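(* Let $(\phi_t)$ be an elliptic holomorphic semigroup in $\mathbb{D}$, not a group, with Denjoy-Wolff point $\tau\in\mathbb{D}$ and spectral value $\lambda\in\mathbb{C}$ with $\operatorname{Re}\lambda>0$. Let $h$ be the associated Königs function and $\sigma\in\partial\mathbb{D}$. The following are equivalent: (1) $\sigma$ is a repelling fixed point of $(\phi_t)$; (2) $\lim_{z\to\sigma}|h(z)|=\infty$ and $\angle\liminf_{z\to\sigma}\mathrm{Arg}_\lambda(h(z))\ne\angle\limsup_{z\to\sigma}\mathrm{Arg}_\lambda(h(z))$; (3) $\lim_{z\to\sigma}|h(z)|=\infty$ and $\liminf_{z\to\sigma}\mathrm{Arg}_\lambda(h(z))\ne\limsup_{z\to\sigma}\mathrm{Arg}_\lambda(h(z))$. Moreover, if $\sigma$ is a repelling fixed point for $(\phi_t)$ with repelling spectral value $\nu\in(-\infty,0)$, then there exists $\theta_0\in[-\pi,\pi)$ such that, if $\{z_n\}\subset\mathbb{D}$ is a sequence converging to $\sigma$ and $\lim_{n\to\infty}\mathrm{Arg}(1-\overline{\sigma}z_n)=\beta\in(-\pi/2,\pi/2)$, then $$\lim_{n\to\infty}\mathrm{Arg}_\lambda(h(z_n))=\theta_0+\frac{\beta|\lambda|^2}{\nu\operatorname{Re}\lambda}\mod[-\pi,\pi),$$ where "mod $[-\pi,\pi)$" means that the angle is taken modulo $2\pi$.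
   Context: $\mathbb{D}$ is the open unit disc in $\mathbb{C}$. A holomorphic semigroup in $\mathbb{D}$ is a family $(\phi_t)_{t\ge0}$ of holomorphic self-maps of $\mathbb{D}$ with $\phi_0=\mathrm{id}$, $\phi_{t+s}=\phi_t\circ\phi_s$, continuous in $t$ for uniform convergence on compacta. It is a group if $\phi_t$ is an automorphism of $\mathbb{D}$ for some (equivalently all) $t>0$. If it is not a group, the Denjoy-Wolff point is the unique $\tau\in\overline{\mathbb{D}}$ with $\phi_t\to\tau$ uniformly on compacta as $t\to+\infty$; the semigroup is elliptic if $\tau\in\mathbb{D}$, and then $\phi_t'(\tau)=e^{-\lambda t}$ with $\operatorname{Re}\lambda>0$, $\lambda$ being the spectral value. $\angle\lim$, $\angle\liminf$, $\angle\limsup$ refer to non-tangential approach; $\lim$, $\liminf$, $\limsup$ as $z\to\sigma$ are unrestricted in $\mathbb{D}$. $\sigma\in\partial\mathbb{D}$ is a repelling fixed point if $\angle\lim_{z\to\sigma}\phi_t(z)=\sigma$ and $\angle\lim_{z\to\sigma}\phi_t'(z)=e^{-\nu t}$ for all $t\ge0$, with some $\nu<0$ (the repelling spectral value at $\sigma$). The Königs function of an elliptic semigroup (not a group) with spectral value $\lambda$ is the univalent map $h:\mathbb{D}\to\mathbb{C}$, unique up to a non-zero multiplicative constant, such that $h(\phi_t(z))=e^{-\lambda t}h(z)$ for all $t\ge0$, $z\in\mathbb{D}$, and $\bigcup_{t\ge0}e^{\lambda t}h(\mathbb{D})=\mathbb{C}$. Every $w\in\mathbb{C}\setminus\{0\}$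 can be written uniquely as $w=e^{-\lambda t+i\theta}$ with $t\in\mathbb{R}$, $\theta\in[-\pi,\pi)$; the $\lambda$-spirallike argument of $w$ is the real number $\mathrm{Arg}_\lambda(w):=\theta\in[-\pi,\pi)$. $\mathrm{Arg}$ is the principal argument.
   Formalization: In (2) and (3) the inequality liminf ≠ limsup is required for c·h for every constant c ≠ 0, since for one fixed normalisation of h the implications (2)⇒(1) and (3)⇒(1) fail, e.g. λ=1, h(z)=log((1+z)/(1−z)), σ=−1. *)

theory Defs
  imports "HOL-Complex_Analysis.Complex_Analysis"
begin

abbreviation unit_disc :: "complex set" where
  "unit_disc \<equiv> ball 0 1"

definition holomorphic_semigroup :: "(real \<Rightarrow> complex \<Rightarrow> complex) \<Rightarrow> bool" where
  "holomorphic_semigroup \<phi> \<longleftrightarrow>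
     (\<forall>t\<ge>0. \<phi> t holomorphic_on unit_disc \<and> \<phi> t ` unit_disc \<subseteq> unit_disc) \<and>
     (\<forall>z\<in>unit_disc. \<phi> 0 z = z) \<and>
     (\<forall>t\<ge>0. \<forall>s\<ge>0. \<forall>z\<in>unit_disc. \<phi> (t + s) z = \<phi> t (\<phi> s z)) \<and>
     (\<forall>t\<ge>0. \<forall>K. compact K \<and> K \<subseteq> unit_disc \<longrightarrow> uniform_limit K \<phi> (\<phi> t) (at t within {0..}))"

definition disc_automorphism :: "(complex \<Rightarrow> complex) \<Rightarrow> bool" where
  "disc_automorphism f \<longleftrightarrow>
     f holomorphic_on unit_disc \<and> f ` unit_disc \<subseteq> unit_disc \<and>
     (\<exists>g. g holomorphic_on unit_disc \<and> g ` unit_disc \<subseteq> unit_disc \<and>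
          (\<forall>z\<in>unit_disc. g (f z) = z \<and> f (g z) = z))"

definition is_group :: "(real \<Rightarrow> complex \<Rightarrow> complex) \<Rightarrow> bool" where
  "is_group \<phi> \<longleftrightarrow> (\<exists>t>0. disc_automorphism (\<phi> t))"

definition Denjoy_Wolff_point :: "(real \<Rightarrow> complex \<Rightarrow> complex) \<Rightarrow> complex \<Rightarrow> bool" where
  "Denjoy_Wolff_point \<phi> \<tau> \<longleftrightarrow> \<tau> \<in> cball 0 1 \<and>
     (\<forall>K. compact K \<and> K \<subseteq> unit_disc \<longrightarrow> uniform_limit K \<phi> (\<lambda>_. \<tau>) at_top)"

definition spectral_value :: "(real \<Rightarrow> complex \<Rightarrow> complex) \<Rightarrow> complex \<Rightarrow> complex \<Rightarrow> bool" where
  "spectral_value \<phi> \<tau> lam \<longleftrightarrow> (\<forall>t\<ge>0. deriv (\<phi> t) \<tau> = exp (- lam * of_real t))"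

definition Stolz_region :: "complex \<Rightarrow> real \<Rightarrow> complex set" where
  "Stolz_region \<sigma> M = {z \<in> unit_disc. cmod (\<sigma> - z) < M * (1 - cmod z)}"

text \<open>Non-tangential approach to a boundary point as a filter: a property holds eventually iff,
  for every \<open>M > 1\<close>, it holds in the Stolz region of amplitude \<open>M\<close> near the point. Hence
  \<open>Liminf (nontangential \<sigma>) f\<close> is the infimum over \<open>M\<close> of the lower limits of \<open>f\<close> along the
  Stolz regions, and dually for \<open>Limsup\<close>.\<close>

definition nontangential :: "complex \<Rightarrow> complex filter" where
  "nontangential \<sigma> = (SUP M\<in>{1<..}. at \<sigma> within Stolz_region \<sigma> M)"

definition repelling_spectral_value ::
    "(real \<Rightarrow> complex \<Rightarrow> complex) \<Rightarrow> complex \<Rightarrow> real \<Rightarrow> bool" where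
  "repelling_spectral_value \<phi> \<sigma> \<nu> \<longleftrightarrow> \<nu> < 0 \<and>
     (\<forall>t\<ge>0. (\<phi> t \<longlongrightarrow> \<sigma>) (nontangential \<sigma>) \<and>
            (deriv (\<phi> t) \<longlongrightarrow> of_real (exp (- \<nu> * t))) (nontangential \<sigma>))"

definition repelling_fixed_point :: "(real \<Rightarrow> complex \<Rightarrow> complex) \<Rightarrow> complex \<Rightarrow> bool" where
  "repelling_fixed_point \<phi> \<sigma> \<longleftrightarrow> (\<exists>\<nu>. repelling_spectral_value \<phi> \<sigma> \<nu>)"

definition Koenigs_function ::
    "(real \<Rightarrow> complex \<Rightarrow> complex) \<Rightarrow> complex \<Rightarrow> (complex \<Rightarrow> complex) \<Rightarrow> bool" where
  "Koenigs_function \<phi> lam h \<longleftrightarrow>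
     h holomorphic_on unit_disc \<and> inj_on h unit_disc \<and>
     (\<forall>t\<ge>0. \<forall>z\<in>unit_disc. h (\<phi> t z) = exp (- lam * of_real t) * h z) \<and>
     (\<Union>t\<in>{0..}. (\<lambda>w. exp (lam * of_real t) * w) ` h ` unit_disc) = UNIV"

text \<open>Well defined for \<open>w \<noteq> 0\<close> and \<open>Re lam \<noteq> 0\<close>.\<close>

definition spiral_Arg :: "complex \<Rightarrow> complex \<Rightarrow> real" where
  "spiral_Arg lam w = (THE \<theta>. - pi \<le> \<theta> \<and> \<theta> < pi \<and>
     (\<exists>t::real. w = exp (- lam * of_real t + \<i> * of_real \<theta>)))"

text \<open>A Koenigs function is determined by its semigroup only up to a non-zero constant factor,
  whereas \<open>spiral_Arg lam \<circ> h\<close> has a jump that depends on this factor. Conditions comparing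
  its lower and upper limits are therefore to be imposed on every Koenigs function \<open>c * h\<close>,
  \<open>c \<noteq> 0\<close>. For one fixed factor they can hold just
  because the values of \<open>h\<close> approach the cut from both sides: with \<open>lam = 1\<close>,
  \<open>h z = Ln ((1 + z) / (1 - z))\<close> and \<open>\<sigma> = -1\<close>, the modulus of \<open>h\<close> tends to infinity and the argument
  has lower limit \<open>-pi\<close> and upper limit \<open>pi\<close>, even non-tangentially, but \<open>\<sigma>\<close> is not repelling,
  as \<open>deriv (\<phi> t)\<close> is unbounded there for \<open>t > 0\<close>.\<close>

end

theory Submission
  imports Defs
begin

text \<open>
  Move the Denjoy--Wolff point to \<open>0\<close> and \<open>\<sigma>\<close> to \<open>1\<close> by a Moebius map and write the Koenigs function as
  \<open>g u = u * exp (lam * l u)\<close>. By the Schwarz lemma \<open>Q u = 1 / lam + u * l' u\<close> has non-negative real part, so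
  by Julia's lemma \<open>(1 - u) * Q u\<close> has a non-tangential limit \<open>A \<ge> 0\<close> at \<open>1\<close>. This \<open>A\<close> is a multiple of the mass at \<open>1\<close> of the
  measure representing \<open>Re Q\<close>, that is, of the increment of the spiral argument of \<open>g\<close> along the circle.
  Subtracting the mass, that is, passing to \<open>l1 u = l u + A * Ln (1 - u)\<close>, leaves a measure without mass at \<open>1\<close>, so
  \<open>Im l1\<close> has an unrestricted limit, and the spiral argument of \<open>g\<close> equals, up to a null function, a constant
  minus \<open>A * \<bar>lam\<bar>\<^sup>2 / Re lam * Arg (1 - u)\<close>. If \<open>A > 0\<close>, then \<open>u * exp (lam * l1 u)\<close>
  is bounded away from \<open>0\<close> because it is spirallike too, so \<open>\<bar>g\<bar>\<close> tends to infinity.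

  In the coordinate \<open>y\<close> with \<open>z = \<sigma> * (1 - exp y)\<close>, non-tangential approach means \<open>Re y \<rightarrow> - \<infinity>\<close> in
  horizontal strips, and there \<open>log h\<close> has derivative close to \<open>- lam * A\<close>. The semigroup translates \<open>log h\<close> by
  \<open>- lam * t\<close>, hence \<open>y\<close> by about \<open>t / A\<close>. So \<open>\<sigma>\<close> is repelling iff \<open>A > 0\<close>, with spectral value
  \<open>- 1 / A\<close>. For \<open>A = 0\<close> the spiral argument converges, and a rotation of \<open>h\<close> moves its limit away from the cut.
\<close>

section \<open>Poisson integral and spiral argument\<close>

lemma Poisson_integral_disc:
  assumes f: "f holomorphic_on cball 0 \<rho>" and z: "cmod z < \<rho>"
  shows "((\<lambda>t. of_real ((\<rho>\<^sup>2 - (cmod z)\<^sup>2) / (cmod (of_real \<rho> * cis t - z))\<^sup>2) * f (of_real \<rho> * cis t))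
           has_integral of_real (2 * pi) * f z) {-pi..pi}"
proof -
  \<comment> \<open>Cauchy's formula applied to \<open>g\<close> is Poisson's formula; the reflection \<open>w \<mapsto> - w\<close> moves the
    parameter interval \<open>{0..2 * pi}\<close> of the circle to \<open>{-pi..pi}\<close>.\<close>
  define g where "g = (\<lambda>w. f (- w) * of_real (\<rho>\<^sup>2 - (cmod z)\<^sup>2) / (of_real (\<rho>\<^sup>2) + cnj z * w))"
  have \<rho>: "\<rho> > 0" using z norm_ge_zero[of z] by linarith
  have nz: "of_real (\<rho>\<^sup>2) + cnj z * w \<noteq> 0" if "cmod w \<le> \<rho>" for w
  proof
    assume "of_real (\<rho>\<^sup>2) + cnj z * w = 0"
    then have "cnj z * w = - of_real (\<rho>\<^sup>2)" by (simp add: add_eq_0_iff)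
    then have "cmod (cnj z * w) = \<rho>\<^sup>2" by (simp add: norm_power)
    moreover have "cmod (cnj z * w) < \<rho> * \<rho>"
      using z that \<rho> by (simp add: norm_mult mult_less_le_imp_less le_less_trans[OF mult_left_mono[OF that]])
    ultimately show False by (simp add: power2_eq_square)
  qed
  have "g holomorphic_on cball 0 \<rho>"
    unfolding g_def using nz
    by (intro holomorphic_intros holomorphic_on_compose_gen[OF _ f, of uminus, unfolded o_def]) auto
  from Cauchy_integral_circlepath_simple[OF this, of "- z"] z
  have "((\<lambda>u. g u / (u + z)) has_contour_integral (2 * of_real pi * \<i> * g (-z))) (circlepath 0 \<rho>)"
    by simp
  then have I: "((\<lambda>t. g (of_real \<rho> * cis t) / (of_real \<rho> * cis t + z) * \<rho> * \<i> * cis t) has_integral (2 * of_real pi * \<i> * g (-z))) {0..2*pi}"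
    unfolding circlepath_def by (subst (asm) has_contour_integral_part_circlepath_iff) auto
  have gz: "g (- z) = f z"
    using nz[of "-z"] z by (simp add: g_def complex_norm_square mult.commute flip: of_real_power)
  \<comment> \<open>On the circle |w| = \<rho> one has \<rho>^2 = w * cnj w, so the denominator of
    \<open>g\<close> at - w equals w * cnj (w - z). Together with the Cauchy denominator z - w it
    yields |w - z|^2, the denominator of the Poisson kernel.\<close>
  have E: "g (of_real \<rho> * cis (t + pi)) / (of_real \<rho> * cis (t + pi) + z) * \<rho> * \<i> * cis (t + pi) / \<i>
      = of_real ((\<rho>\<^sup>2 - (cmod z)\<^sup>2) / (cmod (of_real \<rho> * cis t - z))\<^sup>2) * f (of_real \<rho> * cis t)" for t
  proof -
    define w where "w = of_real \<rho> * cis t"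
    have c: "cis (t + pi) = - cis t" by (simp add: cis_mult[symmetric])
    have w2: "of_real (\<rho>\<^sup>2) = w * cnj w"
      using \<rho> complex_norm_square[of w] by (simp add: w_def norm_mult)
    have nw: "cmod w = \<rho>" using \<rho> by (simp add: w_def norm_mult)
    have a: "w - z \<noteq> 0" using nw z by auto
    have b: "of_real (\<rho>\<^sup>2) - cnj z * w \<noteq> 0" using nz[of "-w"] nw by simp
    have "of_real ((cmod (w - z))\<^sup>2) = (w - z) * (cnj w - cnj z)"
      by (simp add: complex_norm_square[symmetric] flip: complex_cnj_diff of_real_power)
    moreover have "of_real (\<rho>\<^sup>2) - cnj z * w = w * (cnj w - cnj z)" unfolding w2 by (simp add: algebra_simps)
    ultimately show ?thesis
      using a b unfolding c g_def by (simp add: w_def[symmetric] divide_simps) (simp add: field_simps w_def)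
  qed
  have "((\<lambda>t. 1 / \<i> * (g (of_real \<rho> * cis (t + pi)) / (of_real \<rho> * cis (t + pi) + z) * \<rho> * \<i> * cis (t + pi)))
          has_integral 1 / \<i> * (2 * of_real pi * \<i> * g (-z))) {-pi..pi}"
    using has_integral_mult_right[OF has_integral_shift_real_ivl[OF I, of pi], of "1/\<i>"] by simp
  moreover have "1 / \<i> * (2 * of_real pi * \<i> * g (-z)) = of_real (2 * pi) * f z"
    by (simp add: gz)
  moreover have "1 / \<i> * (g (of_real \<rho> * cis (t + pi)) / (of_real \<rho> * cis (t + pi) + z) * \<rho> * \<i> * cis (t + pi))
      = of_real ((\<rho>\<^sup>2 - (cmod z)\<^sup>2) / (cmod (of_real \<rho> * cis t - z))\<^sup>2) * f (of_real \<rho> * cis t)" for t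
    using E[of t] by simp
  ultimately show ?thesis by (simp only:)
qed

text \<open>In the coordinate \<open>X\<close>, a logarithm divided by \<open>lam\<close>, the
  spirals are horizontal lines, so the spiral argument is, modulo 2 pi, a fixed multiple of
  \<open>Im X\<close>. This turns later claims on spiral arguments into claims on imaginary parts,
  and \<open>cis\<close> avoids the cut.\<close>

lemma spiral_Arg_exp:
  assumes lam: "Re lam > 0"
  shows "spiral_Arg lam (exp (lam * X)) \<in> {-pi..<pi}"
    and "cis (spiral_Arg lam (exp (lam * X))) = cis (Im X * (cmod lam)\<^sup>2 / Re lam)"
proof -
  define a where "a = Im X * (cmod lam)\<^sup>2 / Re lam"
  define P where "P = (\<lambda>\<theta>. - pi \<le> \<theta> \<and> \<theta> < pi \<and> (\<exists>t::real. exp (lam * X) = exp (- lam * of_real t + \<i> * of_real \<theta>)))"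
  obtain k :: int where k: "- pi \<le> a + 2 * pi * k" "a + 2 * pi * k < pi"
  proof -
    define k where "k = - floor ((a + pi) / (2 * pi))"
    have "floor ((a + pi) / (2 * pi)) \<le> (a + pi) / (2 * pi)" "(a + pi) / (2 * pi) < floor ((a + pi) / (2 * pi)) + 1"
      by linarith+
    then have "floor ((a + pi) / (2 * pi)) * (2 * pi) \<le> a + pi" "a + pi < (floor ((a + pi) / (2 * pi)) + 1) * (2 * pi)"
      using pi_gt_zero by (simp_all only: pos_le_divide_eq[of "2 * pi"] pos_divide_less_eq[of "2 * pi"] of_int_add of_int_1)
    then show ?thesis by (intro that[of k]) (simp_all add: k_def algebra_simps)
  qed
  define \<theta> where "\<theta> = a + 2 * pi * k"
  \<comment> \<open>The real part of lam * X = - lam * t + i * a forces this value of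
    \<open>t\<close>; the imaginary part then gives \<open>a\<close>.\<close>
  define t where "t = Im lam * Im X / Re lam - Re X"
  have "lam * X = - lam * of_real t + \<i> * of_real a"
    using lam by (simp add: complex_eq_iff t_def a_def cmod_power2) (simp add: field_simps power2_eq_square)
  then have "exp (lam * X) = exp (- lam * of_real t + \<i> * of_real a) * cis (2 * pi * k)" by simp
  also have "\<dots> = exp (- lam * of_real t + \<i> * of_real \<theta>)"
    unfolding cis_conv_exp mult_exp_exp by (simp add: \<theta>_def algebra_simps)
  finally have ex: "exp (lam * X) = exp (- lam * of_real t + \<i> * of_real \<theta>)" .
  have uniq: "\<theta>' = \<theta>" if "P \<theta>'" for \<theta>'
  proof -
    from that obtain s where s: "exp (lam * X) = exp (- lam * of_real s + \<i> * of_real \<theta>')"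
      and \<theta>': "- pi \<le> \<theta>'" "\<theta>' < pi" unfolding P_def by auto
    obtain n where n: "- lam * of_real t + \<i> * of_real \<theta> = - lam * of_real s + \<i> * of_real \<theta>' + (of_int (2 * n) * pi) * \<i>"
      using s unfolding ex exp_eq by auto
    have "Re lam * t = Re lam * s" using arg_cong[OF n, of Re] by simp
    then have "t = s" using lam by simp
    then have "\<theta> - \<theta>' = of_int n * (2 * pi)" using arg_cong[OF n, of Im] by simp
    moreover have "\<bar>\<theta> - \<theta>'\<bar> < 2 * pi" using \<theta>' k unfolding \<theta>_def by linarith
    ultimately have "\<bar>of_int n * (2 * pi)\<bar> < 1 * (2 * pi)" by simp
    then have "\<bar>real_of_int n\<bar> < 1" unfolding abs_mult by simp
    then have "n = 0" by linarith
    then show ?thesis using \<open>\<theta> - \<theta>' = of_int n * (2 * pi)\<close> by simp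
  qed
  have "P \<theta>" unfolding P_def using k ex by (auto simp: \<theta>_def)
  then have "spiral_Arg lam (exp (lam * X)) = \<theta>"
    unfolding spiral_Arg_def P_def[symmetric] using uniq by blast
  moreover have "cis \<theta> = cis a" unfolding \<theta>_def by (simp flip: cis_mult)
  ultimately show "spiral_Arg lam (exp (lam * X)) \<in> {-pi..<pi}"
    "cis (spiral_Arg lam (exp (lam * X))) = cis (Im X * (cmod lam)\<^sup>2 / Re lam)"
    using k by (auto simp: \<theta>_def a_def)
qed

text \<open>At 0 the derivative of |c s|^2 is 2 * |c 0|^2 * Re q, so the sign of the real part of
  the logarithmic derivative \<open>q\<close> decides whether the modulus grows or shrinks.\<close>

lemma eventually_norm_at_right_0:
  fixes c :: "real \<Rightarrow> complex"
  assumes "(c has_vector_derivative c 0 * q) (at 0)" and "c 0 \<noteq> 0"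
  shows "Re q < 0 \<Longrightarrow> \<forall>\<^sub>F s in at_right 0. cmod (c s) < cmod (c 0)"
    and "Re q > 0 \<Longrightarrow> \<forall>\<^sub>F s in at_right 0. cmod (c s) > cmod (c 0)"
proof -
  let ?f = "\<lambda>s. (cmod (c s))\<^sup>2"
  have "((\<lambda>s. Re (c s)) has_real_derivative Re (c 0 * q)) (at 0)"
       "((\<lambda>s. Im (c s)) has_real_derivative Im (c 0 * q)) (at 0)"
    using assms by (auto simp: has_vector_derivative_complex_iff)
  from DERIV_add[OF DERIV_power[OF this(1), of 2] DERIV_power[OF this(2), of 2]]
  have D: "(?f has_real_derivative 2 * (cmod (c 0))\<^sup>2 * Re q) (at 0)"
    unfolding cmod_power2 by (rule DERIV_cong) (simp add: algebra_simps power2_eq_square)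
  have iff: "a < b \<longleftrightarrow> a\<^sup>2 < b\<^sup>2" if "0 \<le> a" "0 \<le> b" for a b :: real
    using that by (meson power_less_imp_less_base power_strict_mono zero_less_numeral)
  show "\<forall>\<^sub>F s in at_right 0. cmod (c s) < cmod (c 0)" if "Re q < 0"
    using has_real_derivative_neg_dec_right[OF D] that assms(2)
    unfolding iff[OF norm_ge_zero norm_ge_zero] by (auto simp: eventually_at_right_field mult_pos_neg)
  show "\<forall>\<^sub>F s in at_right 0. cmod (c s) > cmod (c 0)" if "Re q > 0"
    using has_real_derivative_pos_inc_right[OF D] that assms(2)
    unfolding iff[OF norm_ge_zero norm_ge_zero] by (auto simp: eventually_at_right_field)
qed

text \<open>
  Moving from \<open>p\<close> in the direction \<open>- p / lam\<close> decreases both \<open>\<bar>u\<bar>\<close> and the modulus of the function, so its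
  minimum over an annulus lies on the inner circle.
\<close>

lemma norm_spiral_lower_bound:
  fixes l :: "complex \<Rightarrow> complex"
  assumes l: "l holomorphic_on ball 0 1" and lam: "Re lam > 0"
    and pos: "\<And>u. u \<in> ball 0 1 \<Longrightarrow> Re (1 / lam + u * deriv l u) > 0"
  shows "\<exists>\<delta>>0. \<forall>u. 1/2 \<le> cmod u \<and> cmod u < 1 \<longrightarrow> \<delta> \<le> cmod (u * exp (lam * l u))"
proof -
  define f where "f = (\<lambda>u. u * exp (lam * l u))"
  have f: "f holomorphic_on ball 0 1" unfolding f_def by (intro holomorphic_intros l)
  have contf: "continuous_on (ball 0 1) (\<lambda>u. cmod (f u))"
    by (intro continuous_intros holomorphic_on_imp_continuous_on f)
  have "\<exists>v\<in>sphere 0 (1/2). \<forall>w\<in>sphere 0 (1/2). cmod (f v) \<le> cmod (f w)"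
    by (rule continuous_attains_inf) (auto intro: continuous_on_subset[OF contf])
  then obtain v where v: "cmod v = 1/2" and vmin: "\<And>w. cmod w = 1/2 \<Longrightarrow> cmod (f v) \<le> cmod (f w)"
    by auto
  have "cmod (f v) \<le> cmod (f u)" if u: "1/2 \<le> cmod u" "cmod u < 1" for u
  proof -
    define K where "K = cball 0 (cmod u) - ball (0::complex) (1/2)"
    have "compact K" unfolding K_def by (intro compact_diff) auto
    moreover have "u \<in> K" using u by (auto simp: K_def)
    moreover have KD: "K \<subseteq> ball 0 1" using u by (auto simp: K_def)
    ultimately obtain p where p: "p \<in> K" and pmin: "\<And>w. w \<in> K \<Longrightarrow> cmod (f p) \<le> cmod (f w)"
      using continuous_attains_inf[of K "\<lambda>u. cmod (f u)"] continuous_on_subset[OF contf KD] by blast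
    have "cmod p = 1/2"
    proof (rule ccontr)
      assume "cmod p \<noteq> 1/2"
      then have p2: "cmod p > 1/2" "cmod p \<le> cmod u" using p by (auto simp: K_def)
      have p0: "p \<noteq> 0" and pD: "p \<in> ball 0 1" using p2 u by auto
      define w where "w = (\<lambda>s. p * (1 - of_real s / lam))"
      define q where "q = 1 / lam + p * deriv l p"
      have lam0: "lam \<noteq> 0" using lam by auto
      have f0: "f p \<noteq> 0" using p0 by (simp add: f_def)
      have w': "(w has_vector_derivative (- p / lam)) (at 0)"
        unfolding w_def by (auto intro!: derivative_eq_intros simp: field_simps)
      have l': "(l has_field_derivative deriv l p) (at p)"
        using l pD by (simp add: holomorphic_derivI)
      \<comment> \<open>Since f' / f = lam * q / p, the velocity - p / lam of \<open>w\<close> turns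
        into the logarithmic derivative - q for f along \<open>w\<close>, while that of
        \<open>w\<close> itself is - 1 / lam. Both have negative real part.\<close>
      have "(f has_field_derivative lam * f p / p * q) (at (w 0))"
        unfolding f_def w_def q_def using lam0 p0
        by (auto intro!: derivative_eq_intros l' simp: field_simps)
      from field_vector_diff_chain_at[OF w' this]
      have "((\<lambda>s. f (w s)) has_vector_derivative f (w 0) * (- q)) (at 0)"
        using lam0 p0 by (simp add: o_def w_def)
      then have 1: "\<forall>\<^sub>F s in at_right 0. cmod (f (w s)) < cmod (f (w 0))"
        by (rule eventually_norm_at_right_0) (use f0 pos[OF pD] in \<open>auto simp: q_def w_def\<close>)
      have "Re (- (1 / lam)) < 0"
        using lam by (simp add: Re_divide sum_power2_gt_zero_iff)
      then have 2: "\<forall>\<^sub>F s in at_right 0. cmod (w s) < cmod (w 0)"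
        using p0 lam w' by (intro eventually_norm_at_right_0[of _ "- (1 / lam)"]) (auto simp: w_def)
      have "((\<lambda>s. cmod (w s)) \<longlongrightarrow> cmod (w 0)) (at_right 0)"
        unfolding w_def using lam0 by (auto intro!: tendsto_eq_intros)
      then have 3: "\<forall>\<^sub>F s in at_right 0. cmod (w s) > 1/2"
        by (rule order_tendstoD) (use p2 in \<open>simp add: w_def\<close>)
      obtain s where s: "cmod (f (w s)) < cmod (f p)" "cmod (w s) < cmod p" "cmod (w s) > 1/2"
        using eventually_happens[OF eventually_conj[OF 1 eventually_conj[OF 2 3]]] by (auto simp: w_def)
      then have "w s \<in> K" using p2 by (auto simp: K_def)
      then show False using pmin s(1) by fastforce
    qed
    then show ?thesis using vmin[of p] pmin[OF \<open>u \<in> K\<close>] by linarith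
  qed
  moreover have "cmod (f v) > 0" using v by (auto simp: f_def)
  ultimately show ?thesis unfolding f_def by blast
qed

section \<open>Julia's lemma for functions with non-negative real part\<close>

lemma tendsto_nontangential_iff:
  "(f \<longlongrightarrow> l) (nontangential \<sigma>) \<longleftrightarrow> (\<forall>M>1. (f \<longlongrightarrow> l) (at \<sigma> within Stolz_region \<sigma> M))"
  unfolding nontangential_def tendsto_def eventually_Sup by auto

lemma one_minus_norm_Moebius_square:
  assumes "cmod a < 1" "cmod u < 1"
  shows "1 - (cmod (Moebius_function 0 a u))\<^sup>2 = (1 - (cmod u)\<^sup>2) * (1 - (cmod a)\<^sup>2) / (cmod (1 - cnj a * u))\<^sup>2"
proof -
  have "(cmod (1 - cnj a * u))\<^sup>2 - (cmod (u - a))\<^sup>2 = (1 - (cmod u)\<^sup>2) * (1 - (cmod a)\<^sup>2)"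
    unfolding cmod_power2 by (simp add: algebra_simps power2_eq_square)
  moreover have "cmod (cnj a * u) < 1" using assms norm_mult_less[of "cnj a" 1 u 1] by simp
  then have "1 - (cmod (Moebius_function 0 a u))\<^sup>2 = ((cmod (1 - cnj a * u))\<^sup>2 - (cmod (u - a))\<^sup>2) / (cmod (1 - cnj a * u))\<^sup>2"
    unfolding diff_divide_distrib by (auto simp: Moebius_function_simple norm_divide power_divide)
  ultimately show ?thesis by (simp only:)
qed

text \<open>Conjugating by a Moebius map that brings \<open>a\<close> to 0 and by a Cayley transform
  that brings \<open>F a\<close> to 0 leads to the Schwarz lemma. The result bounds
  \<open>F u\<close> itself, up to the constant imaginary part of \<open>F a\<close>, by a multiple
  of \<open>Re (F a)\<close>; this is what makes it useful when \<open>Re (F a)\<close> is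
  small.\<close>

lemma half_plane_Schwarz_Pick_pos:
  assumes F: "F holomorphic_on ball 0 1" and pos: "\<And>z. z \<in> ball 0 1 \<Longrightarrow> Re (F z) > 0"
    and a: "a \<in> ball 0 1" and u: "u \<in> ball 0 1"
  shows "cmod (F u - \<i> * Im (F a)) \<le> Re (F a) * (4 * (cmod (1 - cnj a * u))\<^sup>2 / ((1 - (cmod u)\<^sup>2) * (1 - (cmod a)\<^sup>2)))"
proof -
  define f where "f = (\<lambda>s. (F (Moebius_function 0 (-a) s) - F a) / (F (Moebius_function 0 (-a) s) + cnj (F a)))"
  define s where "s = Moebius_function 0 a u"
  have mD: "Moebius_function 0 (-a) z \<in> ball 0 1" if "z \<in> ball 0 1" for z
    using Moebius_function_norm_lt_1[of "-a" z] a that by simp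
  have nz: "F z + cnj (F a) \<noteq> 0" if "z \<in> ball 0 1" for z
    using pos[OF that] pos[OF a] by (auto simp: complex_eq_iff)
  have "F \<circ> Moebius_function 0 (-a) holomorphic_on ball 0 1"
    using Moebius_function_holomorphic[of "-a" 0] a mD
    by (intro holomorphic_on_compose_gen[OF _ F]) auto
  then have "f holomorphic_on ball 0 1"
    unfolding f_def o_def by (intro holomorphic_intros) (use nz mD in auto)
  moreover have "f 0 = 0" by (simp add: f_def Moebius_function_of_zero)
  moreover have "cmod (f z) < 1" if "cmod z < 1" for z
  proof -
    define b where "b = Moebius_function 0 (-a) z"
    have "b \<in> ball 0 1" using mD that by (simp add: b_def)
    \<comment> \<open>The two squares differ by 4 * Re (F b) * Re (F a).\<close>
    then have "(cmod (F b - F a))\<^sup>2 < (cmod (F b + cnj (F a)))\<^sup>2"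
      using mult_pos_pos[OF pos pos[OF a], of b] unfolding cmod_power2 by (simp add: algebra_simps power2_eq_square)
    then have "cmod (F b - F a) < cmod (F b + cnj (F a))" by (rule power_less_imp_less_base) simp
    then show ?thesis using nz[OF \<open>b \<in> ball 0 1\<close>] by (simp add: f_def b_def[symmetric] norm_divide)
  qed
  moreover have s1: "cmod s < 1" using Moebius_function_norm_lt_1 a u by (simp add: s_def)
  ultimately have "cmod (f s) \<le> cmod s" by (rule Schwarz_Lemma(1))
  moreover have "Moebius_function 0 (-a) s = u"
    unfolding s_def using a u by (intro Moebius_function_compose) auto
  ultimately have le: "cmod (F u - F a) \<le> cmod s * cmod (F u + cnj (F a))"
    using nz[OF u] by (simp add: f_def norm_divide field_simps)
  define x where "x = F u - \<i> * Im (F a)"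
  define r where "r = Re (F a)"
  have r: "r > 0" using pos[OF a] by (simp add: r_def)
  have "F u - F a = x - r" "F u + cnj (F a) = x + r" by (simp_all add: x_def r_def complex_eq_iff)
  then have "cmod (x - r) \<le> cmod s * cmod (x + r)" using le by simp
  moreover have "cmod x - r \<le> cmod (x - r)" using norm_triangle_ineq2[of x "of_real r"] r by simp
  moreover have "cmod (x + r) \<le> cmod x + r" using norm_triangle_ineq[of x "of_real r"] r by simp
  ultimately have "cmod x - r \<le> cmod s * (cmod x + r)"
    by (meson mult_left_mono norm_ge_zero order_trans)
  then have "cmod x * (1 - cmod s) \<le> r * (1 + cmod s)" by (simp add: algebra_simps)
  \<comment> \<open>The extra factor 1 + |s| produces 1 - |s|^2, which the Moebius identity
    evaluates. The crude bound 1 + |s| \<le> 2 is the source of the constant 4.\<close>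
  then have "cmod x * (1 - cmod s) * (1 + cmod s) \<le> r * (1 + cmod s) * (1 + cmod s)"
    by (intro mult_right_mono) auto
  also have "\<dots> = r * (1 + cmod s)\<^sup>2" by (simp add: power2_eq_square)
  also have "\<dots> \<le> r * 2\<^sup>2" using r s1 by (intro mult_left_mono power_mono) auto
  finally have "cmod x * (1 - (cmod s)\<^sup>2) \<le> 4 * r" by (simp add: algebra_simps power2_eq_square)
  moreover have "1 - (cmod s)\<^sup>2 = (1 - (cmod u)\<^sup>2) * (1 - (cmod a)\<^sup>2) / (cmod (1 - cnj a * u))\<^sup>2"
    unfolding s_def using a u by (intro one_minus_norm_Moebius_square) auto
  moreover have "(1 - (cmod u)\<^sup>2) * (1 - (cmod a)\<^sup>2) / (cmod (1 - cnj a * u))\<^sup>2 > 0"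
    using s1 calculation(2) by (metis abs_norm_cancel abs_square_less_1 diff_gt_0_iff_gt)
  ultimately have "cmod x \<le> 4 * r / ((1 - (cmod u)\<^sup>2) * (1 - (cmod a)\<^sup>2) / (cmod (1 - cnj a * u))\<^sup>2)"
    by (simp only: pos_le_divide_eq)
  then show ?thesis
    unfolding x_def[symmetric] r_def[symmetric] by (simp add: ac_simps)
qed

text \<open>Adding a small e > 0 to \<open>F\<close> restores strict positivity of the real part,
  and both sides of the inequality are continuous in e.\<close>

lemma half_plane_Schwarz_Pick:
  assumes F: "F holomorphic_on ball 0 1" and nonneg: "\<And>z. z \<in> ball 0 1 \<Longrightarrow> Re (F z) \<ge> 0"
    and a: "a \<in> ball 0 1" and u: "u \<in> ball 0 1"
  shows "cmod (F u - \<i> * Im (F a)) \<le> Re (F a) * (4 * (cmod (1 - cnj a * u))\<^sup>2 / ((1 - (cmod u)\<^sup>2) * (1 - (cmod a)\<^sup>2)))"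
    (is "_ \<le> _ * ?k")
proof (rule tendsto_le[OF trivial_limit_at_right_real])
  show "((\<lambda>e. Re (F a + of_real e) * ?k) \<longlongrightarrow> Re (F a) * ?k) (at_right (0::real))"
    by (rule tendsto_eq_intros refl | simp)+
  show "((\<lambda>e. cmod ((F u + of_real e) - \<i> * Im (F a + of_real e))) \<longlongrightarrow> cmod (F u - \<i> * Im (F a))) (at_right (0::real))"
    by (auto intro!: tendsto_eq_intros)
  show "\<forall>\<^sub>F e in at_right 0. cmod ((F u + of_real e) - \<i> * Im (F a + of_real e)) \<le> Re (F a + of_real e) * ?k"
    using eventually_at_right_less
  proof eventually_elim
    case (elim e)
    show ?case
      by (rule half_plane_Schwarz_Pick_pos[of "\<lambda>z. F z + of_real e"])
         (use elim a u nonneg in \<open>auto intro!: holomorphic_intros F add_nonneg_pos\<close>)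
  qed
qed

lemma Re_Cayley: "Re ((1 + u) / (1 - u)) = (1 - (cmod u)\<^sup>2) / (cmod (1 - u))\<^sup>2"
  unfolding Re_divide cmod_power2 by (simp add: algebra_simps power2_eq_square)

text \<open>The quotient \<open>J\<close> of \<open>Re F\<close> by the Poisson kernel at 1 has
  infimum A / 2. Subtracting that multiple of the Cayley function leaves \<open>G\<close> with
  non-negative real part and quotient of infimum 0. The Schwarz-Pick bound for \<open>G\<close>,
  based at a point where the quotient is nearly minimal, then shows that (1 - u) * G u tends to 0 in
  every Stolz region.\<close>

lemma Julia_half_plane:
  assumes F: "F holomorphic_on ball 0 1" and nonneg: "\<And>z. z \<in> ball 0 1 \<Longrightarrow> Re (F z) \<ge> 0"
  obtains A where "A \<ge> 0" "\<And>u. u \<in> ball 0 1 \<Longrightarrow> Re (F u - of_real (A / 2) * ((1 + u) / (1 - u))) \<ge> 0"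
    "((\<lambda>u. (1 - u) * F u) \<longlongrightarrow> of_real A) (nontangential 1)"
proof -
  define J where "J = (\<lambda>u. Re (F u) * (cmod (1 - u))\<^sup>2 / (1 - (cmod u)\<^sup>2))"
  define A where "A = 2 * (INF u\<in>ball 0 1. J u)"
  have lt: "1 - (cmod u)\<^sup>2 > 0" "cmod (1 - u) > 0" if "u \<in> ball 0 1" for u :: complex
    using that by (auto simp: abs_square_less_1)
  have J0: "J u \<ge> 0" if "u \<in> ball 0 1" for u
    unfolding J_def using lt[OF that] nonneg[OF that] by simp
  have bdd: "bdd_below (J ` ball 0 1)" using J0 by (intro bdd_belowI2[of _ 0]) auto
  have A0: "A \<ge> 0" unfolding A_def using J0 by (auto intro: cINF_greatest)
  define G where "G = (\<lambda>u. F u - of_real (A / 2) * ((1 + u) / (1 - u)))"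
  have ReG: "Re (G u) = (J u - A / 2) * ((1 - (cmod u)\<^sup>2) / (cmod (1 - u))\<^sup>2)" if "u \<in> ball 0 1" for u
  proof -
    have "Re (G u) = Re (F u) - (A / 2) * Re ((1 + u) / (1 - u))"
      unfolding G_def minus_complex.sel times_complex.sel[of "of_real _"] by simp
    also have "Re (F u) = J u * ((1 - (cmod u)\<^sup>2) / (cmod (1 - u))\<^sup>2)"
      using lt[OF that] unfolding J_def by (simp del: right_minus_eq)
    finally show ?thesis unfolding Re_Cayley by (simp add: left_diff_distrib diff_divide_distrib)
  qed
  have G0: "Re (G u) \<ge> 0" if "u \<in> ball 0 1" for u
    unfolding ReG[OF that] using cINF_lower[OF bdd that] lt[OF that] by (simp add: A_def)
  have G: "G holomorphic_on ball 0 1" unfolding G_def by (intro holomorphic_intros F) auto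
  have "((\<lambda>u. (1 - u) * G u) \<longlongrightarrow> 0) (at 1 within Stolz_region 1 M)" if M: "M > 1" for M
  proof (rule tendstoI, simp only: dist_0_norm dist_norm diff_zero)
    fix e :: real assume e: "e > 0"
    \<comment> \<open>The tolerance e / (4 * M) is chosen to make the majorant \<open>b\<close>
      below smaller than e at 1, where its value is 4 * M * (J a - A / 2).\<close>
    have "(INF u\<in>ball 0 1. J u) < A / 2 + e / (4 * M)" using e M by (simp add: A_def)
    then obtain a where a: "a \<in> ball 0 1" and Ja: "J a < A / 2 + e / (4 * M)"
      using bdd by (subst (asm) cINF_less_iff) auto
    \<comment> \<open>This is the Schwarz-Pick bound for (1 - u) * G u, with |1 - u| / (1 - |u|^2)
      replaced by its bound M in the Stolz region. In contrast to the original bound it is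
      continuous at u = 1.\<close>
    define b where "b = (\<lambda>u. cmod (1 - u) * \<bar>Im (G a)\<bar> + 4 * M * (Re (G a) * (cmod (1 - cnj a * u))\<^sup>2 / (1 - (cmod a)\<^sup>2)))"
    have "(cmod (1 - cnj a))\<^sup>2 = (cmod (1 - a))\<^sup>2" by (metis complex_cnj_diff complex_cnj_one complex_mod_cnj)
    then have "b 1 = 4 * M * (J a - A / 2)"
      unfolding b_def ReG[OF a] using lt[OF a] by simp
    also have "\<dots> < e" using Ja M by (simp add: field_simps)
    finally have "b 1 < e" .
    moreover have "(b \<longlongrightarrow> b 1) (at 1 within Stolz_region 1 M)"
      unfolding b_def by (intro tendsto_intros) (use lt[OF a] in auto)
    ultimately have "\<forall>\<^sub>F u in at 1 within Stolz_region 1 M. b u < e"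
      by (intro order_tendstoD)
    moreover have "\<forall>\<^sub>F u in at 1 within Stolz_region 1 M. u \<in> Stolz_region 1 M"
      by (simp add: eventually_at_filter)
    ultimately show "\<forall>\<^sub>F u in at 1 within Stolz_region 1 M. cmod ((1 - u) * G u) < e"
    proof eventually_elim
      case (elim u)
      then have u: "u \<in> ball 0 1" and uM: "cmod (1 - u) < M * (1 - cmod u)" by (auto simp: Stolz_region_def)
      have "1 - cmod u \<le> 1 - (cmod u)\<^sup>2" using u by (simp add: power2_eq_square mult_left_le)
      then have "M * (1 - cmod u) \<le> M * (1 - (cmod u)\<^sup>2)" using M by (intro mult_left_mono) auto
      then have *: "cmod (1 - u) / (1 - (cmod u)\<^sup>2) \<le> M"
        using uM lt[OF u] by (simp add: divide_le_eq)
      have "cmod (G u) \<le> cmod (G u - \<i> * Im (G a)) + cmod (\<i> * Im (G a))"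
        by (metis diff_add_cancel norm_triangle_ineq)
      also have "\<dots> \<le> Re (G a) * (4 * (cmod (1 - cnj a * u))\<^sup>2 / ((1 - (cmod u)\<^sup>2) * (1 - (cmod a)\<^sup>2))) + \<bar>Im (G a)\<bar>"
        using half_plane_Schwarz_Pick[OF G G0 a u] by (simp add: norm_mult)
      finally have "cmod ((1 - u) * G u) \<le> cmod (1 - u) * (Re (G a) * (4 * (cmod (1 - cnj a * u))\<^sup>2 / ((1 - (cmod u)\<^sup>2) * (1 - (cmod a)\<^sup>2))) + \<bar>Im (G a)\<bar>)"
        unfolding norm_mult by (rule mult_left_mono) simp
      also have "\<dots> = cmod (1 - u) * \<bar>Im (G a)\<bar> + (cmod (1 - u) / (1 - (cmod u)\<^sup>2)) * (4 * (Re (G a) * (cmod (1 - cnj a * u))\<^sup>2 / (1 - (cmod a)\<^sup>2)))"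
        by (simp add: field_simps)
      also have "\<dots> \<le> cmod (1 - u) * \<bar>Im (G a)\<bar> + M * (4 * (Re (G a) * (cmod (1 - cnj a * u))\<^sup>2 / (1 - (cmod a)\<^sup>2)))"
        using * G0[OF a] lt[OF a] by (intro add_left_mono mult_right_mono) auto
      also have "\<dots> = b u" by (simp add: b_def)
      finally show ?case using elim by simp
    qed
  qed
  then have 1: "((\<lambda>u. (1 - u) * G u) \<longlongrightarrow> 0) (nontangential 1)" by (simp add: tendsto_nontangential_iff)
  have 2: "((\<lambda>u. of_real (A / 2) * (1 + u)) \<longlongrightarrow> of_real A) (nontangential 1)"
    unfolding tendsto_nontangential_iff by (auto intro!: tendsto_eq_intros)
  have "((\<lambda>u. (1 - u) * F u) \<longlongrightarrow> of_real A) (nontangential 1)"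
  proof (rule Lim_transform_eventually[OF tendsto_add[OF 1 2, unfolded add_0_left]])
    show "\<forall>\<^sub>F u in nontangential 1. (1 - u) * G u + of_real (A / 2) * (1 + u) = (1 - u) * F u"
      unfolding nontangential_def eventually_Sup
      by (auto simp: eventually_at_filter G_def Stolz_region_def field_simps)
  qed
  then show ?thesis using that A0 G0 by (auto simp: G_def)
qed

section \<open>Unrestricted limits in the absence of a point mass\<close>

text \<open>Arbitrarily small oscillation makes the image filter a Cauchy filter, which converges by
  completeness; no candidate for the limit is required.\<close>

lemma ex_tendsto_if_small_oscillation:
  fixes f :: "'a \<Rightarrow> real"
  assumes "F \<noteq> bot" and osc: "\<And>e. e > 0 \<Longrightarrow> \<exists>c. \<forall>\<^sub>F u in F. \<bar>f u - c\<bar> < e"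
  shows "\<exists>v. (f \<longlongrightarrow> v) F"
proof -
  have "cauchy_filter (filtermap f F)"
    unfolding cauchy_filter_metric_filtermap
  proof (intro allI impI)
    fix e :: real assume "e > 0"
    then obtain c where c: "\<forall>\<^sub>F u in F. \<bar>f u - c\<bar> < e / 2" using osc[of "e / 2"] by auto
    then show "\<exists>P. eventually P F \<and> (\<forall>x y. P x \<and> P y \<longrightarrow> dist (f x) (f y) < e)"
      by (intro exI[of _ "\<lambda>u. \<bar>f u - c\<bar> < e / 2"]) (auto simp: dist_real_def abs_if split: if_splits)
  qed
  then obtain v where "filtermap f F \<le> nhds v"
    using cauchy_filter_complete_converges[of "filtermap f F" UNIV] assms(1) by (auto simp: complete_UNIV filtermap_bot_iff)
  then show ?thesis by (auto simp: filterlim_def)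
qed

text \<open>
  The hypothesis \<open>atom\<close> says that the measure representing \<open>Re (u * l' u)\<close> has no mass at \<open>1\<close>. On circles of radius
  near \<open>1\<close> the variation of \<open>Im l\<close> over a short arc around \<open>1\<close> is then small by Poisson's formula for
  \<open>Re (u * l' u)\<close>, and Poisson's formula for \<open>Im l\<close> compares the values at different radii.
\<close>

lemma tendsto_Im_at_1_if_no_atom:
  fixes l :: "complex \<Rightarrow> complex"
  assumes l: "l holomorphic_on ball 0 1"
    and B: "B \<ge> 0" "\<And>u. u \<in> ball 0 1 \<Longrightarrow> Re (u * deriv l u) \<ge> - B"
    and atom: "((\<lambda>x. (1 - x) * Re (of_real x * deriv l (of_real x))) \<longlongrightarrow> 0) (at_left 1)"
  shows "\<exists>v. ((\<lambda>u. Im (l u)) \<longlongrightarrow> v) (at 1 within ball 0 1)"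
proof -
  define P where "P = (\<lambda>u. Re (u * deriv l u) + B)"
  define w where "w = (\<lambda>\<rho> t. Im (l (of_real \<rho> * cis t)))"
  define K where "K = (\<lambda>\<rho> x t. (\<rho>\<^sup>2 - x\<^sup>2) / (cmod (of_real \<rho> * cis t - of_real x))\<^sup>2)"
  have chord: "cmod (cis t - 1) = 2 * \<bar>sin (t / 2)\<bar>" for t
    using dist_exp_i_1[of t] by (simp add: cis_conv_exp dist_norm)
  have P0: "P u \<ge> 0" if "u \<in> ball 0 1" for u using B(2)[OF that] by (simp add: P_def)
  \<comment> \<open>The angular derivative of l is i * u * l' u, whose imaginary part is Re (u * l'
    u). Hence \<open>P\<close> is the density of the increasing function
    \<open>w \<rho> t + B * t\<close>.\<close>
  have D: "((\<lambda>t. w \<rho> t + B * t) has_real_derivative P (of_real \<rho> * cis t)) (at t within S)"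
    if "0 < \<rho>" "\<rho> < 1" for \<rho> t S
  proof -
    have "(l has_field_derivative deriv l (of_real \<rho> * cis t)) (at (of_real \<rho> * cis t))"
      using l that by (intro holomorphic_derivI[of _ "ball 0 1"]) (auto simp: norm_mult)
    moreover have "((\<lambda>t. of_real \<rho> * cis t) has_vector_derivative (of_real \<rho> * (\<i> * cis t))) (at t within S)"
      by (auto intro!: derivative_eq_intros simp: has_vector_derivative_complex_iff)
    ultimately have "((\<lambda>t. l (of_real \<rho> * cis t)) has_vector_derivative (of_real \<rho> * (\<i> * cis t) * deriv l (of_real \<rho> * cis t))) (at t within S)"
      using field_vector_diff_chain_within[of "\<lambda>t. of_real \<rho> * cis t" _ t S l] by (simp add: o_def has_field_derivative_at_within)
    then have "(w \<rho> has_real_derivative Im (of_real \<rho> * (\<i> * cis t) * deriv l (of_real \<rho> * cis t))) (at t within S)"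
      unfolding w_def has_vector_derivative_complex_iff by blast
    from DERIV_add[OF this DERIV_cmult[OF DERIV_ident, of B]]
    show ?thesis by (simp add: P_def algebra_simps)
  qed
  have mono: "w \<rho> s + B * s \<le> w \<rho> t + B * t" if "0 < \<rho>" "\<rho> < 1" "s \<le> t" for \<rho> s t
  proof (rule DERIV_nonneg_imp_nondecreasing[OF that(3)])
    fix x
    have "P (of_real \<rho> * cis x) \<ge> 0" using that by (intro P0) (simp add: norm_mult)
    then show "\<exists>y. ((\<lambda>t. w \<rho> t + B * t) has_real_derivative y) (at x) \<and> 0 \<le> y"
      using D[OF that(1,2)] by blast
  qed
  \<comment> \<open>Monotonicity bounds the decrease of \<open>w \<rho>\<close> by the linear term.
    Going round the circle the other way, by periodicity, bounds its increase too, uniformly in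
    \<rho>.\<close>
  have osc: "\<bar>w \<rho> t - w \<rho> 0\<bar> \<le> 2 * pi * B" if "0 < \<rho>" "\<rho> < 1" "t \<in> {-pi..pi}" for \<rho> t
  proof -
    have per: "w \<rho> (s + 2 * pi) = w \<rho> s" "w \<rho> (s - 2 * pi) = w \<rho> s" for s
      by (simp_all add: w_def flip: cis_mult cis_divide)
    have "B * t \<le> B * pi" "- (B * pi) \<le> B * t" 
      using that(3) B(1) mult_left_mono[of t pi B] mult_left_mono[of "-pi" t B] by auto
    moreover have "0 \<le> t \<Longrightarrow> 0 \<le> B * t" "t \<le> 0 \<Longrightarrow> B * t \<le> 0"
      using B(1) by (auto intro: mult_nonneg_nonneg mult_nonneg_nonpos)
    ultimately show ?thesis
      using mono[OF that(1,2), of 0 t] mono[OF that(1,2), of t 0]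
        mono[OF that(1,2), of "t - 2 * pi" 0] mono[OF that(1,2), of 0 "t + 2 * pi"] that(3)
      unfolding per by (cases "t \<ge> 0") (auto simp: algebra_simps abs_if)
  qed
  have Poisson: "((\<lambda>t. K \<rho> x t * Re (f (of_real \<rho> * cis t))) has_integral 2 * pi * Re (f (of_real x))) {-pi..pi}"
    if f: "f holomorphic_on ball 0 1" and "0 \<le> x" "x < \<rho>" "\<rho> < 1" for f \<rho> x
  proof -
    have "f holomorphic_on cball 0 \<rho>" using f that by (auto intro: holomorphic_on_subset)
    from has_integral_Re[OF Poisson_integral_disc[OF this, of "of_real x"]] that
    show ?thesis by (simp add: K_def power2_abs)
  qed
  \<comment> \<open>The Poisson integral of \<open>P\<close> at 1 - \<eta> dominates its part over
    the arc |t| \<le> \<eta>, where the kernel is at least 1 / (8 * \<eta>). This bounds the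
    increment of \<open>w \<rho> t + B * t\<close> over the arc; removing the linear term costs at
    most 2 * B * \<eta>.\<close>
  have arc: "\<bar>w \<rho> t - w \<rho> 0\<bar> \<le> 16 * pi * \<eta> * P (of_real (1 - \<eta>)) + 2 * B * \<eta>"
    if \<eta>: "0 < \<eta>" "\<eta> \<le> 1/2" and \<rho>: "1 - \<eta> / 2 \<le> \<rho>" "\<rho> < 1" and t: "\<bar>t\<bar> \<le> \<eta>" for \<eta> \<rho> t
  proof -
    define x where "x = 1 - \<eta>"
    have \<rho>0: "0 < \<rho>" using \<eta> \<rho> by linarith
    have I1: "((\<lambda>t. K \<rho> x t * P (of_real \<rho> * cis t)) has_integral 2 * pi * P (of_real x)) {-pi..pi}"
      using Poisson[of "\<lambda>u. u * deriv l u + of_real B" x \<rho>] \<eta> \<rho> l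
      by (simp add: x_def P_def holomorphic_intros holomorphic_deriv)
    have I2: "((\<lambda>t. P (of_real \<rho> * cis t)) has_integral (w \<rho> \<eta> + B * \<eta>) - (w \<rho> (-\<eta>) + B * (-\<eta>))) {-\<eta>..\<eta>}"
      using \<eta> D[OF \<rho>0 \<rho>(2)] by (intro fundamental_theorem_of_calculus) (auto simp: has_real_derivative_iff_has_vector_derivative)
    \<comment> \<open>On the arc the numerator (\<rho> - x) * (\<rho> + x) is at least \<eta> / 2
      and the distance in the denominator is at most 2 * \<eta>.\<close>
    have K: "1 / (8 * \<eta>) \<le> K \<rho> x t" if "t \<in> {-\<eta>..\<eta>}" for t
    proof -
      have *: "of_real \<rho> * cis t - of_real x = of_real (\<rho> - x) + of_real \<rho> * (cis t - 1)" by (simp add: algebra_simps)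
      have "cmod (of_real \<rho> * cis t - of_real x) \<le> \<bar>\<rho> - x\<bar> + \<rho> * cmod (cis t - 1)"
        unfolding * using norm_triangle_ineq[of "of_real (\<rho> - x)" "of_real \<rho> * (cis t - 1)"] \<rho>0
        by (simp add: norm_mult del: of_real_diff)
      moreover have "cmod (cis t - 1) \<le> \<bar>t\<bar>"
        unfolding chord using abs_sin_x_le_abs_x[of "t / 2"] by simp
      then have "\<rho> * cmod (cis t - 1) \<le> 1 * \<bar>t\<bar>" using \<rho> \<rho>0 by (intro mult_mono) auto
      ultimately have le: "cmod (of_real \<rho> * cis t - of_real x) \<le> 2 * \<eta>"
        using that \<rho> \<eta> by (auto simp: x_def abs_if split: if_splits)
      have "cmod (of_real \<rho> * cis t) = \<rho>" "cmod (complex_of_real x) = x" "x < \<rho>"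
        using \<rho>0 \<eta> \<rho> by (auto simp: norm_mult x_def simp del: of_real_diff)
      then have "0 < cmod (of_real \<rho> * cis t - of_real x)" by (metis less_irrefl right_minus_eq zero_less_norm_iff)
      have "\<eta> / 2 * 1 \<le> (\<rho> - x) * (\<rho> + x)" using \<eta> \<rho> unfolding x_def by (intro mult_mono) auto
      then have "\<eta> / 2 \<le> \<rho>\<^sup>2 - x\<^sup>2" by (simp add: power2_eq_square algebra_simps)
      then have "(\<eta> / 2) / (2 * \<eta>)\<^sup>2 \<le> K \<rho> x t" unfolding K_def
        using le \<open>0 < cmod _\<close> \<eta> by (intro frac_le power_mono) auto
      then show ?thesis using \<eta> by (simp add: power2_eq_square)
    qed
    have PS: "P (of_real \<rho> * cis t) \<ge> 0" for t using P0 \<rho>0 \<rho> by (simp add: norm_mult)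
    have KS: "K \<rho> x t \<ge> 0" for t
      using \<eta> \<rho> by (auto simp: K_def x_def intro!: divide_nonneg_nonneg power_mono)
    have sub: "{-\<eta>..\<eta>} \<subseteq> {-pi..pi}" using \<eta> pi_gt3 by auto
    have int: "(\<lambda>t. K \<rho> x t * P (of_real \<rho> * cis t)) integrable_on {-\<eta>..\<eta>}"
      using integrable_on_subinterval[OF has_integral_integrable[OF I1] sub] .
    have "1 / (8 * \<eta>) * ((w \<rho> \<eta> + B * \<eta>) - (w \<rho> (-\<eta>) + B * (-\<eta>))) \<le> integral {-\<eta>..\<eta>} (\<lambda>t. K \<rho> x t * P (of_real \<rho> * cis t))"
      using K PS by (intro has_integral_le[OF has_integral_mult_right[OF I2] integrable_integral[OF int]] mult_right_mono) auto
    also have "\<dots> \<le> 2 * pi * P (of_real x)"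
      using integral_subset_le[OF sub int has_integral_integrable[OF I1]] KS PS integral_unique[OF I1] by auto
    finally have *: "(w \<rho> \<eta> + B * \<eta>) - (w \<rho> (-\<eta>) + B * (-\<eta>)) \<le> 16 * pi * \<eta> * P (of_real x)"
      using \<eta> by (simp add: field_simps)
    have "B * \<bar>t\<bar> \<le> B * \<eta>" using t B(1) by (intro mult_left_mono)
    then have "B * t \<le> B * \<eta>" "- (B * \<eta>) \<le> B * t"
      using B(1) \<eta> t mult_left_mono[of t \<eta> B] mult_left_mono[of "-\<eta>" t B] by (auto simp: abs_if split: if_splits)
    then show ?thesis
      using * mono[OF \<rho>0 \<rho>(2), of t 0] mono[OF \<rho>0 \<rho>(2), of 0 t] t
        mono[OF \<rho>0 \<rho>(2), of "-\<eta>" t] mono[OF \<rho>0 \<rho>(2), of t \<eta>] mono[OF \<rho>0 \<rho>(2), of "-\<eta>" 0] mono[OF \<rho>0 \<rho>(2), of 0 \<eta>]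
      unfolding x_def[symmetric] by (cases "t \<ge> 0") (auto simp: algebra_simps abs_if)
  qed
  show ?thesis
  proof (rule ex_tendsto_if_small_oscillation)
    show "at 1 within ball (0::complex) 1 \<noteq> bot"
      by (simp add: at_within_ball_bot_iff)
    fix e :: real assume e: "e > 0"
    have "filterlim (\<lambda>\<eta>. 1 - \<eta>) (at_left 1) (at_right (0::real))"
      unfolding filterlim_at by (auto intro!: tendsto_eq_intros simp: eventually_at_filter)
    from filterlim_compose[OF atom this]
    have "((\<lambda>\<eta>. \<eta> * Re (of_real (1 - \<eta>) * deriv l (of_real (1 - \<eta>))) + \<eta> * B) \<longlongrightarrow> 0 + 0 * B) (at_right 0)"
      by (intro tendsto_intros) auto
    then have "((\<lambda>\<eta>. \<eta> * P (of_real (1 - \<eta>))) \<longlongrightarrow> 0) (at_right 0)"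
      by (simp add: P_def distrib_left)
    then have "((\<lambda>\<eta>. 16 * pi * (\<eta> * P (of_real (1 - \<eta>))) + 2 * B * \<eta>) \<longlongrightarrow> 16 * pi * 0 + 2 * B * 0) (at_right 0)"
      by (intro tendsto_intros)
    then have "\<forall>\<^sub>F \<eta> in at_right 0. 16 * pi * (\<eta> * P (of_real (1 - \<eta>))) + 2 * B * \<eta> < e / 4"
      by (rule order_tendstoD) (use e in auto)
    moreover have "\<forall>\<^sub>F \<eta> in at_right (0::real). \<eta> < 1/2" by (rule order_tendstoD(2)[OF tendsto_ident_at]) auto
    ultimately obtain \<eta> where \<eta>: "16 * pi * (\<eta> * P (of_real (1 - \<eta>))) + 2 * B * \<eta> < e / 4" "\<eta> < 1/2" "\<eta> > 0"
      using eventually_happens[OF eventually_conj[OF eventually_conj[OF eventually_at_right_less]]] by force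
    \<comment> \<open>The chord from 1 to cis \<eta>, which bounds the distance of the complementary
      arc from 1 from below.\<close>
    define c where "c = 2 * sin (\<eta> / 2)"
    have c: "c > 0" unfolding c_def using \<eta> pi_gt3 by (auto intro: sin_gt_zero)
    have "c \<le> \<eta>" unfolding c_def using sin_x_le_x[of "\<eta> / 2"] \<eta> by simp
    \<comment> \<open>The first bound puts x = 1 - \<delta> within the range of radii allowed in
      \<open>arc\<close>. The second keeps the far arc at distance at least c / 4 from x. The third
      makes the far part of the Poisson integral contribute at most e / 4; the summand 1 in B + 1
      excludes division by zero.\<close>
    define \<delta> where "\<delta> = min (\<eta> / 4) (min (c / 4) (e * c\<^sup>2 / (256 * pi * (B + 1))))"
    have \<delta>: "\<delta> > 0" "\<delta> < \<eta> / 2" "\<delta> \<le> c / 4" using \<eta> c e B(1) by (auto simp: \<delta>_def)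
    have "\<delta> \<le> e * c\<^sup>2 / (256 * pi * (B + 1))" by (simp add: \<delta>_def)
    then have "\<delta> * (256 * pi * (B + 1)) \<le> e * c\<^sup>2"
      using B(1) by (subst (asm) pos_le_divide_eq) auto
    moreover have "\<delta> * (256 * pi * B) \<le> \<delta> * (256 * pi * (B + 1))"
      using \<delta>(1) by (intro mult_left_mono) auto
    ultimately have "\<delta> * (256 * pi * B) \<le> e * c\<^sup>2" by linarith
    then have \<delta>c: "64 * \<delta> * pi * B / c\<^sup>2 \<le> e / 4"
      using c by (simp add: divide_le_eq)
    define x where "x = 1 - \<delta>"
    have x: "1/2 \<le> x" "x < 1" "1 - \<eta> / 2 < x" using \<delta> \<eta> by (auto simp: x_def)
    have near: "\<bar>w \<rho> t - w \<rho> 0\<bar> \<le> e / 4" if "x < \<rho>" "\<rho> < 1" "\<bar>t\<bar> \<le> \<eta>" for \<rho> t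
      using arc[of \<eta> \<rho> t] \<eta> that x by (simp add: mult.assoc)
    \<comment> \<open>The Poisson formula for Im l at x averages
      \<open>w \<rho> t - w \<rho> 0\<close>. On the near arc this difference is at most e / 4 by
      \<open>near\<close>; on the far arc it is bounded by \<open>osc\<close> and the kernel is of
      order \<delta>.\<close>
    have radial: "\<bar>Im (l (of_real x)) - w \<rho> 0\<bar> \<le> e / 2" if \<rho>: "x < \<rho>" "\<rho> < 1" for \<rho>
    proof -
      have \<rho>0: "0 < \<rho>" using x \<rho> by linarith
      have I0: "(K \<rho> x has_integral 2 * pi) {-pi..pi}"
        using Poisson[of "\<lambda>_. 1" x \<rho>] x \<rho> by simp
      have I1: "((\<lambda>t. K \<rho> x t * w \<rho> t) has_integral 2 * pi * Im (l (of_real x))) {-pi..pi}"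
        \<comment> \<open>The function - i * l has real part Im l.\<close>
        using Poisson[of "\<lambda>u. - \<i> * l u" x \<rho>] x \<rho> l by (simp add: w_def holomorphic_intros)
      have I2: "((\<lambda>t. K \<rho> x t * (w \<rho> t - w \<rho> 0)) has_integral 2 * pi * (Im (l (of_real x)) - w \<rho> 0)) {-pi..pi}"
        using has_integral_diff[OF I1 has_integral_mult_left[OF I0, of "w \<rho> 0"]] by (simp add: algebra_simps)
      have I3: "((\<lambda>t. K \<rho> x t * (e / 4) + 64 * \<delta> * pi * B / c\<^sup>2) has_integral 2 * pi * (e / 4) + 2 * pi * (64 * \<delta> * pi * B / c\<^sup>2)) {-pi..pi}"
        using has_integral_add[OF has_integral_mult_left[OF I0, of "e / 4"] has_integral_const_real[of "64 * \<delta> * pi * B / c\<^sup>2" "-pi" pi]]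
        by simp
      have "norm (K \<rho> x t * (w \<rho> t - w \<rho> 0)) \<le> K \<rho> x t * (e / 4) + 64 * \<delta> * pi * B / c\<^sup>2" if t: "t \<in> {-pi..pi}" for t
      proof (cases "\<bar>t\<bar> \<le> \<eta>")
        case True
        have "K \<rho> x t \<ge> 0" using x \<rho> by (auto simp: K_def intro!: divide_nonneg_nonneg power_mono)
        then have "K \<rho> x t * \<bar>w \<rho> t - w \<rho> 0\<bar> \<le> K \<rho> x t * (e / 4)" using near[OF \<rho> True] by (intro mult_left_mono)
        moreover have "0 \<le> 64 * \<delta> * pi * B / c\<^sup>2" using \<delta> B(1) by simp
        ultimately show ?thesis using \<open>K \<rho> x t \<ge> 0\<close> by (simp add: abs_mult)
      next
        case False
        have "sin (\<eta> / 2) \<le> \<bar>sin (t / 2)\<bar>"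
        proof (cases "t \<ge> 0")
          case True
          then have "sin (\<eta> / 2) \<le> sin (t / 2)" using False \<eta> t by (intro sin_monotone_2pi_le) auto
          then show ?thesis by simp
        next
          case F: False
          then have "sin (\<eta> / 2) \<le> sin (- t / 2)" using False \<eta> t by (intro sin_monotone_2pi_le) auto
          then show ?thesis by simp
        qed
        then have "c \<le> cmod (cis t - 1)" by (simp add: chord c_def)
        then have "\<rho> * c \<le> \<rho> * cmod (cis t - 1)" using \<rho>0 by (intro mult_left_mono) auto
        moreover have "1/2 * c \<le> \<rho> * c" using x \<rho> c by (intro mult_right_mono) auto
        moreover have "of_real \<rho> * cis t - of_real x = of_real \<rho> * (cis t - 1) + of_real (\<rho> - x)" by (simp add: algebra_simps)
        then have "cmod (of_real \<rho> * cis t - of_real x) \<ge> \<rho> * cmod (cis t - 1) - (\<rho> - x)"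
          using norm_diff_ineq[of "of_real \<rho> * (cis t - 1)" "of_real (\<rho> - x)"] \<rho>0 \<rho>
          by (simp add: norm_mult del: of_real_diff)
        moreover have "\<rho> - x \<le> \<delta>" using \<rho> by (simp add: x_def)
        ultimately have "c / 4 \<le> cmod (of_real \<rho> * cis t - of_real x)" using \<delta>(3) by linarith
        then have "(c / 4)\<^sup>2 \<le> (cmod (of_real \<rho> * cis t - of_real x))\<^sup>2" using c by (intro power_mono) auto
        moreover have "\<rho>\<^sup>2 - x\<^sup>2 \<le> \<delta> * 2"
          using mult_mono[of "\<rho> - x" \<delta> "\<rho> + x" 2] \<rho> x \<delta> by (simp add: x_def power2_eq_square algebra_simps)
        ultimately have "K \<rho> x t \<le> (\<delta> * 2) / (c / 4)\<^sup>2"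
          unfolding K_def using c \<delta> by (intro frac_le) auto
        then have "K \<rho> x t * \<bar>w \<rho> t - w \<rho> 0\<bar> \<le> (\<delta> * 2) / (c / 4)\<^sup>2 * (2 * pi * B)"
          using osc[OF \<rho>0 \<rho>(2) t] \<delta> by (intro mult_mono) auto
        also have "\<dots> = 64 * \<delta> * pi * B / c\<^sup>2" by (simp add: power2_eq_square)
        also have "K \<rho> x t \<ge> 0" using x \<rho> by (auto simp: K_def intro!: divide_nonneg_nonneg power_mono)
        ultimately show ?thesis using e by (simp add: abs_mult add_increasing)
      qed
      then have "\<bar>2 * pi * (Im (l (of_real x)) - w \<rho> 0)\<bar> \<le> 2 * pi * (e / 4) + 2 * pi * (64 * \<delta> * pi * B / c\<^sup>2)"
        using integral_norm_bound_integral[OF has_integral_integrable[OF I2] has_integral_integrable[OF I3]]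
        unfolding integral_unique[OF I2] integral_unique[OF I3] by simp
      also have "\<dots> \<le> 2 * pi * (e / 2)"
        using mult_left_mono[OF \<delta>c, of "2 * pi"] pi_ge_zero by argo
      finally show ?thesis by (simp add: abs_mult)
    qed
    \<comment> \<open>A point u near 1 is compared with x in two moves: along its circle to the
      positive axis by \<open>near\<close>, then along the axis by \<open>radial\<close>.\<close>
    have "((\<lambda>u. \<bar>Arg u\<bar>) \<longlongrightarrow> \<bar>Arg 1\<bar>) (at 1 within ball 0 1)"
      by (intro tendsto_intros isCont_tendsto_compose[OF continuous_at_Arg]) auto
    then have "\<forall>\<^sub>F u in at 1 within ball 0 1. \<bar>Arg u\<bar> < \<eta>"
      by (rule order_tendstoD) (use \<eta> in simp)
    moreover have "((\<lambda>u. cmod u) \<longlongrightarrow> cmod 1) (at 1 within ball 0 1)" by (intro tendsto_intros)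
    then have "\<forall>\<^sub>F u in at 1 within ball 0 1. cmod u > x"
      by (rule order_tendstoD) (use x in simp)
    moreover have "\<forall>\<^sub>F u in at 1 within ball 0 1. cmod u < 1"
      by (simp add: eventually_at_filter)
    ultimately have "\<forall>\<^sub>F u in at 1 within ball 0 1. \<bar>Im (l u) - Im (l (of_real x))\<bar> < e"
    proof eventually_elim
      case (elim u)
      have "u = of_real (cmod u) * cis (Arg u)" using rcis_cmod_Arg[of u] by (simp add: rcis_def)
      then have "Im (l u) = w (cmod u) (Arg u)" by (simp add: w_def)
      then show ?case using near[of "cmod u" "Arg u"] radial[of "cmod u"] elim e by linarith
    qed
    then show "\<exists>v. \<forall>\<^sub>F u in at 1 within ball 0 1. \<bar>Im (l u) - v\<bar> < e" by blast
  qed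
qed

section \<open>Boundary behaviour of the Koenigs function\<close>

text \<open>The quotient g u / u has no zeros, so it has a logarithm, written as lam * l u. Pulled
  back by g, the contraction by exp (- lam * t) is a flow that does not increase |u|; its initial
  velocity is - u / (1 / lam + u * l' u), and differentiating the modulus gives the sign of the real
  part.\<close>

lemma spirallike_log_derivative:
  fixes g :: "complex \<Rightarrow> complex"
  assumes g: "g holomorphic_on ball 0 1" and inj: "inj_on g (ball 0 1)" and g0: "g 0 = 0"
    and lam: "Re lam > 0"
    and spiral: "\<And>t u. t \<ge> 0 \<Longrightarrow> u \<in> ball 0 1 \<Longrightarrow>
      \<exists>v\<in>ball 0 1. cmod v \<le> cmod u \<and> g v = exp (- lam * of_real t) * g u"
  obtains l where "l holomorphic_on ball 0 1" "\<And>u. u \<in> ball 0 1 \<Longrightarrow> g u = u * exp (lam * l u)"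
    "\<And>u. u \<in> ball 0 1 \<Longrightarrow> Re (1 / lam + u * deriv l u) \<ge> 0"
proof -
  have lam0: "lam \<noteq> 0" using lam by auto
  obtain q where q: "q holomorphic_on ball 0 1" "\<And>z. cmod z < 1 \<Longrightarrow> g z = z * q z" "deriv g 0 = q 0"
    using Schwarz3[OF g g0] by blast
  have gnz: "g u \<noteq> 0" if "u \<in> ball 0 1" "u \<noteq> 0" for u
    using inj_onD[OF inj, of u 0] that g0 by auto
  have "q u \<noteq> 0" if "u \<in> ball 0 1" for u
  proof (cases "u = 0")
    case True
    then show ?thesis using holomorphic_injective_imp_regular[OF g _ inj, of 0] q(3) by simp
  next
    case False
    then show ?thesis using gnz[OF that] q(2)[of u] that by auto
  qed
  then obtain L where L: "L holomorphic_on ball 0 1" "\<And>u. u \<in> ball 0 1 \<Longrightarrow> q u = exp (L u)"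
    using contractible_imp_holomorphic_log[OF q(1)] convex_imp_contractible[OF convex_ball] by metis
  define l where "l = (\<lambda>u. L u / lam)"
  have l: "l holomorphic_on ball 0 1" unfolding l_def by (intro holomorphic_intros L lam0)
  have gl: "g u = u * exp (lam * l u)" if "u \<in> ball 0 1" for u
    using q(2)[of u] L(2)[of u] lam0 that by (simp add: l_def)
  obtain k where k: "k holomorphic_on (g ` ball 0 1)" "\<And>z. z \<in> ball 0 1 \<Longrightarrow> deriv g z * deriv k (g z) = 1"
    "\<And>z. z \<in> ball 0 1 \<Longrightarrow> k (g z) = z"
    using holomorphic_has_inverse[OF g open_ball inj] by metis
  have "Re (1 / lam + u * deriv l u) \<ge> 0" if u: "u \<in> ball 0 1" for u
  proof (cases "u = 0")
    case True
    then show ?thesis using lam by (simp add: Re_divide)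
  next
    case False
    have l': "(l has_field_derivative deriv l u) (at u)"
      using l u by (simp add: holomorphic_derivI)
    have "((\<lambda>u. u * exp (lam * l u)) has_field_derivative (lam * g u / u * (1 / lam + u * deriv l u))) (at u)"
      using lam0 False by (auto intro!: derivative_eq_intros l' simp: gl[OF u] field_simps)
    then have "(g has_field_derivative (lam * g u / u * (1 / lam + u * deriv l u))) (at u)"
      by (rule has_field_derivative_transform_within_open[of _ _ _ "ball 0 1"]) (use u gl in auto)
    then have dg: "deriv g u = lam * g u / u * (1 / lam + u * deriv l u)" by (rule DERIV_imp_deriv)
    \<comment> \<open>The logarithmic velocity of the flow: - lam * g u / g' u = u * p, because g' u
      = lam * g u / u * (1 / lam + u * l' u).\<close>
    define p where "p = - 1 / (1 / lam + u * deriv l u)"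
    have "open (g ` ball 0 1)" using g inj by (intro open_mapping_thm3) auto
    then have "(k has_field_derivative deriv k (g u)) (at (g u))"
      using k(1) u by (intro holomorphic_derivI) auto
    moreover have "deriv k (g u) = 1 / deriv g u" using k(2)[OF u] by (metis mult.commute mult_zero_left nonzero_eq_divide_eq zero_neq_one)
    ultimately have dk: "(k has_field_derivative 1 / deriv g u) (at (exp (- lam * of_real 0) * g u))" by simp
    have "((\<lambda>t. exp (- lam * of_real t) * g u) has_vector_derivative (- lam * g u)) (at 0)"
    proof -
      have "((\<lambda>t. exp (- lam * t) * g u) has_field_derivative (- lam * g u)) (at (of_real 0))"
        by (auto intro!: derivative_eq_intros)
      from has_vector_derivative_real_field[OF this] show ?thesis by simp
    qed
    from field_vector_diff_chain_at[OF this dk]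
    have "((\<lambda>t. k (exp (- lam * of_real t) * g u)) has_vector_derivative (- lam * g u / deriv g u)) (at 0)"
      by (simp add: o_def)
    moreover have "- lam * g u / deriv g u = u * p"
    proof -
      have "- lam * g u / (lam * g u / u * W) = u * (- 1 / W)" for W
        using False gnz[OF u] lam0 by (simp add: divide_simps)
      then show ?thesis unfolding dg p_def .
    qed
    ultimately have D: "((\<lambda>t. k (exp (- lam * of_real t) * g u)) has_vector_derivative k (exp (- lam * of_real 0) * g u) * p) (at 0)"
      by (simp add: k(3)[OF u])
    have "\<not> Re p > 0"
    proof
      assume "Re p > 0"
      from eventually_norm_at_right_0(2)[OF D _ this] False
      have "\<forall>\<^sub>F t in at_right 0. cmod u < cmod (k (exp (- lam * of_real t) * g u))" by (simp add: k(3)[OF u])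
      from eventually_happens[OF eventually_conj[OF this eventually_at_right_less]]
      obtain t where t: "t > 0" "cmod u < cmod (k (exp (- lam * of_real t) * g u))" by auto
      obtain v where "v \<in> ball 0 1" "cmod v \<le> cmod u" "g v = exp (- lam * of_real t) * g u"
        using spiral[of t u] t(1) u by auto
      then show False using t(2) k(3)[of v] by simp
    qed
    moreover have "Re (- 1 / W) > 0" if "Re W < 0" for W
      using that by (auto simp: Re_divide intro!: divide_neg_pos simp: sum_power2_gt_zero_iff)
    ultimately show ?thesis unfolding p_def by (meson not_le)
  qed
  then show ?thesis using that l gl by blast
qed

text \<open>Julia's lemma applied to \<open>Q\<close> isolates the point mass at 1. Adding A * Ln (1
  - u) to l removes it, so the limit theorem without an atom applies to the corrected function. The
  correction also leaves a surplus A / 2 in the real part, which gives the strict positivity behind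
  the lower bound.\<close>

lemma spirallike_at_1:
  fixes l :: "complex \<Rightarrow> complex"
  assumes l: "l holomorphic_on ball 0 1" and lam: "Re lam > 0"
    and nonneg: "\<And>u. u \<in> ball 0 1 \<Longrightarrow> Re (1 / lam + u * deriv l u) \<ge> 0"
  obtains A v where "A \<ge> 0"
    "((\<lambda>u. (1 - u) * (1 / lam + u * deriv l u)) \<longlongrightarrow> of_real A) (nontangential 1)"
    "((\<lambda>u. Im (l u + of_real A * Ln (1 - u))) \<longlongrightarrow> v) (at 1 within ball 0 1)"
    "A > 0 \<Longrightarrow> \<exists>\<delta>>0. \<forall>u. 1/2 \<le> cmod u \<and> cmod u < 1 \<longrightarrow>
       \<delta> \<le> cmod (u * exp (lam * (l u + of_real A * Ln (1 - u))))"
proof -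
  define Q where "Q = (\<lambda>u. 1 / lam + u * deriv l u)"
  have lam0: "lam \<noteq> 0" and Re_lam: "Re (1 / lam) > 0" using lam by (auto simp: Re_divide sum_power2_gt_zero_iff)
  have Q: "Q holomorphic_on ball 0 1" unfolding Q_def using l lam0 by (intro holomorphic_intros holomorphic_deriv) auto
  have Q0: "Re (Q u) \<ge> 0" if "u \<in> ball 0 1" for u unfolding Q_def by (rule nonneg[OF that])
  obtain A where A: "A \<ge> 0" "\<And>u. u \<in> ball 0 1 \<Longrightarrow> Re (Q u - of_real (A / 2) * ((1 + u) / (1 - u))) \<ge> 0"
    "((\<lambda>u. (1 - u) * Q u) \<longlongrightarrow> of_real A) (nontangential 1)"
    using Julia_half_plane[OF Q Q0] by metis
  define l1 where "l1 = (\<lambda>u. l u + of_real A * Ln (1 - u))"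
  have Ln: "1 - u \<notin> \<real>\<^sub>\<le>\<^sub>0" "u \<noteq> 1" if "u \<in> ball 0 1" for u :: complex
    using that abs_Re_le_cmod[of u] by (auto simp: complex_nonpos_Reals_iff)
  have l1: "l1 holomorphic_on ball 0 1" unfolding l1_def by (intro holomorphic_intros l) (use Ln in auto)
  have dl1: "u * deriv l1 u = Q u - 1 / lam - of_real A * u / (1 - u)" if "u \<in> ball 0 1" for u
  proof -
    have l': "(l has_field_derivative deriv l u) (at u)"
      using l that by (simp add: holomorphic_derivI)
    have "(l1 has_field_derivative deriv l u + of_real A * (- 1 / (1 - u))) (at u)"
      unfolding l1_def using Ln[OF that] by (auto intro!: derivative_eq_intros l' simp: field_simps)
    then show ?thesis by (simp add: DERIV_imp_deriv Q_def field_simps)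
  qed
  \<comment> \<open>The identity u / (1 - u) = ((1 + u) / (1 - u) - 1) / 2 compares the correction
    with the Cayley function and produces the surplus A / 2.\<close>
  have pos: "Re (1 / lam + u * deriv l1 u) \<ge> A / 2" if "u \<in> ball 0 1" for u
  proof -
    have "1 / lam + u * deriv l1 u = (Q u - of_real (A / 2) * ((1 + u) / (1 - u))) + of_real (A / 2)"
      unfolding dl1[OF that] using Ln[OF that] by (simp add: field_simps)
    then show ?thesis using A(2)[OF that] by simp
  qed
  have "\<exists>v. ((\<lambda>u. Im (l1 u)) \<longlongrightarrow> v) (at 1 within ball 0 1)"
  proof (rule tendsto_Im_at_1_if_no_atom[OF l1, of "Re (1 / lam)"])
    show "0 \<le> Re (1 / lam)" using Re_lam by simp
    show "- Re (1 / lam) \<le> Re (u * deriv l1 u)" if "u \<in> ball 0 1" for u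
      using pos[OF that] A(1) by simp
    have "filterlim complex_of_real (at 1 within Stolz_region 1 2) (at_left 1)"
    proof -
      have "\<forall>\<^sub>F x in at_left 1. complex_of_real x \<in> Stolz_region 1 2 \<and> complex_of_real x \<noteq> 1"
        using eventually_at_left_real[OF zero_less_one]
      proof eventually_elim
        case (elim x)
        then have "cmod (1 - of_real x) = 1 - x"
          by (metis abs_of_pos diff_gt_0_iff_gt greaterThanLessThan_iff norm_of_real of_real_1 of_real_diff)
        then show ?case using elim by (simp add: Stolz_region_def)
      qed
      moreover have "(complex_of_real \<longlongrightarrow> 1) (at_left 1)" by (auto intro!: tendsto_eq_intros)
      ultimately show ?thesis unfolding filterlim_at by simp
    qed
    moreover have "((\<lambda>u. (1 - u) * Q u) \<longlongrightarrow> of_real A) (at 1 within Stolz_region 1 2)"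
      using A(3) by (simp add: tendsto_nontangential_iff)
    ultimately have "((\<lambda>x. (1 - of_real x) * Q (of_real x)) \<longlongrightarrow> of_real A) (at_left 1)"
      using filterlim_compose by blast
    from tendsto_Re[OF this]
    \<comment> \<open>Along the radius (1 - x) * Q x tends to A, and the correction subtracts A * x,
      so the two masses cancel in the limit.\<close>
    have "((\<lambda>x. Re ((1 - of_real x) * Q (of_real x)) - A * x - (1 - x) * Re (1 / lam)) \<longlongrightarrow> A - A * 1 - (1 - 1) * Re (1 / lam)) (at_left 1)"
      by (intro tendsto_intros) simp
    then have "((\<lambda>x. Re ((1 - of_real x) * Q (of_real x)) - A * x - (1 - x) * Re (1 / lam)) \<longlongrightarrow> 0) (at_left 1)" by simp
    then show "((\<lambda>x. (1 - x) * Re (of_real x * deriv l1 (of_real x))) \<longlongrightarrow> 0) (at_left 1)"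
    proof (rule Lim_transform_eventually)
      show "\<forall>\<^sub>F x in at_left 1. Re ((1 - of_real x) * Q (of_real x)) - A * x - (1 - x) * Re (1 / lam) = (1 - x) * Re (of_real x * deriv l1 (of_real x))"
        using eventually_at_left_real[OF zero_less_one]
      proof eventually_elim
        case (elim x)
        then have x: "0 < x \<and> x < 1" by simp
        have "of_real x * deriv l1 (of_real x) = Q (of_real x) - 1 / lam - of_real (A * x / (1 - x))"
          using dl1[of "of_real x"] x by simp
        then have "(1 - x) * Re (of_real x * deriv l1 (of_real x)) = (1 - x) * Re (Q (of_real x)) - (1 - x) * Re (1 / lam) - (1 - x) * (A * x / (1 - x))"
          by (simp only: minus_complex.sel Re_complex_of_real right_diff_distrib)
        then show ?case using x by simp
      qed
    qed
  qed
  then obtain v where v: "((\<lambda>u. Im (l1 u)) \<longlongrightarrow> v) (at 1 within ball 0 1)" by blast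
  have low: "\<exists>\<delta>>0. \<forall>u. 1/2 \<le> cmod u \<and> cmod u < 1 \<longrightarrow> \<delta> \<le> cmod (u * exp (lam * l1 u))" if "A > 0"
  proof (rule norm_spiral_lower_bound[OF l1 lam])
    show "Re (1 / lam + u * deriv l1 u) > 0" if "u \<in> ball 0 1" for u
      using pos[OF that] \<open>A > 0\<close> by linarith
  qed
  show ?thesis
    by (rule that[OF A(1) A(3)[unfolded Q_def] v[unfolded l1_def] low[unfolded l1_def]])
qed

lemma at_within_Stolz_region_le_nontangential:
  "M > 1 \<Longrightarrow> at \<sigma> within Stolz_region \<sigma> M \<le> nontangential \<sigma>"
  unfolding nontangential_def by (rule SUP_upper) auto

lemma filterlim_nontangentialI:
  assumes "\<And>M. M > 1 \<Longrightarrow> filterlim f F (at \<sigma> within Stolz_region \<sigma> M)"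
  shows "filterlim f F (nontangential \<sigma>)"
  using assms unfolding filterlim_iff nontangential_def eventually_Sup by auto

lemma nontangential_le_at_within_ball: "nontangential \<sigma> \<le> at \<sigma> within ball 0 1"
  unfolding nontangential_def by (intro SUP_least at_le) (auto simp: Stolz_region_def)

text \<open>A disc automorphism \<open>m\<close> with m \<tau> = 0 and m \<sigma> = 1 reduces
  everything to \<open>spirallike_at_1\<close>. The limits carry back because \<open>m\<close> is
  conformal at \<sigma> and (1 - m z) / (1 - cnj \<sigma> * z) tends to a positive real number, so
  that arguments measured at 1 and at \<sigma> agree asymptotically.\<close>

lemma Koenigs_boundary_behaviour:
  fixes h :: "complex \<Rightarrow> complex"
  assumes h: "h holomorphic_on ball 0 1" and inj: "inj_on h (ball 0 1)"
    and \<tau>: "\<tau> \<in> ball 0 1" "h \<tau> = 0" and lam: "Re lam > 0" and \<sigma>: "cmod \<sigma> = 1"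
    and spiral: "\<And>t z. t \<ge> 0 \<Longrightarrow> z \<in> ball 0 1 \<Longrightarrow> \<exists>z'\<in>ball 0 1.
      cmod (Moebius_function 0 \<tau> z') \<le> cmod (Moebius_function 0 \<tau> z) \<and> h z' = exp (- lam * of_real t) * h z"
  obtains A v where "A \<ge> 0"
    "((\<lambda>z. (\<sigma> - z) * deriv h z / (lam * h z)) \<longlongrightarrow> of_real A) (nontangential \<sigma>)"
    "((\<lambda>z. cis (spiral_Arg lam (h z) + A * ((cmod lam)\<^sup>2 / Re lam) * Arg (1 - cnj \<sigma> * z))) \<longlongrightarrow> cis v)
       (at \<sigma> within ball 0 1)"
    "A > 0 \<Longrightarrow> filterlim (\<lambda>z. cmod (h z)) at_top (at \<sigma> within ball 0 1)"
proof -

  \<comment> \<open>Normalisation of the interior fixed point and of the boundary point\<close>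
  define c where "c = (1 - cnj \<tau> * \<sigma>) / (\<sigma> - \<tau>)"
  define m where "m = (\<lambda>z. c * Moebius_function 0 \<tau> z)"
  define N where "N = (\<lambda>u. Moebius_function 0 (-\<tau>) (cnj c * u))"
  have lam0: "lam \<noteq> 0" using lam by auto
  have \<tau>1: "cmod \<tau> < 1" using \<tau> by simp
  have \<sigma>\<tau>: "\<sigma> \<noteq> \<tau>" using \<sigma> \<tau>1 by auto
  have \<sigma>\<sigma>: "\<sigma> * cnj \<sigma> = 1" "cnj \<sigma> * \<sigma> = 1" using complex_norm_square[of \<sigma>] \<sigma> by (auto simp: mult.commute)
  have den: "1 - cnj \<tau> * z \<noteq> 0" if "cmod z \<le> 1" for z
  proof
    assume "1 - cnj \<tau> * z = 0"
    then have "cmod (cnj \<tau> * z) = 1" by (metis eq_iff_diff_eq_0 norm_one)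
    moreover have "cmod \<tau> * cmod z \<le> cmod \<tau> * 1" using that by (intro mult_left_mono) auto
    ultimately show False using \<tau>1 by (simp add: norm_mult)
  qed
  have eq: "1 - cnj \<tau> * \<sigma> = \<sigma> * cnj (\<sigma> - \<tau>)" using \<sigma>\<sigma> by (simp add: algebra_simps)
  have c1: "cmod c = 1" using \<sigma> \<sigma>\<tau> unfolding c_def eq
    by (simp add: norm_divide norm_mult del: complex_cnj_diff)
  have cc: "cnj c * c = 1" "c * cnj c = 1" using complex_norm_square[of c] c1 by (auto simp: mult.commute)
  have mD: "m z \<in> ball 0 1" if "z \<in> ball 0 1" for z
    using Moebius_function_norm_lt_1[OF \<tau>1, of z] that c1 by (simp add: m_def norm_mult)
  have ND: "N u \<in> ball 0 1" if "u \<in> ball 0 1" for u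
    using Moebius_function_norm_lt_1[of "-\<tau>" "cnj c * u"] that c1 \<tau>1 by (simp add: N_def norm_mult)
  have Nm: "N (m z) = z" if "z \<in> ball 0 1" for z
  proof -
    have "cnj c * (c * Moebius_function 0 \<tau> z) = Moebius_function 0 \<tau> z" by (simp add: cc flip: mult.assoc)
    then show ?thesis unfolding N_def m_def
      by (simp only:) (use that \<tau>1 in \<open>intro Moebius_function_compose; simp\<close>)
  qed
  have mN: "m (N u) = u" if "u \<in> ball 0 1" for u
  proof -
    have "Moebius_function 0 \<tau> (N u) = cnj c * u"
      unfolding N_def using that \<tau>1 c1 by (intro Moebius_function_compose) (auto simp: norm_mult)
    then show ?thesis by (simp add: m_def cc flip: mult.assoc)
  qed
  define g where "g = (\<lambda>u. h (N u))"
  have "N holomorphic_on ball 0 1"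
    unfolding N_def using \<tau>1 c1
    by (intro holomorphic_on_compose_gen[OF _ Moebius_function_holomorphic, of "\<lambda>u. cnj c * u", unfolded o_def])
       (auto intro!: holomorphic_intros simp: norm_mult)
  then have g: "g holomorphic_on ball 0 1"
    unfolding g_def by (intro holomorphic_on_compose_gen[OF _ h, unfolded o_def]) (use ND in auto)
  have inj_g: "inj_on g (ball 0 1)"
    by (rule inj_onI) (metis ND g_def inj inj_onD mN)
  have g0: "g 0 = 0" using \<tau> by (simp add: g_def N_def Moebius_function_of_zero)
  have spiral_g: "\<exists>v\<in>ball 0 1. cmod v \<le> cmod u \<and> g v = exp (- lam * of_real t) * g u"
    if t: "t \<ge> 0" and u: "u \<in> ball 0 1" for t u
  proof -
    obtain z' where z': "z' \<in> ball 0 1" "cmod (Moebius_function 0 \<tau> z') \<le> cmod (Moebius_function 0 \<tau> (N u))"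
      "h z' = exp (- lam * of_real t) * h (N u)"
      using spiral[OF t ND[OF u]] by blast
    have nm: "cmod (m z) = cmod (Moebius_function 0 \<tau> z)" for z using c1 by (simp add: m_def norm_mult)
    show ?thesis
      by (rule bexI[of _ "m z'"]) (use z' mD Nm mN[OF u] in \<open>auto simp: g_def nm[symmetric]\<close>)
  qed
  obtain l where l: "l holomorphic_on ball 0 1" "\<And>u. u \<in> ball 0 1 \<Longrightarrow> g u = u * exp (lam * l u)"
    "\<And>u. u \<in> ball 0 1 \<Longrightarrow> Re (1 / lam + u * deriv l u) \<ge> 0"
    by (rule spirallike_log_derivative[OF g inj_g g0 lam spiral_g]) (assumption | rule that)+
  obtain A v0 where A: "A \<ge> 0"
    "((\<lambda>u. (1 - u) * (1 / lam + u * deriv l u)) \<longlongrightarrow> of_real A) (nontangential 1)"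
    "((\<lambda>u. Im (l u + of_real A * Ln (1 - u))) \<longlongrightarrow> v0) (at 1 within ball 0 1)"
    "A > 0 \<Longrightarrow> \<exists>\<delta>>0. \<forall>u. 1/2 \<le> cmod u \<and> cmod u < 1 \<longrightarrow>
       \<delta> \<le> cmod (u * exp (lam * (l u + of_real A * Ln (1 - u))))"
    by (rule spirallike_at_1[OF l(1) lam l(3)]) (assumption | rule that)+
  have hm: "h z = m z * exp (lam * l (m z))" if "z \<in> ball 0 1" for z
    using l(2)[OF mD[OF that]] Nm[OF that] by (simp add: g_def)

  \<comment> \<open>The Moebius map near the boundary point\<close>
  define m' where "m' = (\<lambda>z. c * (1 - of_real ((cmod \<tau>)\<^sup>2)) / (1 - cnj \<tau> * z)\<^sup>2)"
  have dm: "(m has_field_derivative m' z) (at z)" if "cmod z \<le> 1" for z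
  proof -
    have 1: "((\<lambda>z. 1 - cnj \<tau> * z) has_field_derivative - cnj \<tau>) (at z)"
      by (auto intro!: derivative_eq_intros)
    have 2: "((\<lambda>z. z - \<tau>) has_field_derivative 1) (at z)"
      by (auto intro!: derivative_eq_intros)
    have "c * ((1 * (1 - cnj \<tau> * z) - (z - \<tau>) * (- cnj \<tau>)) / ((1 - cnj \<tau> * z) * (1 - cnj \<tau> * z))) = m' z"
      unfolding m'_def complex_norm_square by (simp add: power2_eq_square algebra_simps)
    with DERIV_cmult[OF DERIV_divide[OF 2 1 den[OF that]], of c] show ?thesis
      by (simp add: m_def[abs_def] Moebius_function_simple)
  qed
  have m\<sigma>: "m \<sigma> = 1" using \<sigma>\<tau> den[of \<sigma>] \<sigma> by (simp add: m_def c_def Moebius_function_simple)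
  have m1: "(m \<longlongrightarrow> 1) (at \<sigma> within S)" for S
    using DERIV_isCont[OF dm[of \<sigma>]] \<sigma> m\<sigma> by (auto simp: isCont_def intro: filterlim_mono at_le)
  \<comment> \<open>The Poisson kernel of \<tau> at \<sigma>; it is the modulus of the derivative of
    \<open>m\<close> at \<sigma>.\<close>
  define \<kappa> where "\<kappa> = (1 - (cmod \<tau>)\<^sup>2) / (cmod (\<sigma> - \<tau>))\<^sup>2"
  have \<kappa>: "\<kappa> > 0" unfolding \<kappa>_def using \<tau>1 \<sigma>\<tau> by (auto simp: abs_square_less_1)
  have m'\<sigma>: "\<sigma> * m' \<sigma> = of_real \<kappa>"
  proof -
    have "\<sigma> * m' \<sigma> = \<sigma> * (1 - of_real ((cmod \<tau>)\<^sup>2)) / ((\<sigma> - \<tau>) * (1 - cnj \<tau> * \<sigma>))"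
      using den[of \<sigma>] \<sigma> by (simp add: m'_def c_def power2_eq_square)
    also have "\<dots> = (1 - of_real ((cmod \<tau>)\<^sup>2)) / ((\<sigma> - \<tau>) * cnj (\<sigma> - \<tau>))"
    proof -
      have "\<sigma> \<noteq> 0" using \<sigma> by auto
      then show ?thesis unfolding eq by (simp add: mult.left_commute[of _ \<sigma>] del: complex_cnj_diff)
    qed
    finally show ?thesis unfolding \<kappa>_def complex_norm_square[symmetric] by simp
  qed
  define k where "k = (\<lambda>z. (1 - m z) / (1 - cnj \<sigma> * z))"
  have quot: "((\<lambda>z. (1 - m z) / (\<sigma> - z)) \<longlongrightarrow> m' \<sigma>) (at \<sigma> within S)" for S
  proof -
    have "((\<lambda>z. (m z - m \<sigma>) / (z - \<sigma>)) \<longlongrightarrow> m' \<sigma>) (at \<sigma>)"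
      using dm[of \<sigma>] \<sigma> by (simp add: has_field_derivative_iff)
    then have "((\<lambda>z. (m z - 1) / (z - \<sigma>)) \<longlongrightarrow> m' \<sigma>) (at \<sigma> within S)"
      unfolding m\<sigma> by (rule filterlim_mono) (auto intro: at_le)
    moreover have "(m z - 1) / (z - \<sigma>) = (1 - m z) / (\<sigma> - z)" for z
      using minus_divide_divide[of "m z - 1" "z - \<sigma>"] by simp
    ultimately show ?thesis by simp
  qed
  have k_eq: "k z = \<sigma> * ((1 - m z) / (\<sigma> - z))" for z
  proof -
    have "\<sigma> * (1 - cnj \<sigma> * z) = \<sigma> - (\<sigma> * cnj \<sigma>) * z" by (simp only: right_diff_distrib mult.assoc mult_1_right)
    then have "\<sigma> - z = \<sigma> * (1 - cnj \<sigma> * z)" by (simp add: \<sigma>\<sigma>)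
    then show ?thesis using \<sigma> by (auto simp: k_def)
  qed
  have k: "(k \<longlongrightarrow> of_real \<kappa>) (at \<sigma> within S)" for S
    unfolding k_eq m'\<sigma>[symmetric] by (intro tendsto_intros quot)
  have inD: "\<forall>\<^sub>F z in at \<sigma> within ball 0 1. z \<in> ball 0 1"
    by (simp add: eventually_at_filter)
  have "m z \<in> ball 0 1 \<and> m z \<noteq> 1" if "z \<in> ball 0 1" for z
    using mD[OF that] by auto
  then have m_at: "filterlim m (at 1 within ball 0 1) (at \<sigma> within ball 0 1)"
    unfolding filterlim_at using m1 eventually_mono[OF inD] by simp
  have m_nt: "filterlim m (nontangential 1) (nontangential \<sigma>)"
  proof (rule filterlim_nontangentialI)
    fix M :: real assume M: "M > 1"
    \<comment> \<open>The factor 2 * \<kappa> bounds |1 - m z| / |\<sigma> - z| near \<sigma>, and 8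
      / (1 - |\<tau>|^2) bounds (1 - |z|) / (1 - |m z|). The summand 1 makes the final inequality
      strict.\<close>
    define M' where "M' = 1 + 2 * \<kappa> * M * 8 / (1 - (cmod \<tau>)\<^sup>2)"
    have \<tau>2: "1 - (cmod \<tau>)\<^sup>2 > 0" using \<tau>1 by (simp add: abs_square_less_1)
    have M': "M' > 1" using M \<kappa> \<tau>2 by (simp add: M'_def)
    have "((\<lambda>z. cmod (k z)) \<longlongrightarrow> cmod (of_real \<kappa>)) (at \<sigma> within Stolz_region \<sigma> M)"
      by (intro tendsto_intros k)
    then have "\<forall>\<^sub>F z in at \<sigma> within Stolz_region \<sigma> M. cmod (k z) < 2 * \<kappa>"
      by (rule order_tendstoD) (use \<kappa> in simp)
    moreover have "\<forall>\<^sub>F z in at \<sigma> within Stolz_region \<sigma> M. z \<in> Stolz_region \<sigma> M"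
      by (simp add: eventually_at_filter)
    ultimately have "\<forall>\<^sub>F z in at \<sigma> within Stolz_region \<sigma> M. m z \<in> Stolz_region 1 M' \<and> m z \<noteq> 1"
    proof eventually_elim
      case (elim z)
      then have z: "z \<in> ball 0 1" and zM: "cmod (\<sigma> - z) < M * (1 - cmod z)" by (auto simp: Stolz_region_def)
      have "1 - m z = \<sigma> * ((1 - m z) / (\<sigma> - z)) * (cnj \<sigma> * (\<sigma> - z))"
      proof -
        have "\<sigma> * ((1 - m z) / (\<sigma> - z)) * (cnj \<sigma> * (\<sigma> - z)) = (\<sigma> * cnj \<sigma>) * ((1 - m z) / (\<sigma> - z) * (\<sigma> - z))"
          by (simp only: ac_simps)
        moreover have "\<sigma> - z \<noteq> 0" using \<sigma> z by auto
        ultimately show ?thesis by (simp add: \<sigma>\<sigma>)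
      qed
      then have "cmod (1 - m z) = cmod (k z) * cmod (\<sigma> - z)"
        unfolding k_eq[symmetric] using \<sigma> by (metis (no_types) complex_mod_cnj mult_1 norm_mult)
      also have "\<dots> \<le> (2 * \<kappa>) * (M * (1 - cmod z))" using elim zM \<kappa> by (intro mult_mono) auto
      also have "1 - cmod z \<le> 8 / (1 - (cmod \<tau>)\<^sup>2) * (1 - cmod (m z))"
      proof -
        have "1 - (cmod (m z))\<^sup>2 = (1 - (cmod z)\<^sup>2) * (1 - (cmod \<tau>)\<^sup>2) / (cmod (1 - cnj \<tau> * z))\<^sup>2"
          using one_minus_norm_Moebius_square[of \<tau> z] z \<tau>1 c1 by (simp add: m_def norm_mult)
        moreover have "cmod (1 - cnj \<tau> * z) \<le> 2"
          using norm_triangle_ineq4[of 1 "cnj \<tau> * z"] mult_mono[of "cmod \<tau>" 1 "cmod z" 1] z \<tau>1 by (simp add: norm_mult)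
        then have "(cmod (1 - cnj \<tau> * z))\<^sup>2 \<le> 2\<^sup>2" by (intro power_mono) auto
        moreover have "(1 - cmod z) * (1 - (cmod \<tau>)\<^sup>2) \<le> (1 - (cmod z)\<^sup>2) * (1 - (cmod \<tau>)\<^sup>2)"
          using z \<tau>2 by (intro mult_right_mono) (auto simp: power2_eq_square mult_left_le)
        moreover have "0 \<le> (1 - (cmod z)\<^sup>2) * (1 - (cmod \<tau>)\<^sup>2)"
          using z \<tau>1 by (intro mult_nonneg_nonneg) (auto simp: abs_square_le_1)
        moreover have "0 < (cmod (1 - cnj \<tau> * z))\<^sup>2" using z den[of z] by simp
        ultimately have "(1 - cmod z) * (1 - (cmod \<tau>)\<^sup>2) / 2\<^sup>2 \<le> 1 - (cmod (m z))\<^sup>2"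
          by (simp only: frac_le)
        also have "\<dots> = (1 - cmod (m z)) * (1 + cmod (m z))" by (simp add: algebra_simps power2_eq_square)
        also have "\<dots> \<le> (1 - cmod (m z)) * 2" using mD[OF z] by (intro mult_left_mono) auto
        finally show ?thesis using \<tau>2 by (simp add: field_simps)
      qed
      finally have "cmod (1 - m z) \<le> (M' - 1) * (1 - cmod (m z))"
        using \<kappa> M unfolding M'_def by (simp add: mult_left_mono mult_ac)
      also have "\<dots> < M' * (1 - cmod (m z))" using mD[OF z] by (intro mult_strict_right_mono) auto
      finally show ?case using mD[OF z] by (auto simp: Stolz_region_def)
    qed
    with m1 have "filterlim m (at 1 within Stolz_region 1 M') (at \<sigma> within Stolz_region \<sigma> M)"
      unfolding filterlim_at by simp
    then show "filterlim m (nontangential 1) (at \<sigma> within Stolz_region \<sigma> M)"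
      by (rule filterlim_mono) (auto intro: at_within_Stolz_region_le_nontangential M')
  qed
  have inD_nt: "\<forall>\<^sub>F z in nontangential \<sigma>. z \<in> ball 0 1"
    by (rule filter_leD[OF nontangential_le_at_within_ball inD])

  \<comment> \<open>Transfer of the limits from the normalised function to the Koenigs
    function\<close>
  have a: "((\<lambda>z. (\<sigma> - z) * deriv h z / (lam * h z)) \<longlongrightarrow> of_real A) (nontangential \<sigma>)"
  proof -
    \<comment> \<open>The chain rule for h z = m z * exp (lam * l (m z)) shows that this product is
      (\<sigma> - z) * h' z / (lam * h z). The derivative of \<open>m\<close> and its difference
      quotient have the same limit, and m z tends to 1.\<close>
    have "((\<lambda>z. (1 - m z) * (1 / lam + m z * deriv l (m z)) * (m' z / ((1 - m z) / (\<sigma> - z)) / m z)) \<longlongrightarrow> of_real A * (m' \<sigma> / m' \<sigma> / 1)) (nontangential \<sigma>)"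
    proof (intro tendsto_intros filterlim_compose[OF A(2) m_nt] tendsto_mono[OF nontangential_le_at_within_ball quot]
        tendsto_mono[OF nontangential_le_at_within_ball m1])
      have "isCont m' \<sigma>" unfolding m'_def using den[of \<sigma>] \<sigma> by (intro continuous_intros) auto
      then show "(m' \<longlongrightarrow> m' \<sigma>) (nontangential \<sigma>)"
        unfolding isCont_def by (rule tendsto_mono[rotated]) (rule order_trans[OF nontangential_le_at_within_ball at_le], simp)
    qed (use m'\<sigma> \<kappa> in auto)
    moreover have "m' \<sigma> \<noteq> 0" using m'\<sigma> \<kappa> by auto
    moreover have "\<forall>\<^sub>F z in nontangential \<sigma>. m z \<noteq> 0"
      by (rule filter_leD[OF nontangential_le_at_within_ball tendsto_imp_eventually_ne[OF m1]]) simp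
    with inD_nt have "\<forall>\<^sub>F z in nontangential \<sigma>. (1 - m z) * (1 / lam + m z * deriv l (m z)) * (m' z / ((1 - m z) / (\<sigma> - z)) / m z) = (\<sigma> - z) * deriv h z / (lam * h z)"
    proof eventually_elim
      case (elim z)
      have l': "(l has_field_derivative deriv l (m z)) (at (m z))"
        using l(1) mD[OF elim(1)] by (simp add: holomorphic_derivI)
      have dm': "(m has_field_derivative m' z) (at z)" using elim by (intro dm) auto
      have "((\<lambda>z. m z * exp (lam * l (m z))) has_field_derivative (h z * m' z / m z * (1 + lam * m z * deriv l (m z)))) (at z)"
        using elim by (auto intro!: derivative_eq_intros DERIV_chain2[OF l' dm'] dm' simp: hm field_simps)
      then have "(h has_field_derivative (h z * m' z / m z * (1 + lam * m z * deriv l (m z)))) (at z)"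
        by (rule has_field_derivative_transform_within_open[of _ _ _ "ball 0 1"]) (use elim hm in auto)
      then have "deriv h z = h z * m' z / m z * (1 + lam * m z * deriv l (m z))" by (rule DERIV_imp_deriv)
      moreover have "h z \<noteq> 0" using hm[OF elim(1)] elim by simp
      moreover have "1 - m z \<noteq> 0" "\<sigma> - z \<noteq> 0" using mD[OF elim(1)] elim \<sigma> by auto
      ultimately show ?case using lam0 elim(2) by (simp add: field_simps)
    qed
    ultimately show ?thesis using Lim_transform_eventually by fastforce
  qed
  define K0 where "K0 = (cmod lam)\<^sup>2 / Re lam"
  have b: "((\<lambda>z. cis (spiral_Arg lam (h z) + A * K0 * Arg (1 - cnj \<sigma> * z))) \<longlongrightarrow> cis (K0 * v0)) (at \<sigma> within ball 0 1)"
  proof -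
    let ?F = "at \<sigma> within ball 0 1"
    have cont: "isCont Ln 1" "isCont Arg (of_real \<kappa>)"
      using \<kappa> by (auto intro: continuous_at_Arg continuous_at_Ln)
    \<comment> \<open>The number Ln (m z) / lam + l (m z) is a logarithm of h z divided by
      \<open>lam\<close>. Its imaginary part, corrected by A * Arg (1 - m z), converges; replacing
      that argument by Arg (1 - cnj \<sigma> * z) costs Arg (k z), which tends to Arg \<kappa> =
      0.\<close>
    have "((\<lambda>z. cis (K0 * (Im (Ln (m z) / lam) + Im (l (m z) + of_real A * Ln (1 - m z)) - A * Arg (k z)))) \<longlongrightarrow>
        cis (K0 * (Im (Ln 1 / lam) + v0 - A * Arg (of_real \<kappa>)))) ?F"
      by (intro tendsto_intros filterlim_compose[OF A(3) m_at] lam0 isCont_tendsto_compose[OF cont(1)]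
          isCont_tendsto_compose[OF cont(2)] m1 k)
    then have "((\<lambda>z. cis (K0 * (Im (Ln (m z) / lam) + Im (l (m z) + of_real A * Ln (1 - m z)) - A * Arg (k z)))) \<longlongrightarrow> cis (K0 * v0)) ?F"
      using \<kappa> by simp
    then show ?thesis
    proof (rule Lim_transform_eventually)
      have ev1: "\<forall>\<^sub>F z in ?F. m z \<noteq> 0" by (rule tendsto_imp_eventually_ne[OF m1]) simp
      \<comment> \<open>With both arguments below pi / 2 in modulus, the argument of the product (1
        - cnj \<sigma> * z) * k z is their sum without a correction by 2 pi.\<close>
      have ev2: "\<forall>\<^sub>F z in ?F. \<bar>Arg (k z)\<bar> < pi / 2"
      proof (rule order_tendstoD)
        show "((\<lambda>z. \<bar>Arg (k z)\<bar>) \<longlongrightarrow> \<bar>Arg (of_real \<kappa>)\<bar>) ?F"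
          by (intro tendsto_intros isCont_tendsto_compose[OF cont(2)] k)
      qed (use \<kappa> in simp)
      show "\<forall>\<^sub>F z in ?F. cis (K0 * (Im (Ln (m z) / lam) + Im (l (m z) + of_real A * Ln (1 - m z)) - A * Arg (k z)))
        = cis (spiral_Arg lam (h z) + A * K0 * Arg (1 - cnj \<sigma> * z))"
        using ev1 ev2 inD
      proof eventually_elim
        case (elim z)
        define X where "X = Ln (m z) / lam + l (m z)"
        have "h z = exp (lam * X)"
          using hm[OF elim(3)] elim(1) lam0 by (simp add: X_def distrib_left exp_add)
        then have 1: "cis (spiral_Arg lam (h z)) = cis (K0 * Im X)"
          using spiral_Arg_exp(2)[OF lam, of X] by (simp add: K0_def mult.commute)
        have "cmod (cnj \<sigma> * z) < 1" using elim(3) \<sigma> by (simp add: norm_mult)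
        then have r: "Re (1 - cnj \<sigma> * z) > 0" using abs_Re_le_cmod[of "cnj \<sigma> * z"] by simp
        have nz: "1 - cnj \<sigma> * z \<noteq> 0" "1 - m z \<noteq> 0"
          using \<open>cmod (cnj \<sigma> * z) < 1\<close> mD[OF elim(3)] by (auto simp: right_minus_eq simp del: norm_mult)
        then have "k z \<noteq> 0" by (simp add: k_def)
        have "1 - m z = (1 - cnj \<sigma> * z) * k z" using nz by (simp add: k_def)
        moreover have "\<bar>Arg (1 - cnj \<sigma> * z)\<bar> < pi / 2" using r Re_Ln_pos_lt[OF nz(1)] Arg_eq_Im_Ln[OF nz(1)] by simp
        moreover from this have "Arg (1 - cnj \<sigma> * z) + Arg (k z) \<in> {-pi<..pi}"
          using elim(2) unfolding greaterThanAtMost_iff abs_less_iff by linarith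
        ultimately have 2: "Arg (1 - m z) = Arg (1 - cnj \<sigma> * z) + Arg (k z)"
          using Arg_times[OF _ nz(1) \<open>k z \<noteq> 0\<close>] by simp
        have "cis (spiral_Arg lam (h z) + A * K0 * Arg (1 - cnj \<sigma> * z)) = cis (K0 * Im X + A * K0 * Arg (1 - cnj \<sigma> * z))"
          by (simp add: 1 flip: cis_mult)
        also have "K0 * Im X + A * K0 * Arg (1 - cnj \<sigma> * z) = K0 * (Im (Ln (m z) / lam) + Im (l (m z) + of_real A * Ln (1 - m z)) - A * Arg (k z))"
          using 2 Arg_eq_Im_Ln[OF nz(2)] by (simp add: X_def algebra_simps)
        finally show ?case by simp
      qed
    qed
  qed
  have "filterlim (\<lambda>z. cmod (h z)) at_top (at \<sigma> within ball 0 1)" if A0: "A > 0"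
  proof -
    let ?F = "at \<sigma> within ball 0 1"
    obtain \<delta> where \<delta>: "\<delta> > 0" "\<And>u. 1/2 \<le> cmod u \<Longrightarrow> cmod u < 1 \<Longrightarrow> \<delta> \<le> cmod (u * exp (lam * (l u + of_real A * Ln (1 - u))))"
      using A(4)[OF A0] by blast
    have "filterlim (\<lambda>z. cmod (1 - m z)) (at_right 0) ?F"
    proof -
      have "((\<lambda>z. cmod (1 - m z)) \<longlongrightarrow> cmod (1 - 1)) ?F" by (intro tendsto_intros m1)
      moreover have "\<forall>\<^sub>F z in ?F. 1 - m z \<noteq> 0"
        using inD by eventually_elim (use mD in fastforce)
      ultimately show ?thesis by (auto simp: filterlim_at elim: eventually_mono)
    qed
    then have "filterlim (\<lambda>z. ln (cmod (1 - m z))) at_bot ?F" by (rule filterlim_compose[OF ln_at_0])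
    then have "filterlim (\<lambda>z. - ln (cmod (1 - m z))) at_top ?F" by (simp add: filterlim_uminus_at_top)
    then have "filterlim (\<lambda>z. (A * Re lam) * (- ln (cmod (1 - m z)))) at_top ?F"
      by (rule filterlim_tendsto_pos_mult_at_top[OF tendsto_const, rotated]) (use A0 lam in simp)
    then have "filterlim (\<lambda>z. exp ((A * Re lam) * (- ln (cmod (1 - m z))))) at_top ?F"
      by (rule filterlim_compose[OF exp_at_top])
    then have "filterlim (\<lambda>z. (\<delta> * exp (- (A * \<bar>Im lam\<bar> * pi))) * exp ((A * Re lam) * (- ln (cmod (1 - m z))))) at_top ?F"
      by (rule filterlim_tendsto_pos_mult_at_top[OF tendsto_const, rotated]) (use \<delta> in simp)
    then show ?thesis
    proof (rule filterlim_at_top_mono)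
      have "((\<lambda>z. cmod (m z)) \<longlongrightarrow> cmod 1) ?F" by (intro tendsto_intros m1)
      then have "\<forall>\<^sub>F z in ?F. cmod (m z) > 1/2" by (rule order_tendstoD) simp
      with inD show "\<forall>\<^sub>F z in ?F. (\<delta> * exp (- (A * \<bar>Im lam\<bar> * pi))) * exp ((A * Re lam) * (- ln (cmod (1 - m z)))) \<le> cmod (h z)"
      proof eventually_elim
        case (elim z)
        have nz: "1 - m z \<noteq> 0" using mD[OF elim(1)] by auto
        \<comment> \<open>The first factor is bounded below by \<delta>. The second has modulus |1 -
          m z|^(- A * Re lam) times exp (A * Im lam * Arg (1 - m z)), and the last exponential is
          bounded below because arguments are at most pi in modulus.\<close>
        have "h z = (m z * exp (lam * (l (m z) + of_real A * Ln (1 - m z)))) * exp (- (lam * of_real A * Ln (1 - m z)))"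
          by (simp add: hm[OF elim(1)] distrib_left mult.assoc mult_exp_exp)
        then have "cmod (h z) = cmod (m z * exp (lam * (l (m z) + of_real A * Ln (1 - m z)))) * exp (Re (- (lam * of_real A * Ln (1 - m z))))"
          by (metis norm_exp_eq_Re norm_mult)
        moreover have "\<delta> \<le> cmod (m z * exp (lam * (l (m z) + of_real A * Ln (1 - m z))))"
          using \<delta>(2)[of "m z"] elim mD[OF elim(1)] by simp
        moreover have "Re (- (lam * of_real A * Ln (1 - m z))) = (A * Re lam) * (- ln (cmod (1 - m z))) + A * (Im lam * Arg (1 - m z))"
          using nz by (simp add: Arg_eq_Im_Ln algebra_simps)
        moreover have "- (\<bar>Im lam\<bar> * pi) \<le> Im lam * Arg (1 - m z)"
        proof -
          have "\<bar>Im lam * Arg (1 - m z)\<bar> \<le> \<bar>Im lam\<bar> * pi"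
            unfolding abs_mult using mpi_less_Arg[of "1 - m z"] Arg_le_pi[of "1 - m z"] by (intro mult_left_mono) auto
          then show ?thesis by linarith
        qed
        then have "A * (- (\<bar>Im lam\<bar> * pi)) \<le> A * (Im lam * Arg (1 - m z))" using A0 by (intro mult_left_mono) auto
        ultimately have "\<delta> * exp (- (A * \<bar>Im lam\<bar> * pi) + (A * Re lam) * (- ln (cmod (1 - m z)))) \<le> cmod (h z)"
          using \<delta>(1) by (auto intro!: mult_mono)
        then show ?case by (simp only: exp_add mult.assoc)
      qed
    qed
  qed
  then show ?thesis using that[OF A(1) a b[unfolded K0_def]] by blast
qed

section \<open>Logarithmic coordinates at the boundary point\<close>

text \<open>For z = \<sigma> * (1 - exp y) one has |\<sigma> - z| = exp (Re y), while Im y is the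
  angle from the radius. Half-strips therefore correspond to truncated sectors at \<sigma>, and near
  \<sigma> sectors and Stolz regions are contained in one another.\<close>

lemma eventually_nontangential_iff_strip:
  assumes \<sigma>: "cmod \<sigma> = 1"
  shows "eventually P (nontangential \<sigma>) \<longleftrightarrow>
    (\<forall>\<eta>. 0 < \<eta> \<and> \<eta> < pi / 2 \<longrightarrow> (\<exists>R. \<forall>y. \<bar>Im y\<bar> < \<eta> \<and> Re y < R \<longrightarrow> P (\<sigma> * (1 - exp y))))"
    (is "_ \<longleftrightarrow> ?S")
proof
  assume P: "eventually P (nontangential \<sigma>)"
  show ?S
  proof (intro allI impI, elim conjE)
    fix \<eta> :: real assume \<eta>: "0 < \<eta>" "\<eta> < pi / 2"
    \<comment> \<open>If r = |\<sigma> - z| < cos \<eta>, then 1 - |z| is at least r * cos \<eta> /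
      2 in the sector, so any amplitude above 2 / cos \<eta> suffices.\<close>
    define M where "M = 1 + 2 / cos \<eta>"
    have c: "cos \<eta> > 0" using \<eta> by (intro cos_gt_zero) auto
    then have "M > 1" by (simp add: M_def)
    then have "eventually P (at \<sigma> within Stolz_region \<sigma> M)"
      using P by (auto simp: nontangential_def eventually_Sup)
    then obtain d where d: "d > 0" "\<And>z. z \<in> Stolz_region \<sigma> M \<Longrightarrow> z \<noteq> \<sigma> \<Longrightarrow> dist z \<sigma> < d \<Longrightarrow> P z"
      unfolding eventually_at by blast
    show "\<exists>R. \<forall>y. \<bar>Im y\<bar> < \<eta> \<and> Re y < R \<longrightarrow> P (\<sigma> * (1 - exp y))"
    proof (intro exI[of _ "min (ln d) (ln (cos \<eta>))"] allI impI)
      fix y assume y: "\<bar>Im y\<bar> < \<eta> \<and> Re y < min (ln d) (ln (cos \<eta>))"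
      define r where "r = exp (Re y)"
      have r: "0 < r" "r < d" "r < cos \<eta>"
        using y d(1) c by (auto simp: r_def exp_less_cancel_iff[symmetric, of _ "ln _"] simp del: exp_less_cancel_iff)
      have dist: "cmod (\<sigma> - \<sigma> * (1 - exp y)) = r" using \<sigma> by (simp add: algebra_simps norm_mult r_def norm_exp_eq_Re)
      have "cos \<eta> \<le> cos \<bar>Im y\<bar>" using y \<eta> by (intro cos_monotone_0_pi_le) auto
      then have "r * cos \<eta> \<le> Re (exp y)" using r(1) by (simp add: Re_exp r_def)
      have "(cmod (1 - exp y))\<^sup>2 = 1 - 2 * Re (exp y) + (cmod (exp y))\<^sup>2"
        unfolding cmod_power2 by (simp add: power2_eq_square algebra_simps)
      also have "\<dots> \<le> 1 - 2 * (r * cos \<eta>) + r * cos \<eta>"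
        using \<open>r * cos \<eta> \<le> Re (exp y)\<close> mult_strict_left_mono[OF r(3) r(1)]
        by (simp add: r_def[symmetric] norm_exp_eq_Re power2_eq_square)
      finally have sq: "(cmod (1 - exp y))\<^sup>2 \<le> 1 - r * cos \<eta>" by simp
      then have "(cmod (1 - exp y))\<^sup>2 < 1" using r c mult_pos_pos[OF r(1) c] by linarith
      then have lt1: "cmod (1 - exp y) < 1" by (simp add: abs_square_less_1)
      have "1 - (cmod (1 - exp y))\<^sup>2 = (1 - cmod (1 - exp y)) * (1 + cmod (1 - exp y))" by (simp add: power2_eq_square algebra_simps)
      also have "\<dots> \<le> (1 - cmod (1 - exp y)) * 2" using lt1 by (intro mult_left_mono) auto
      finally have "r * cos \<eta> / 2 \<le> 1 - cmod (1 - exp y)" using sq by simp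
      then have "M * (r * cos \<eta> / 2) \<le> M * (1 - cmod (1 - exp y))" using \<open>M > 1\<close> by (intro mult_left_mono) auto
      moreover have "M * (r * cos \<eta> / 2) = r + r * cos \<eta> / 2" using c by (simp add: M_def field_simps)
      ultimately have "r < M * (1 - cmod (1 - exp y))" using mult_pos_pos[OF r(1) c] by linarith
      then have "\<sigma> * (1 - exp y) \<in> Stolz_region \<sigma> M"
        unfolding Stolz_region_def mem_Collect_eq dist using lt1 \<sigma> by (simp add: norm_mult)
      moreover have "\<sigma> * (1 - exp y) \<noteq> \<sigma>" using dist r(1) by auto
      ultimately show "P (\<sigma> * (1 - exp y))" using d(2) dist r(2) by (simp add: dist_norm norm_minus_commute)
    qed
  qed
next
  assume S: ?S
  show "eventually P (nontangential \<sigma>)"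
    unfolding nontangential_def eventually_Sup
  proof clarsimp
    fix M :: real assume M: "M > 1"
    \<comment> \<open>As 1 - |z| \<le> Re \<xi> with |\<xi>| = |\<sigma> - z|, the Stolz condition
      implies |\<xi>| < M * Re \<xi>, that is, the cosine of the angle exceeds 1 / M.\<close>
    define \<eta> where "\<eta> = arccos (1 / M)"
    have M1: "0 < 1 / M" "1 / M < 1" using M by auto
    have \<eta>: "0 < \<eta>" "\<eta> < pi / 2" "cos \<eta> = 1 / M"
    proof -
      show "cos \<eta> = 1 / M" using M1 by (simp add: \<eta>_def cos_arccos del: zero_less_divide_1_iff divide_less_eq_1_pos)
      show "0 < \<eta>" using arccos_less_arccos[of "1 / M" 1] M1 by (simp add: \<eta>_def)
      show "\<eta> < pi / 2" using arccos_less_arccos[of 0 "1 / M"] M1 by (simp add: \<eta>_def)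
    qed
    then obtain R where R: "\<And>y. \<bar>Im y\<bar> < \<eta> \<Longrightarrow> Re y < R \<Longrightarrow> P (\<sigma> * (1 - exp y))" using S by blast
    show "eventually P (at \<sigma> within Stolz_region \<sigma> M)"
      unfolding eventually_at
    proof (intro exI[of _ "exp R"] conjI ballI impI)
      fix z assume z: "z \<in> Stolz_region \<sigma> M" "z \<noteq> \<sigma> \<and> dist z \<sigma> < exp R"
      define \<xi> where "\<xi> = 1 - cnj \<sigma> * z"
      have \<sigma>\<sigma>: "\<sigma> * cnj \<sigma> = 1" using complex_norm_square[of \<sigma>] \<sigma> by auto
      have "\<sigma> * \<xi> = \<sigma> - (\<sigma> * cnj \<sigma>) * z" by (simp only: \<xi>_def right_diff_distrib mult.assoc mult_1_right)
      then have \<xi>: "\<sigma> - z = \<sigma> * \<xi>" by (simp add: \<sigma>\<sigma>)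
      then have n\<xi>: "cmod (\<sigma> - z) = cmod \<xi>" using \<sigma> by (simp add: norm_mult)
      have "\<xi> \<noteq> 0" using \<xi> z by auto
      define y where "y = Ln \<xi>"
      have ey: "exp y = \<xi>" using \<open>\<xi> \<noteq> 0\<close> by (simp add: y_def)
      have z_eq: "z = \<sigma> * (1 - exp y)" unfolding ey using \<xi> by (simp add: algebra_simps)
      have "cmod z = cmod (1 - \<xi>)" using \<sigma> by (simp add: z_eq ey norm_mult)
      also have "\<dots> \<ge> 1 - Re \<xi>" using complex_Re_le_cmod[of "1 - \<xi>"] by simp
      finally have "M * (1 - cmod z) \<le> M * Re \<xi>" using M by (intro mult_left_mono) auto
      then have "cmod \<xi> < M * Re \<xi>" using z(1) n\<xi> by (simp add: Stolz_region_def)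
      also have "Re \<xi> = cmod \<xi> * cos (Im y)" using arg_cong[OF ey, of Re] by (simp add: Re_exp flip: ey norm_exp_eq_Re)
      finally have "cmod \<xi> * 1 < cmod \<xi> * (M * cos (Im y))" by (simp add: mult.left_commute)
      moreover have "0 < cmod \<xi>" using \<open>\<xi> \<noteq> 0\<close> by simp
      ultimately have "1 < M * cos (Im y)" by (simp only: mult_less_cancel_left_pos)
      then have "cos \<eta> < cos \<bar>Im y\<bar>" using M \<eta>(3) by (simp add: divide_less_eq mult.commute)
      moreover have "\<bar>Im y\<bar> \<le> pi" using mpi_less_Im_Ln[OF \<open>\<xi> \<noteq> 0\<close>] Im_Ln_le_pi[OF \<open>\<xi> \<noteq> 0\<close>] by (simp add: y_def)
      ultimately have "\<bar>Im y\<bar> < \<eta>" using cos_mono_less_eq[of \<eta> "\<bar>Im y\<bar>"] \<eta> by simp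
      moreover have "exp (Re y) < exp R"
        using z(2) n\<xi> by (simp add: dist_norm norm_minus_commute flip: ey norm_exp_eq_Re)
      ultimately show "P z" using R[of y] z_eq by simp
    qed simp
  qed
qed

text \<open>In the coordinate y the logarithm \<open>N\<close> of h has derivative - lam times the
  quotient assumed to tend to \<open>A\<close>. The mean value inequality on the convex half-strip
  makes \<open>N\<close> nearly affine with slope - lam * A.\<close>

lemma Koenigs_log_strip:
  fixes h :: "complex \<Rightarrow> complex"
  assumes h: "h holomorphic_on ball 0 1" and \<sigma>: "cmod \<sigma> = 1" and lam: "lam \<noteq> 0"
    and nz: "\<forall>\<^sub>F z in nontangential \<sigma>. h z \<noteq> 0"
    and A: "((\<lambda>z. (\<sigma> - z) * deriv h z / (lam * h z)) \<longlongrightarrow> A) (nontangential \<sigma>)"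
    and \<eta>: "0 < \<eta>" "\<eta> < pi / 2" and e: "e > 0"
  obtains R N where
    "\<And>y. \<bar>Im y\<bar> < \<eta> \<Longrightarrow> Re y < R \<Longrightarrow> \<sigma> * (1 - exp y) \<in> ball 0 1 \<and> h (\<sigma> * (1 - exp y)) = exp (N y)"
    "\<And>y y'. \<bar>Im y\<bar> < \<eta> \<Longrightarrow> Re y < R \<Longrightarrow> \<bar>Im y'\<bar> < \<eta> \<Longrightarrow> Re y' < R \<Longrightarrow>
       cmod (N y' - N y + lam * A * (y' - y)) \<le> e * cmod (y' - y)"
proof -
  have e': "e / cmod lam > 0" using e lam by simp
  have "\<forall>\<^sub>F z in nontangential \<sigma>. z \<in> ball 0 1"
    by (rule filter_leD[OF nontangential_le_at_within_ball]) (simp add: eventually_at_filter)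
  from eventually_conj[OF this eventually_conj[OF nz tendstoD[OF A e']]]
  obtain R where R: "\<And>y. \<bar>Im y\<bar> < \<eta> \<Longrightarrow> Re y < R \<Longrightarrow> \<sigma> * (1 - exp y) \<in> ball 0 1 \<and> h (\<sigma> * (1 - exp y)) \<noteq> 0 \<and>
      dist ((\<sigma> - \<sigma> * (1 - exp y)) * deriv h (\<sigma> * (1 - exp y)) / (lam * h (\<sigma> * (1 - exp y)))) A < e / cmod lam"
    unfolding eventually_nontangential_iff_strip[OF \<sigma>] using \<eta> by blast
  define S where "S = {y. \<bar>Im y\<bar> < \<eta> \<and> Re y < R}"
  have S_eq: "S = {y. Im y < \<eta>} \<inter> {y. Im y > - \<eta>} \<inter> {y. Re y < R}" by (auto simp: S_def abs_less_iff)
  have "open S" "convex S"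
    unfolding S_eq by (auto intro!: open_Int convex_Int open_halfspace_Im_lt open_halfspace_Im_gt open_halfspace_Re_lt
        convex_halfspace_Im_lt convex_halfspace_Im_gt convex_halfspace_Re_lt)
  define f where "f = (\<lambda>y. h (\<sigma> * (1 - exp y)))"
  have "f holomorphic_on S"
    unfolding f_def by (rule holomorphic_on_compose_gen[OF _ h, of "\<lambda>y. \<sigma> * (1 - exp y)", unfolded o_def])
       (use R in \<open>auto intro!: holomorphic_intros simp: S_def\<close>)
  then obtain N where N: "N holomorphic_on S" "\<And>y. y \<in> S \<Longrightarrow> f y = exp (N y)"
    using contractible_imp_holomorphic_log[of f S] convex_imp_contractible[OF \<open>convex S\<close>] R
    by (auto simp: f_def S_def)
  have "cmod (deriv N y + lam * A) \<le> e \<and> (N has_field_derivative deriv N y) (at y within S)" if y: "y \<in> S" for y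
  proof -
    define z where "z = \<sigma> * (1 - exp y)"
    have z: "z \<in> ball 0 1" "h z \<noteq> 0" "dist ((\<sigma> - z) * deriv h z / (lam * h z)) A < e / cmod lam"
      using R[of y] y by (auto simp: S_def z_def)
    have dN: "(N has_field_derivative deriv N y) (at y)" using N(1) \<open>open S\<close> y by (rule holomorphic_derivI)
    have "(h has_field_derivative deriv h z) (at (\<sigma> * (1 - exp y)))"
      using h z(1) unfolding z_def by (intro holomorphic_derivI) auto
    moreover have "((\<lambda>y. \<sigma> * (1 - exp y)) has_field_derivative - \<sigma> * exp y) (at y)"
      by (auto intro!: derivative_eq_intros)
    ultimately have "(f has_field_derivative deriv h z * (- \<sigma> * exp y)) (at y)"
      unfolding f_def by (rule DERIV_chain2)
    moreover have "(f has_field_derivative exp (N y) * deriv N y) (at y)"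
      by (rule has_field_derivative_transform_within_open[OF _ \<open>open S\<close> y, of "\<lambda>y. exp (N y)"])
         (use N dN in \<open>auto intro!: derivative_eq_intros\<close>)
    ultimately have "h z * deriv N y = deriv h z * (- \<sigma> * exp y)"
      using N(2)[OF y] DERIV_unique by (fastforce simp: f_def z_def)
    moreover have "\<sigma> - z = \<sigma> * exp y" by (simp add: z_def algebra_simps)
    ultimately have "h z * deriv N y = - ((\<sigma> - z) * deriv h z)" by simp
    then have "deriv N y = - ((\<sigma> - z) * deriv h z) / h z"
      using z(2) by (metis mult.commute nonzero_eq_divide_eq)
    then have "deriv N y = - lam * ((\<sigma> - z) * deriv h z / (lam * h z))"
      using lam by simp
    then have "deriv N y + lam * A = - lam * ((\<sigma> - z) * deriv h z / (lam * h z) - A)" by (simp only: right_diff_distrib) simp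
    then have "cmod (deriv N y + lam * A) = cmod lam * dist ((\<sigma> - z) * deriv h z / (lam * h z)) A"
      by (simp only: norm_mult dist_norm norm_minus_cancel)
    also have "\<dots> \<le> cmod lam * (e / cmod lam)" using z(3) by (intro mult_left_mono) auto
    finally show ?thesis using dN lam by (auto intro: has_field_derivative_at_within)
  qed
  then have "cmod ((N y' + lam * A * y') - (N y + lam * A * y)) \<le> e * cmod (y' - y)" if "y \<in> S" "y' \<in> S" for y y'
    using that \<open>convex S\<close>
    by (intro field_differentiable_bound[of S "\<lambda>y. N y + lam * A * y" "\<lambda>y. deriv N y + lam * A"])
       (auto intro!: derivative_eq_intros)
  then have "cmod (N y' - N y + lam * A * (y' - y)) \<le> e * cmod (y' - y)" if "y \<in> S" "y' \<in> S" for y y'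
    using that by (simp add: right_diff_distrib add_diff_eq diff_diff_eq add.commute add.left_commute diff_add_eq)
  then show ?thesis using that[of R N] R N(2) by (auto simp: S_def f_def)
qed

lemma filterlim_radial_nontangential:
  assumes \<sigma>: "cmod \<sigma> = 1"
  shows "filterlim (\<lambda>x. \<sigma> * (1 - of_real x)) (nontangential \<sigma>) (at_right 0)"
  unfolding filterlim_iff
proof (intro allI impI)
  fix P assume P: "eventually P (nontangential \<sigma>)"
  have "0 < (1::real) \<and> 1 < pi / 2" using pi_gt3 by simp
  then obtain R where R: "\<forall>y. \<bar>Im y\<bar> < 1 \<and> Re y < R \<longrightarrow> P (\<sigma> * (1 - exp y))"
    using P unfolding eventually_nontangential_iff_strip[OF \<sigma>] by blast
  show "\<forall>\<^sub>F x in at_right 0. P (\<sigma> * (1 - of_real x))" unfolding eventually_at_right_field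
  proof (intro exI[of _ "exp R"] conjI allI impI)
    fix x :: real assume "0 < x" "x < exp R"
    then have "ln x < R" using ln_less_cancel_iff[of x "exp R"] by simp
    then show "P (\<sigma> * (1 - of_real x))" using R[rule_format, of "of_real (ln x)"] \<open>x > 0\<close> by (simp add: exp_of_real)
  qed simp
qed

text \<open>The mean value inequality for f z - L * z on a short radius compares difference quotient
  and derivative. The quotient is what the coordinate y sees: its logarithm is the displacement
  caused by f.\<close>

lemma angular_derivative_difference_quotient:
  assumes f: "f holomorphic_on ball 0 1" and \<sigma>: "cmod \<sigma> = 1"
    and lim: "(f \<longlongrightarrow> \<sigma>) (nontangential \<sigma>)" and deriv: "(deriv f \<longlongrightarrow> L) (nontangential \<sigma>)"
  shows "((\<lambda>x. (1 - cnj \<sigma> * f (\<sigma> * (1 - of_real x))) / of_real x) \<longlongrightarrow> L) (at_right (0::real))"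
proof (rule tendstoI)
  note radial = filterlim_radial_nontangential[OF \<sigma>]
  have \<sigma>\<sigma>: "\<sigma> * cnj \<sigma> = 1" using complex_norm_square[of \<sigma>] \<sigma> by auto
  fix e :: real assume e: "e > 0"
  then have "\<forall>\<^sub>F x in at_right 0. dist (deriv f (\<sigma> * (1 - of_real x))) L < e / 2"
    by (intro tendstoD[OF filterlim_compose[OF deriv radial]]) auto
  then obtain d0 where d0: "d0 > 0" "\<And>x. 0 < x \<Longrightarrow> x < d0 \<Longrightarrow> dist (deriv f (\<sigma> * (1 - of_real x))) L < e / 2"
    unfolding eventually_at_right_field by auto
  define d where "d = min d0 1"
  have d: "d > 0" "d \<le> 1" "d \<le> d0" using d0(1) by (auto simp: d_def)
  \<comment> \<open>The segment is open because f is holomorphic only inside the disc; the endpoint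
    \<sigma> is reached afterwards as a limit.\<close>
  define S where "S = open_segment \<sigma> (\<sigma> * (1 - of_real d))"
  have "convex S" by (simp add: S_def)
  have ne: "\<sigma> \<noteq> \<sigma> * (1 - of_real d)" using \<sigma> d by auto
  have S: "\<sigma> * (1 - of_real x) \<in> S" if "0 < x" "x < d" for x
    unfolding S_def in_segment using that d ne
    by (intro conjI exI[of _ "x / d"]) (auto simp: scaleR_conv_of_real algebra_simps)
  have SD: "z \<in> ball 0 1" "cmod (deriv f z - L) \<le> e / 2" if "z \<in> S" for z
  proof -
    obtain u where u: "0 < u" "u < 1" "z = \<sigma> * (1 - of_real (u * d))"
    proof -
      obtain u where u: "0 < u" "u < 1" "z = (1 - u) *\<^sub>R \<sigma> + u *\<^sub>R (\<sigma> * (1 - of_real d))"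
        using \<open>z \<in> S\<close> unfolding S_def in_segment by blast
      have "z = \<sigma> * (1 - of_real (u * d))"
        unfolding u(3) scaleR_conv_of_real of_real_diff of_real_mult of_real_1 by algebra
      with u(1,2) show ?thesis by (rule that)
    qed
    have ud: "0 < u * d" "u * d < d" using u d by (auto simp: mult_less_cancel_right1)
    have "cmod z = \<bar>1 - u * d\<bar>" unfolding u(3) norm_mult using \<sigma>
      by (metis mult_1 norm_of_real of_real_1 of_real_diff)
    then show "z \<in> ball 0 1" using ud d by simp
    show "cmod (deriv f z - L) \<le> e / 2" using d0(2)[of "u * d"] ud d unfolding u(3) by (simp add: dist_norm)
  qed
  have bd: "cmod ((f z - L * z) - (f w - L * w)) \<le> e / 2 * cmod (z - w)" if zw: "z \<in> S" "w \<in> S" for z w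
  proof (rule field_differentiable_bound[OF \<open>convex S\<close> _ _ zw(1) zw(2)])
    fix z assume z: "z \<in> S"
    have "(f has_field_derivative deriv f z) (at z within S)"
      using f SD(1)[OF z] by (intro has_field_derivative_at_within[OF holomorphic_derivI]) auto
    then show "((\<lambda>z. f z - L * z) has_field_derivative deriv f z - L) (at z within S)"
      by (auto intro!: derivative_eq_intros)
    show "cmod (deriv f z - L) \<le> e / 2" by (rule SD(2)[OF z])
  qed
  have ev: "\<forall>\<^sub>F x in at_right 0. x \<in> {0<..<d}"
    using d(1) by (rule eventually_at_right_real)
  then show "\<forall>\<^sub>F x in at_right 0. dist ((1 - cnj \<sigma> * f (\<sigma> * (1 - of_real x))) / of_real x) L < e"
  proof eventually_elim
    case (elim x)
    define z where "z = \<sigma> * (1 - of_real x)"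
    have z: "z \<in> S" using elim by (auto simp: z_def intro: S)
    have "cmod ((f z - L * z) - (\<sigma> - L * \<sigma>)) \<le> e / 2 * cmod (z - \<sigma>)"
    proof (rule tendsto_le[OF trivial_limit_at_right_real])
      have "((\<lambda>s. \<sigma> * (1 - of_real s)) \<longlongrightarrow> \<sigma>) (at_right 0)" by (rule tendsto_eq_intros refl | simp)+
      then show "((\<lambda>s. e / 2 * cmod (z - \<sigma> * (1 - of_real s))) \<longlongrightarrow> e / 2 * cmod (z - \<sigma>)) (at_right 0)"
        "((\<lambda>s. cmod ((f z - L * z) - (f (\<sigma> * (1 - of_real s)) - L * (\<sigma> * (1 - of_real s)))))
           \<longlongrightarrow> cmod ((f z - L * z) - (\<sigma> - L * \<sigma>))) (at_right 0)"
        by (intro tendsto_intros filterlim_compose[OF lim radial]; simp)+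
      show "\<forall>\<^sub>F s in at_right 0. cmod ((f z - L * z) - (f (\<sigma> * (1 - of_real s)) - L * (\<sigma> * (1 - of_real s)))) \<le> e / 2 * cmod (z - \<sigma> * (1 - of_real s))"
        using ev
      proof eventually_elim
        case (elim s)
        then have "\<sigma> * (1 - of_real s) \<in> S" by (intro S) auto
        then show ?case by (rule bd[OF z])
      qed
    qed
    moreover have "(f z - L * z) - (\<sigma> - L * \<sigma>) = - \<sigma> * ((1 - cnj \<sigma> * f z) - L * of_real x)"
    proof -
      have "\<sigma> * (cnj \<sigma> * f z) = f z" by (simp add: \<sigma>\<sigma> flip: mult.assoc)
      then show ?thesis by (simp add: z_def algebra_simps)
    qed
    moreover have "z - \<sigma> = - \<sigma> * of_real x" by (simp add: z_def algebra_simps)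
    ultimately have "cmod ((1 - cnj \<sigma> * f z) - L * of_real x) \<le> e / 2 * x"
      using \<sigma> elim by (simp add: norm_mult)
    moreover have "(1 - cnj \<sigma> * f z) / of_real x - L = ((1 - cnj \<sigma> * f z) - L * of_real x) / of_real x"
      using elim by (simp add: field_simps)
    ultimately have "dist ((1 - cnj \<sigma> * f z) / of_real x) L \<le> e / 2"
      using elim by (simp add: dist_norm norm_divide divide_le_eq)
    then show ?case using e by (simp add: z_def)
  qed
qed

text \<open>On the radius f displaces y by approximately d, so log h changes by approximately - lam
  * A * d. This change is always a logarithm of \<open>c\<close>, and the logarithms of
  \<open>c\<close> form a closed set, so the approximate value is an exact one.\<close>

lemma multiplier_eq_if_angular_derivative:
  fixes f h :: "complex \<Rightarrow> complex"
  assumes h: "h holomorphic_on ball 0 1" and \<sigma>: "cmod \<sigma> = 1" and lam: "lam \<noteq> 0"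
    and nz: "\<forall>\<^sub>F z in nontangential \<sigma>. h z \<noteq> 0"
    and A: "((\<lambda>z. (\<sigma> - z) * deriv h z / (lam * h z)) \<longlongrightarrow> A) (nontangential \<sigma>)"
    and f: "f holomorphic_on ball 0 1" "f ` ball 0 1 \<subseteq> ball 0 1"
    and hf: "\<And>z. z \<in> ball 0 1 \<Longrightarrow> h (f z) = c * h z"
    and lim: "(f \<longlongrightarrow> \<sigma>) (nontangential \<sigma>)"
    and deriv: "(deriv f \<longlongrightarrow> of_real (exp d)) (nontangential \<sigma>)"
  shows "exp (- (lam * A * of_real d)) = c"
proof -
  define a where "a = - (lam * A * of_real d)"
  define q where "q = (\<lambda>x::real. (1 - cnj \<sigma> * f (\<sigma> * (1 - of_real x))) / of_real x)"
  have q: "(q \<longlongrightarrow> of_real (exp d)) (at_right 0)"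
    unfolding q_def by (rule angular_derivative_difference_quotient[OF f(1) \<sigma> lim deriv])
  have Lnq: "((\<lambda>x. Ln (q x)) \<longlongrightarrow> of_real d) (at_right 0)"
  proof -
    have "((\<lambda>x. Ln (q x)) \<longlongrightarrow> Ln (of_real (exp d))) (at_right 0)"
      by (intro isCont_tendsto_compose[OF continuous_at_Ln] q) auto
    then show ?thesis by (simp add: Ln_of_real)
  qed
  have \<sigma>\<sigma>: "\<sigma> * cnj \<sigma> = 1" using complex_norm_square[of \<sigma>] \<sigma> by auto
  have "a \<in> closure {D. exp D = c}"
    unfolding closure_approachable
  proof (intro allI impI)
    fix \<epsilon> :: real assume \<epsilon>: "\<epsilon> > 0"
    define e where "e = \<epsilon> / 2 / (cmod d + 1)"
    have e: "e > 0" using \<epsilon> by (simp add: e_def add_nonneg_pos)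
    have pi2: "1 < pi / 2" using pi_gt3 by simp
    obtain R N where
      N: "\<And>y. \<bar>Im y\<bar> < 1 \<Longrightarrow> Re y < R \<Longrightarrow> \<sigma> * (1 - exp y) \<in> ball 0 1 \<and> h (\<sigma> * (1 - exp y)) = exp (N y)"
      and dN: "\<And>y y'. \<bar>Im y\<bar> < 1 \<Longrightarrow> Re y < R \<Longrightarrow> \<bar>Im y'\<bar> < 1 \<Longrightarrow> Re y' < R \<Longrightarrow>
        cmod (N y' - N y + lam * A * (y' - y)) \<le> e * cmod (y' - y)"
      by (rule Koenigs_log_strip[OF h \<sigma> lam nz A zero_less_one pi2 e]) (assumption | rule that)+
    have 1: "\<forall>\<^sub>F x in at_right 0. dist (Ln (q x)) (of_real d) < min 1 (\<epsilon> / (2 * (cmod (lam * A) + 1)))"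
      using \<epsilon> by (intro tendstoD[OF Lnq]) (auto intro!: divide_pos_pos add_nonneg_pos)
    have 2: "\<forall>\<^sub>F x in at_right 0. q x \<noteq> 0"
      by (rule tendsto_imp_eventually_ne[OF q]) simp
    have "filterlim ln at_bot (at_right (0::real))" by (rule ln_at_0)
    \<comment> \<open>The margin |d| + 1 keeps the displaced point in the half-strip, since Ln (q x)
      differs from d by less than 1.\<close>
    then have 3: "\<forall>\<^sub>F x in at_right 0. ln x < R - \<bar>d\<bar> - 1" by (simp add: filterlim_at_bot_dense)
    obtain x where x: "x > 0" "q x \<noteq> 0" "ln x < R - \<bar>d\<bar> - 1"
      "cmod (Ln (q x) - d) < min 1 (\<epsilon> / (2 * (cmod (lam * A) + 1)))"
      using eventually_happens[OF eventually_conj[OF eventually_conj[OF 1 2] eventually_conj[OF 3 eventually_at_right_less]]]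
      by (auto simp: dist_norm)
    define y where "y = complex_of_real (ln x)"
    \<comment> \<open>By the definition of \<open>q\<close>, this is the coordinate of the image of
      the point with coordinate y under f.\<close>
    define y' where "y' = y + Ln (q x)"
    have z: "exp y = of_real x" using x(1) by (simp add: y_def exp_of_real)
    have "exp y' = 1 - cnj \<sigma> * f (\<sigma> * (1 - of_real x))"
      using x(1,2) by (simp add: y'_def exp_add z) (simp add: q_def)
    then have "\<sigma> * (1 - exp y') = (\<sigma> * cnj \<sigma>) * f (\<sigma> * (1 - of_real x))" by simp
    then have fz: "\<sigma> * (1 - exp y') = f (\<sigma> * (1 - exp y))" by (simp add: \<sigma>\<sigma> z)
    have "\<bar>Im (Ln (q x) - d)\<bar> < 1" "\<bar>Re (Ln (q x) - d)\<bar> < 1"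
      using x(4) abs_Im_le_cmod[of "Ln (q x) - d"] abs_Re_le_cmod[of "Ln (q x) - d"] by auto
    then have y: "\<bar>Im y\<bar> < 1" "Re y < R" "\<bar>Im y'\<bar> < 1" "Re y' < R"
      using x(3) by (auto simp: y_def y'_def)
    have "exp (N y') = c * exp (N y)"
      using N[OF y(1,2)] N[OF y(3,4)] hf[of "\<sigma> * (1 - exp y)"] by (simp add: fz)
    then have D: "exp (N y' - N y) = c" by (simp add: exp_diff)
    have "cmod (N y' - N y + lam * A * Ln (q x)) \<le> e * cmod (Ln (q x))"
      using dN[OF y] by (simp add: y'_def)
    also have "cmod (Ln (q x)) \<le> cmod d + 1" using norm_triangle_sub[of "Ln (q x)" "of_real d"] x(4) by simp
    then have "e * cmod (Ln (q x)) \<le> e * (cmod d + 1)" using e by (intro mult_left_mono) auto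
    also have "\<dots> = \<epsilon> / 2"
      using add_nonneg_pos[OF abs_ge_zero zero_less_one, of d] by (simp add: e_def field_simps)
    finally have 4: "cmod (N y' - N y + lam * A * Ln (q x)) \<le> \<epsilon> / 2" .
    have "N y' - N y - a = (N y' - N y + lam * A * Ln (q x)) - lam * A * (Ln (q x) - of_real d)"
      by (simp add: a_def algebra_simps)
    then have "cmod (N y' - N y - a) \<le> \<epsilon> / 2 + cmod (lam * A) * cmod (Ln (q x) - of_real d)"
      using norm_triangle_ineq4 4 by (metis (no_types, lifting) add_mono_thms_linordered_semiring(3) norm_mult order_trans)
    also have "cmod (lam * A) * cmod (Ln (q x) - of_real d) < \<epsilon> / 2"
    proof -
      have "cmod (lam * A) * cmod (Ln (q x) - of_real d) \<le> (cmod (lam * A) + 1) * cmod (Ln (q x) - of_real d)"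
        by (intro mult_right_mono) auto
      also have "\<dots> < (cmod (lam * A) + 1) * (\<epsilon> / (2 * (cmod (lam * A) + 1)))"
        using x(4) by (intro mult_strict_left_mono) (auto intro: add_nonneg_pos)
      also have "\<dots> = \<epsilon> / 2" using add_nonneg_pos[OF norm_ge_zero zero_less_one, of "lam * A"] by (simp add: field_simps)
      finally show ?thesis .
    qed
    finally show "\<exists>D\<in>{D. exp D = c}. dist D a < \<epsilon>"
      using D by (intro bexI[of _ "N y' - N y"]) (auto simp: dist_norm)
  qed
  moreover have "closed {D. exp D = c}"
    by (intro closed_Collect_eq continuous_intros)
  ultimately show ?thesis by (simp add: a_def)
qed

text \<open>As log h is nearly affine with slope - lam * A \<noteq> 0, the equation N p = N y - lam
  * t has a solution close to y + t / A. By injectivity of h that solution is the coordinate of the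
  image under f, so f is asymptotically the translation by t / A. This gives the difference
  quotient, and the functional equation upgrades it to the derivative.\<close>

lemma angular_derivative_if_atom:
  fixes f h :: "complex \<Rightarrow> complex" and A t :: real
  assumes h: "h holomorphic_on ball 0 1" "inj_on h (ball 0 1)" and \<sigma>: "cmod \<sigma> = 1" and lam: "lam \<noteq> 0"
    and nz: "\<forall>\<^sub>F z in nontangential \<sigma>. h z \<noteq> 0"
    and A: "((\<lambda>z. (\<sigma> - z) * deriv h z / (lam * h z)) \<longlongrightarrow> of_real A) (nontangential \<sigma>)" "A > 0"
    and f: "f holomorphic_on ball 0 1" "f ` ball 0 1 \<subseteq> ball 0 1" and t: "t \<ge> 0"
    and hf: "\<And>z. z \<in> ball 0 1 \<Longrightarrow> h (f z) = exp (- lam * of_real t) * h z"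
  shows "(f \<longlongrightarrow> \<sigma>) (nontangential \<sigma>)" "(deriv f \<longlongrightarrow> of_real (exp (t / A))) (nontangential \<sigma>)"
proof -
  have step: "\<exists>R. \<forall>y. \<bar>Im y\<bar> < \<eta> \<and> Re y < R \<longrightarrow>
      (\<exists>y'. cmod (y' - (y + of_real (t / A))) \<le> \<epsilon> \<and> f (\<sigma> * (1 - exp y)) = \<sigma> * (1 - exp y'))"
    if \<eta>: "0 < \<eta>" "\<eta> + \<epsilon> < pi / 2" and \<epsilon>: "\<epsilon> > 0" for \<eta> \<epsilon>
  proof -
    have tA: "t / A \<ge> 0" using t A by simp
    \<comment> \<open>The bound 1 / 2 makes the map \<open>T\<close> below a contraction. The other
      bound keeps the ball \<open>B\<close> invariant, because |p - y| \<le> t / A + \<epsilon>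
      there.\<close>
    define e where "e = cmod (lam * A) * min (1 / 2) (\<epsilon> / (t / A + \<epsilon>))"
    have lA: "cmod (lam * A) > 0" using lam A(2) by simp
    have q: "min (1 / 2) (\<epsilon> / (t / A + \<epsilon>)) > 0" using \<epsilon> tA by (auto intro!: divide_pos_pos)
    have e: "e > 0" unfolding e_def using lA q by (rule mult_pos_pos)
    have \<eta>': "0 < \<eta> + \<epsilon>" using \<eta> \<epsilon> by simp
    obtain R N where
      N: "\<And>y. \<bar>Im y\<bar> < \<eta> + \<epsilon> \<Longrightarrow> Re y < R \<Longrightarrow> \<sigma> * (1 - exp y) \<in> ball 0 1 \<and> h (\<sigma> * (1 - exp y)) = exp (N y)"
      and dN: "\<And>y y'. \<bar>Im y\<bar> < \<eta> + \<epsilon> \<Longrightarrow> Re y < R \<Longrightarrow> \<bar>Im y'\<bar> < \<eta> + \<epsilon> \<Longrightarrow> Re y' < R \<Longrightarrow>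
        cmod (N y' - N y + lam * of_real A * (y' - y)) \<le> e * cmod (y' - y)"
      by (rule Koenigs_log_strip[OF h(1) \<sigma> lam nz A(1) \<eta>' \<eta>(2) e]) (assumption | rule that)+
    show ?thesis
    proof (intro exI[of _ "R - t / A - \<epsilon>"] allI impI)
      fix y assume y: "\<bar>Im y\<bar> < \<eta> \<and> Re y < R - t / A - \<epsilon>"
      define B where "B = cball (y + of_real (t / A)) \<epsilon>"
      have yS: "\<bar>Im y\<bar> < \<eta> + \<epsilon>" "Re y < R" using y \<epsilon> tA by linarith+
      have BS: "\<bar>Im p\<bar> < \<eta> + \<epsilon>" "Re p < R" if "p \<in> B" for p
      proof -
        have "cmod (p - (y + of_real (t / A))) \<le> \<epsilon>" using that by (simp add: B_def dist_norm norm_minus_commute)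
        then have "\<bar>Im p - Im y\<bar> \<le> \<epsilon>" "\<bar>Re p - (Re y + t / A)\<bar> \<le> \<epsilon>"
          using abs_Im_le_cmod[of "p - (y + of_real (t / A))"] abs_Re_le_cmod[of "p - (y + of_real (t / A))"] by auto
        then show "\<bar>Im p\<bar> < \<eta> + \<epsilon>" "Re p < R" using y by linarith+
      qed
      \<comment> \<open>A simplified Newton iteration for \<open>N p = N y - lam * t\<close>.\<close>
      define T where "T = (\<lambda>p. p + (N p - N y + lam * of_real t) / (lam * of_real A))"
      have lA0: "lam * of_real A \<noteq> 0" using lam A(2) by simp
      have e2: "e / cmod (lam * of_real A) = min (1 / 2) (\<epsilon> / (t / A + \<epsilon>))"
        using lA by (simp add: e_def)
      have contr: "dist (T p) (T p') \<le> 1 / 2 * dist p p'" if "p \<in> B" "p' \<in> B" for p p'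
      proof -
        have "T p - T p' = (N p - N p' + lam * of_real A * (p - p')) / (lam * of_real A)"
          using lA0 by (simp add: T_def field_simps)
        then have "dist (T p) (T p') = cmod (N p - N p' + lam * of_real A * (p - p')) / cmod (lam * of_real A)"
          by (simp only: dist_norm norm_divide)
        also have "\<dots> \<le> e * cmod (p - p') / cmod (lam * of_real A)"
          using dN[OF BS[OF that(2)] BS[OF that(1)]] by (intro divide_right_mono) auto
        also have "\<dots> = (e / cmod (lam * of_real A)) * dist p p'" by (simp add: dist_norm)
        also have "\<dots> \<le> 1 / 2 * dist p p'" unfolding e2 by (rule mult_right_mono[OF min.cobounded1]) simp
        finally show ?thesis .
      qed
      have self: "T p \<in> B" if "p \<in> B" for p
      proof -
        have "T p - (y + of_real (t / A)) = (N p - N y + lam * of_real A * (p - y)) / (lam * of_real A)"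
          using lam A(2) by (simp add: T_def field_simps)
        then have "dist (T p) (y + of_real (t / A)) = cmod (N p - N y + lam * of_real A * (p - y)) / cmod (lam * of_real A)"
          by (simp only: dist_norm norm_divide)
        also have "\<dots> \<le> e * cmod (p - y) / cmod (lam * of_real A)"
          using dN[OF yS BS[OF that]] by (intro divide_right_mono) auto
        also have "\<dots> = (e / cmod (lam * of_real A)) * cmod (p - y)" by simp
        also have "\<dots> \<le> (\<epsilon> / (t / A + \<epsilon>)) * (t / A + \<epsilon>)"
          unfolding e2
        proof (intro mult_mono)
          have "cmod (p - y) \<le> cmod (p - (y + of_real (t / A))) + cmod (of_real (t / A))"
            using norm_triangle_ineq[of "p - (y + of_real (t / A))" "of_real (t / A)"] by simp
          also have "cmod (of_real (t / A)) = t / A" using tA by (simp only: norm_of_real abs_of_nonneg)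
          finally show "cmod (p - y) \<le> t / A + \<epsilon>" using that by (simp add: B_def dist_norm norm_minus_commute)
        qed (use \<epsilon> tA in auto)
        also have "\<dots> = \<epsilon>" using \<epsilon> tA by simp
        finally show ?thesis by (simp add: B_def dist_commute)
      qed
      have "\<exists>!p\<in>B. T p = p"
        by (rule Banach_fix[of B "1 / 2" T]) (use \<epsilon> self contr in \<open>auto simp: B_def complete_eq_closed\<close>)
      then obtain p where p: "p \<in> B" "T p = p" by blast
      then have "N p - N y + lam * of_real t = 0" using lA0 by (simp add: T_def)
      then have Np: "N p = - lam * of_real t + N y" by (simp add: algebra_simps)
      have zy: "\<sigma> * (1 - exp y) \<in> ball 0 1" "h (\<sigma> * (1 - exp y)) = exp (N y)" using N[OF yS] by auto
      have zp: "\<sigma> * (1 - exp p) \<in> ball 0 1" "h (\<sigma> * (1 - exp p)) = exp (N p)" using N[OF BS[OF p(1)]] by auto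
      have "h (f (\<sigma> * (1 - exp y))) = h (\<sigma> * (1 - exp p))"
        unfolding hf[OF zy(1)] zy(2) zp(2) Np exp_add ..
      then have "f (\<sigma> * (1 - exp y)) = \<sigma> * (1 - exp p)"
        using inj_onD[OF h(2)] f(2) zy(1) zp(1) by blast
      then show "\<exists>y'. cmod (y' - (y + of_real (t / A))) \<le> \<epsilon> \<and> f (\<sigma> * (1 - exp y)) = \<sigma> * (1 - exp y')"
        using p(1) by (intro exI[of _ p]) (auto simp: B_def dist_norm norm_minus_commute)
    qed
  qed
  \<comment> \<open>A half-strip of half-width \<eta> goes into one of half-width \<eta> +
    \<epsilon>, still below pi / 2, so f preserves non-tangential approach and can be substituted
    into \<open>E\<close>.\<close>
  have nt: "filterlim f (nontangential \<sigma>) (nontangential \<sigma>)"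
    unfolding filterlim_iff
  proof (intro allI impI)
    fix P assume P: "eventually P (nontangential \<sigma>)"
    show "\<forall>\<^sub>F z in nontangential \<sigma>. P (f z)"
      unfolding eventually_nontangential_iff_strip[OF \<sigma>]
    proof (intro allI impI, elim conjE)
      fix \<eta> :: real assume \<eta>: "0 < \<eta>" "\<eta> < pi / 2"
      define \<epsilon> where "\<epsilon> = (pi / 2 - \<eta>) / 2"
      have \<epsilon>: "\<epsilon> > 0" "\<eta> + \<epsilon> < pi / 2" using \<eta> by (auto simp: \<epsilon>_def field_simps)
      obtain R where R: "\<And>y. \<bar>Im y\<bar> < \<eta> \<and> Re y < R \<Longrightarrow>
        \<exists>y'. cmod (y' - (y + of_real (t / A))) \<le> \<epsilon> \<and> f (\<sigma> * (1 - exp y)) = \<sigma> * (1 - exp y')"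
        using step[OF \<eta>(1) \<epsilon>(2,1)] by blast
      have "0 < \<eta> + \<epsilon> \<and> \<eta> + \<epsilon> < pi / 2" using \<eta> \<epsilon> by simp
      then obtain R' where R': "\<And>y. \<bar>Im y\<bar> < \<eta> + \<epsilon> \<and> Re y < R' \<Longrightarrow> P (\<sigma> * (1 - exp y))"
        using P unfolding eventually_nontangential_iff_strip[OF \<sigma>] by blast
      show "\<exists>R. \<forall>y. \<bar>Im y\<bar> < \<eta> \<and> Re y < R \<longrightarrow> P (f (\<sigma> * (1 - exp y)))"
      proof (intro exI[of _ "min R (R' - t / A - \<epsilon>)"] allI impI)
        fix y assume y: "\<bar>Im y\<bar> < \<eta> \<and> Re y < min R (R' - t / A - \<epsilon>)"
        then obtain y' where y': "cmod (y' - (y + of_real (t / A))) \<le> \<epsilon>" "f (\<sigma> * (1 - exp y)) = \<sigma> * (1 - exp y')"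
          using R[of y] by auto
        have "\<bar>Im y' - Im y\<bar> \<le> \<epsilon>" "\<bar>Re y' - (Re y + t / A)\<bar> \<le> \<epsilon>"
          using y'(1) abs_Im_le_cmod[of "y' - (y + of_real (t / A))"] abs_Re_le_cmod[of "y' - (y + of_real (t / A))"] by auto
        then show "P (f (\<sigma> * (1 - exp y)))" unfolding y'(2) using y by (intro R') (auto simp: abs_le_iff abs_less_iff)
      qed
    qed
  qed
  have id_nt: "((\<lambda>z. z) \<longlongrightarrow> \<sigma>) (nontangential \<sigma>)"
    by (rule tendsto_mono[OF nontangential_le_at_within_ball tendsto_ident_at])
  show "(f \<longlongrightarrow> \<sigma>) (nontangential \<sigma>)" by (rule filterlim_compose[OF id_nt nt])
  have quot: "((\<lambda>z. (\<sigma> - f z) / (\<sigma> - z)) \<longlongrightarrow> of_real (exp (t / A))) (nontangential \<sigma>)"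
  proof (rule tendstoI)
    fix e :: real assume e: "e > 0"
    have "isCont exp (complex_of_real (t / A))" by simp
    then obtain s where s: "s > 0" "\<And>w. dist w (complex_of_real (t / A)) < s \<Longrightarrow> dist (exp w) (exp (of_real (t / A))) < e"
      unfolding continuous_at_eps_delta using e by blast
    show "\<forall>\<^sub>F z in nontangential \<sigma>. dist ((\<sigma> - f z) / (\<sigma> - z)) (of_real (exp (t / A))) < e"
      unfolding eventually_nontangential_iff_strip[OF \<sigma>]
    proof (intro allI impI, elim conjE)
      fix \<eta> :: real assume \<eta>: "0 < \<eta>" "\<eta> < pi / 2"
      define \<epsilon> where "\<epsilon> = min (s / 2) ((pi / 2 - \<eta>) / 2)"
      have le: "\<epsilon> \<le> (pi / 2 - \<eta>) / 2" "\<epsilon> \<le> s / 2" unfolding \<epsilon>_def by (rule min.cobounded2 min.cobounded1)+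
      have \<epsilon>: "\<epsilon> > 0" using \<eta> s(1) by (simp add: \<epsilon>_def)
      have \<epsilon>2: "\<eta> + \<epsilon> < pi / 2" using le(1) \<eta>(2) by argo
      have \<epsilon>3: "\<epsilon> < s" using le(2) s(1) by argo
      obtain R where R: "\<And>y. \<bar>Im y\<bar> < \<eta> \<and> Re y < R \<Longrightarrow>
        \<exists>y'. cmod (y' - (y + of_real (t / A))) \<le> \<epsilon> \<and> f (\<sigma> * (1 - exp y)) = \<sigma> * (1 - exp y')"
        using step[OF \<eta>(1) \<epsilon>2 \<epsilon>] by blast
      show "\<exists>R. \<forall>y. \<bar>Im y\<bar> < \<eta> \<and> Re y < R \<longrightarrow>
        dist ((\<sigma> - f (\<sigma> * (1 - exp y))) / (\<sigma> - \<sigma> * (1 - exp y))) (of_real (exp (t / A))) < e"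
      proof (intro exI[of _ R] allI impI)
        fix y assume "\<bar>Im y\<bar> < \<eta> \<and> Re y < R"
        then obtain y' where y': "cmod (y' - (y + of_real (t / A))) \<le> \<epsilon>" "f (\<sigma> * (1 - exp y)) = \<sigma> * (1 - exp y')"
          using R[of y] by auto
        have "(\<sigma> - f (\<sigma> * (1 - exp y))) / (\<sigma> - \<sigma> * (1 - exp y)) = exp (y' - y)"
          unfolding y'(2) using \<sigma> by (auto simp: right_diff_distrib exp_diff)
        moreover have "dist (y' - y) (complex_of_real (t / A)) < s"
          using y'(1) \<epsilon>3 by (simp add: dist_norm diff_diff_eq)
        ultimately show "dist ((\<sigma> - f (\<sigma> * (1 - exp y))) / (\<sigma> - \<sigma> * (1 - exp y))) (of_real (exp (t / A))) < e"
          using s(2)[of "y' - y"] unfolding exp_of_real by simp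
      qed
    qed
  qed
  define E where "E = (\<lambda>z. (\<sigma> - z) * deriv h z / (lam * h z))"
  have E: "(E \<longlongrightarrow> of_real A) (nontangential \<sigma>)" using A(1) by (simp add: E_def)
  \<comment> \<open>Differentiating h (f z) = exp (- lam * t) * h z expresses f' through h'. In
    terms of \<open>E\<close> this is exactly the product here, whose last factor tends to A / A =
    1.\<close>
  have "((\<lambda>z. (\<sigma> - f z) / (\<sigma> - z) * (E z / E (f z))) \<longlongrightarrow> of_real (exp (t / A)) * (of_real A / of_real A)) (nontangential \<sigma>)"
    by (intro tendsto_intros quot E filterlim_compose[OF E nt]) (use A(2) in simp)
  then have "((\<lambda>z. (\<sigma> - f z) / (\<sigma> - z) * (E z / E (f z))) \<longlongrightarrow> of_real (exp (t / A))) (nontangential \<sigma>)"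
    using A(2) by simp
  then show "(deriv f \<longlongrightarrow> of_real (exp (t / A))) (nontangential \<sigma>)"
  proof (rule Lim_transform_eventually)
    have inD: "\<forall>\<^sub>F z in nontangential \<sigma>. z \<in> ball 0 1"
      by (rule filter_leD[OF nontangential_le_at_within_ball]) (simp add: eventually_at_filter)
    show "\<forall>\<^sub>F z in nontangential \<sigma>. (\<sigma> - f z) / (\<sigma> - z) * (E z / E (f z)) = deriv f z"
      using inD nz
    proof eventually_elim
      case (elim z)
      have fz: "f z \<in> ball 0 1" using f(2) elim by blast
      have "((\<lambda>z. h (f z)) has_field_derivative deriv h (f z) * deriv f z) (at z)"
        using elim fz h(1) f(1) by (intro DERIV_chain2[of h] holomorphic_derivI) auto
      moreover have "((\<lambda>z. h (f z)) has_field_derivative exp (- lam * of_real t) * deriv h z) (at z)"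
      proof (rule has_field_derivative_transform_within_open[of "\<lambda>z. exp (- lam * of_real t) * h z" _ _ "ball 0 1"])
        have "(h has_field_derivative deriv h z) (at z)" using elim h(1) by (simp add: holomorphic_derivI)
        then show "((\<lambda>z. exp (- lam * of_real t) * h z) has_field_derivative exp (- lam * of_real t) * deriv h z) (at z)"
          by (rule DERIV_cmult)
      qed (use elim hf in auto)
      ultimately have D: "deriv h (f z) * deriv f z = exp (- lam * of_real t) * deriv h z" by (rule DERIV_unique)
      have "deriv h (f z) \<noteq> 0" using holomorphic_injective_imp_regular[OF h(1) _ h(2) fz] by simp
      then have df: "deriv f z = exp (- lam * of_real t) * deriv h z / deriv h (f z)" using D by (simp add: field_simps)
      have ne: "\<sigma> - z \<noteq> 0" "\<sigma> - f z \<noteq> 0" "deriv h z \<noteq> 0"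
        using elim fz \<sigma> holomorphic_injective_imp_regular[OF h(1) _ h(2) elim(1)] by auto
      show ?case unfolding E_def hf[OF elim(1)] df using ne lam elim(2) \<open>deriv h (f z) \<noteq> 0\<close> by (simp add: divide_simps)
    qed
  qed
qed

section \<open>The equivalence and the asymptotics of the spiral argument\<close>

lemma nontangential_neq_bot:
  assumes "cmod \<sigma> = 1"
  shows "nontangential \<sigma> \<noteq> bot"
  using filterlim_radial_nontangential[OF assms] trivial_limit_at_right_real[of 0]
  by (auto simp: filterlim_def filtermap_bot_iff bot_unique)

text \<open>In the coordinate y the ray of angle \<beta> is the horizontal line Im y = \<beta>,
  which lies in a strip of half-width below pi / 2. Such rays test whether a non-tangential limit
  can depend on the angle.\<close>

lemma filterlim_sector_nontangential:
  assumes \<sigma>: "cmod \<sigma> = 1" and \<beta>: "\<bar>\<beta>\<bar> < pi / 2"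
  shows "filterlim (\<lambda>x. \<sigma> * (1 - rcis x \<beta>)) (nontangential \<sigma>) (at_right 0)"
  unfolding filterlim_iff
proof (intro allI impI)
  fix P assume P: "eventually P (nontangential \<sigma>)"
  obtain \<eta> where \<eta>: "\<bar>\<beta>\<bar> < \<eta>" "\<eta> < pi / 2" using dense[OF \<beta>] by blast
  then have "0 < \<eta> \<and> \<eta> < pi / 2" by linarith
  then obtain R where R: "\<forall>y. \<bar>Im y\<bar> < \<eta> \<and> Re y < R \<longrightarrow> P (\<sigma> * (1 - exp y))"
    using P unfolding eventually_nontangential_iff_strip[OF \<sigma>] by blast
  show "\<forall>\<^sub>F x in at_right 0. P (\<sigma> * (1 - rcis x \<beta>))" unfolding eventually_at_right_field
  proof (intro exI[of _ "exp R"] conjI allI impI)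
    fix x :: real assume x: "0 < x" "x < exp R"
    then have "ln x < R" using ln_less_cancel_iff[of x "exp R"] by simp
    moreover have "exp (Complex (ln x) \<beta>) = rcis x \<beta>"
      using x(1) by (simp add: exp_eq_polar rcis_def exp_of_real)
    ultimately show "P (\<sigma> * (1 - rcis x \<beta>))" using R[rule_format, of "Complex (ln x) \<beta>"] \<eta>(1) by simp
  qed simp
qed

text \<open>A repelling spectral value makes the multiplier identity hold for all t, so exp (lam *
  (1 + A * \<nu>) * t) = 1 for all t \<ge> 0. This forces 1 + A * \<nu> = 0 and in particular
  excludes A = 0. Conversely, an atom yields the translation by t / A for every t.\<close>

lemma repelling_spectral_value_iff_atom:
  assumes h: "h holomorphic_on ball 0 1" "inj_on h (ball 0 1)" and \<sigma>: "cmod \<sigma> = 1" and lam: "lam \<noteq> 0"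
    and nz: "\<forall>\<^sub>F z in nontangential \<sigma>. h z \<noteq> 0"
    and A: "((\<lambda>z. (\<sigma> - z) * deriv h z / (lam * h z)) \<longlongrightarrow> of_real A) (nontangential \<sigma>)" "A \<ge> 0"
    and \<phi>: "\<And>t. t \<ge> 0 \<Longrightarrow> \<phi> t holomorphic_on ball 0 1" "\<And>t. t \<ge> 0 \<Longrightarrow> \<phi> t ` ball 0 1 \<subseteq> ball 0 1"
    and h\<phi>: "\<And>t z. t \<ge> 0 \<Longrightarrow> z \<in> ball 0 1 \<Longrightarrow> h (\<phi> t z) = exp (- lam * of_real t) * h z"
  shows "repelling_spectral_value \<phi> \<sigma> \<nu> \<longleftrightarrow> A > 0 \<and> \<nu> = - 1 / A"
proof
  assume r: "repelling_spectral_value \<phi> \<sigma> \<nu>"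
  then have \<nu>: "\<nu> < 0" by (simp add: repelling_spectral_value_def)
  have eq: "exp (lam * (1 + of_real (A * \<nu>)) * of_real t) = 1" if t: "t \<ge> 0" for t
  proof -
    have "exp (- (lam * of_real A * of_real (- \<nu> * t))) = exp (- lam * of_real t)"
      by (rule multiplier_eq_if_angular_derivative[OF h(1) \<sigma> lam nz A(1) \<phi>(1,2)[OF t] h\<phi>[OF t]])
         (use r t in \<open>auto simp: repelling_spectral_value_def\<close>)
    then have "exp (- (lam * of_real A * of_real (- \<nu> * t))) * exp (lam * of_real t) = 1"
      by (simp flip: exp_add)
    then show ?thesis by (simp add: algebra_simps flip: exp_add)
  qed
  define w where "w = lam * (1 + of_real (A * \<nu>))"
  have "w = 0"
  proof (rule ccontr)
    assume w: "w \<noteq> 0"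
    \<comment> \<open>This time makes the exponent unimodular, whereas exponents with exponential 1
      are multiples of 2 pi i.\<close>
    have "exp (w * of_real (1 / cmod w)) = 1" using eq[of "1 / cmod w"] by (simp add: w_def)
    then obtain n :: int where n: "Re (w * of_real (1 / cmod w)) = 0" "Im (w * of_real (1 / cmod w)) = of_int (2 * n) * pi"
      unfolding exp_eq_1 by auto
    have "cmod (w * of_real (1 / cmod w)) = 1" using w by (simp add: norm_mult norm_divide)
    then have "\<bar>of_int (2 * n) * pi\<bar> = 1" using n by (simp only: cmod_eq_Im)
    then have "\<bar>real_of_int n\<bar> * (2 * pi) = 1" by (simp add: abs_mult)
    moreover have "\<bar>real_of_int n\<bar> * (2 * pi) \<ge> 1 * (2 * pi)" if "n \<noteq> 0"
      using that by (intro mult_right_mono) auto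
    ultimately show False using pi_gt3 by (cases "n = 0") auto
  qed
  then have "1 + complex_of_real (A * \<nu>) = 0" using lam by (simp add: w_def)
  then have "complex_of_real (1 + A * \<nu>) = 0" by simp
  then have "1 + A * \<nu> = 0" by (simp only: of_real_eq_0_iff)
  then show "A > 0 \<and> \<nu> = - 1 / A" using A(2) by (cases "A = 0") (auto simp: field_simps)
next
  assume "A > 0 \<and> \<nu> = - 1 / A"
  then have A0: "A > 0" and \<nu>: "\<nu> = - 1 / A" by auto
  show "repelling_spectral_value \<phi> \<sigma> \<nu>"
    unfolding repelling_spectral_value_def
  proof (intro conjI allI impI)
    show "\<nu> < 0" using A0 \<nu> by simp
    fix t :: real assume t: "t \<ge> 0"
    note rep = angular_derivative_if_atom[OF h \<sigma> lam nz A(1) A0 \<phi>(1,2)[OF t] t h\<phi>[OF t]]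
    show "(\<phi> t \<longlongrightarrow> \<sigma>) (nontangential \<sigma>)" by (rule rep(1)) auto
    have "exp (- \<nu> * t) = exp (t / A)" by (simp add: \<nu>)
    then show "(deriv (\<phi> t) \<longlongrightarrow> of_real (exp (- \<nu> * t))) (nontangential \<sigma>)" using rep(2) by simp
  qed
qed

text \<open>The cut of the spiral argument is at - pi, far from the limit 0. Near the limit it
  agrees with the principal argument of its \<open>cis\<close>, which is continuous there.\<close>

lemma tendsto_spiral_Arg_0:
  assumes lam: "Re lam > 0" and nz: "\<forall>\<^sub>F z in F. g z \<noteq> 0"
    and lim: "((\<lambda>z. cis (spiral_Arg lam (g z))) \<longlongrightarrow> 1) F"
  shows "((\<lambda>z. spiral_Arg lam (g z)) \<longlongrightarrow> 0) F"
proof -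
  have lam0: "lam \<noteq> 0" using lam by auto
  have "((\<lambda>z. Arg (cis (spiral_Arg lam (g z)))) \<longlongrightarrow> Arg 1) F"
    by (intro isCont_tendsto_compose[OF continuous_at_Arg] lim) auto
  then have "((\<lambda>z. Arg (cis (spiral_Arg lam (g z)))) \<longlongrightarrow> 0) F" by simp
  moreover have "\<forall>\<^sub>F z in F. cis (spiral_Arg lam (g z)) \<in> ball 1 1"
    using lim by (rule topological_tendstoD) auto
  then have "\<forall>\<^sub>F z in F. Arg (cis (spiral_Arg lam (g z))) = spiral_Arg lam (g z)"
    using nz
  proof eventually_elim
    case (elim z)
    have "g z = exp (lam * (Ln (g z) / lam))" using elim(2) lam0 by simp
    then have r: "spiral_Arg lam (g z) \<in> {-pi..<pi}" using spiral_Arg_exp(1)[OF lam] by metis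
    moreover have "cis (- pi) = - 1" by (simp add: complex_eq_iff)
    then have "spiral_Arg lam (g z) \<noteq> - pi" using elim(1) by (auto simp: dist_norm)
    ultimately show ?case by (intro Arg_cis) auto
  qed
  ultimately show ?thesis by (rule Lim_transform_eventually)
qed

lemma spiral_Arg_bounds:
  assumes "Re lam > 0" and "w \<noteq> 0"
  shows "spiral_Arg lam w \<in> {-pi..<pi}"
proof -
  have "lam \<noteq> 0" using assms(1) by auto
  then show ?thesis using spiral_Arg_exp(1)[OF assms(1), of "Ln w / lam"] assms(2) by simp
qed

text \<open>Modulo 2 pi the spiral argument is linear in the logarithm, so a constant factor of the
  Koenigs function only adds a constant.\<close>

lemma cis_spiral_Arg_mult:
  assumes lam: "Re lam > 0" and w: "c \<noteq> 0" "w \<noteq> 0"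
  shows "cis (spiral_Arg lam (c * w)) = cis (spiral_Arg lam c) * cis (spiral_Arg lam w)"
proof -
  have lam0: "lam \<noteq> 0" using lam by auto
  define X where "X = (\<lambda>w. Ln w / lam)"
  have 1: "exp (lam * X w) = w" if "w \<noteq> 0" for w using that lam0 by (simp add: X_def)
  have 2: "exp (lam * (X c + X w)) = c * w" using 1 w by (simp add: distrib_left exp_add)
  show ?thesis
    using spiral_Arg_exp(2)[OF lam, of "X c"] spiral_Arg_exp(2)[OF lam, of "X w"] spiral_Arg_exp(2)[OF lam, of "X c + X w"]
    unfolding 2 1[OF w(1)] 1[OF w(2)] by (simp add: cis_mult distrib_right add_divide_distrib)
qed

lemma cis_spiral_Arg_cis:
  assumes lam: "Re lam > 0"
  shows "cis (spiral_Arg lam (cis \<alpha>)) = cis \<alpha>"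
proof -
  have lam0: "lam \<noteq> 0" using lam by auto
  have N: "(Re lam)\<^sup>2 + (Im lam)\<^sup>2 \<noteq> 0" using lam by (simp add: sum_power2_eq_zero_iff)
  have "exp (lam * (\<i> * of_real \<alpha> / lam)) = cis \<alpha>" using lam0 by (simp add: cis_conv_exp)
  moreover have "Im (\<i> * of_real \<alpha> / lam) = \<alpha> * Re lam / ((Re lam)\<^sup>2 + (Im lam)\<^sup>2)"
    by (simp add: Im_divide)
  then have "Im (\<i> * of_real \<alpha> / lam) * (cmod lam)\<^sup>2 / Re lam = \<alpha>"
    using lam N by (simp add: cmod_power2)
  ultimately show ?thesis using spiral_Arg_exp(2)[OF lam, of "\<i> * of_real \<alpha> / lam"] by simp
qed

text \<open>Conjugation by the Moebius map at \<tau> turns f into a self-map fixing 0. The resulting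
  bound supplies the monotonicity of the modulus used for the spirallike property.\<close>

lemma Schwarz_Pick_fixed_point:
  assumes f: "f holomorphic_on ball 0 1" "f ` ball 0 1 \<subseteq> ball 0 1" and \<tau>: "\<tau> \<in> ball 0 1" "f \<tau> = \<tau>"
    and z: "z \<in> ball 0 1"
  shows "cmod (Moebius_function 0 \<tau> (f z)) \<le> cmod (Moebius_function 0 \<tau> z)"
proof -
  define N where "N = Moebius_function 0 (-\<tau>)"
  have ND: "N u \<in> ball 0 1" if "u \<in> ball 0 1" for u
    using Moebius_function_norm_lt_1[of "-\<tau>" u] that \<tau> by (simp add: N_def)
  have N: "N holomorphic_on ball 0 1" unfolding N_def using \<tau> by (intro Moebius_function_holomorphic) simp
  have M: "Moebius_function 0 \<tau> holomorphic_on ball 0 1" using \<tau> by (intro Moebius_function_holomorphic) simp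
  have MD: "cmod (Moebius_function 0 \<tau> u) < 1" if "u \<in> ball 0 1" for u
    using Moebius_function_norm_lt_1[of \<tau> u] that \<tau> by simp
  have fN: "(f \<circ> N) holomorphic_on ball 0 1" "\<And>u. u \<in> ball 0 1 \<Longrightarrow> f (N u) \<in> ball 0 1"
    using holomorphic_on_compose_gen[OF N f(1)] ND f(2) by blast+
  have F: "(Moebius_function 0 \<tau> \<circ> (f \<circ> N)) holomorphic_on ball 0 1"
    by (rule holomorphic_on_compose_gen[OF fN(1) M]) (use fN(2) in auto)
  have "cmod ((Moebius_function 0 \<tau> \<circ> (f \<circ> N)) (Moebius_function 0 \<tau> z)) \<le> cmod (Moebius_function 0 \<tau> z)"
    using MD[OF z] MD fN(2) \<tau>
    by (intro Schwarz_Lemma(1)[OF F]) (auto simp: N_def Moebius_function_of_zero Moebius_function_eq_zero)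
  moreover have "N (Moebius_function 0 \<tau> z) = z"
    unfolding N_def using \<tau> z by (intro Moebius_function_compose) auto
  ultimately show ?thesis by simp
qed

text \<open>Along the orbit of \<tau> the function h tends to h \<tau> by continuity and to 0 by the
  functional equation.\<close>

lemma Koenigs_function_at_Denjoy_Wolff_point:
  assumes "Denjoy_Wolff_point \<phi> \<tau>" "\<tau> \<in> ball 0 1" "Koenigs_function \<phi> lam h" "Re lam > 0"
  shows "h \<tau> = 0"
proof -
  have h: "h holomorphic_on ball 0 1" and eq: "\<And>t. t \<ge> 0 \<Longrightarrow> h (\<phi> t \<tau>) = exp (- lam * of_real t) * h \<tau>"
    using assms(2,3) by (auto simp: Koenigs_function_def)
  have "compact {\<tau>} \<and> {\<tau>} \<subseteq> unit_disc" using assms(2) by simp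
  then have "uniform_limit {\<tau>} \<phi> (\<lambda>_. \<tau>) at_top"
    using assms(1) unfolding Denjoy_Wolff_point_def by blast
  then have "((\<lambda>t. \<phi> t \<tau>) \<longlongrightarrow> \<tau>) at_top" by (rule tendsto_uniform_limitI) simp
  moreover have "isCont h \<tau>"
    using h assms(2) holomorphic_on_imp_continuous_on continuous_on_eq_continuous_at open_ball by blast
  ultimately have 1: "((\<lambda>t. h (\<phi> t \<tau>)) \<longlongrightarrow> h \<tau>) at_top" by (metis isCont_tendsto_compose)
  have "filterlim (\<lambda>t. - Re lam * t) at_bot at_top"
    by (rule filterlim_tendsto_neg_mult_at_bot[OF tendsto_const _ filterlim_ident]) (use assms(4) in simp)
  then have "((\<lambda>t. exp (- Re lam * t)) \<longlongrightarrow> 0) at_top" by (rule filterlim_compose[OF exp_at_bot])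
  then have "((\<lambda>t. exp (- lam * of_real t)) \<longlongrightarrow> 0) at_top"
    by (subst tendsto_norm_zero_iff[symmetric]) (simp add: norm_exp_eq_Re)
  then have "((\<lambda>t. exp (- lam * of_real t) * h \<tau>) \<longlongrightarrow> 0) at_top"
    by (rule tendsto_mult_left_zero)
  then have "((\<lambda>t. h (\<phi> t \<tau>)) \<longlongrightarrow> 0) at_top"
    by (rule Lim_transform_eventually) (auto intro: eventually_mono[OF eventually_ge_at_top[of 0]] simp: eq)
  then show ?thesis using tendsto_unique[OF _ 1] by simp
qed

text \<open>The limit modulo 2 pi is stated through \<open>cis\<close>: the spiral argument may jump
  across its cut while its image on the circle converges.\<close>

theorem theorem6p2:
  fixes \<phi> :: "real \<Rightarrow> complex \<Rightarrow> complex" and h :: "complex \<Rightarrow> complex"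
    and \<tau> lam \<sigma> :: complex
  assumes "holomorphic_semigroup \<phi>"
    and "\<not> is_group \<phi>"
    and "Denjoy_Wolff_point \<phi> \<tau>" and "\<tau> \<in> unit_disc"
    and "spectral_value \<phi> \<tau> lam" and "Re lam > 0"
    and "Koenigs_function \<phi> lam h"
    and "\<sigma> \<in> sphere 0 1"
  shows "(repelling_fixed_point \<phi> \<sigma> \<longleftrightarrow>
            filterlim (\<lambda>z. cmod (h z)) at_top (at \<sigma> within unit_disc) \<and>
            (\<forall>c. c \<noteq> 0 \<longrightarrow>
               Liminf (nontangential \<sigma>) (\<lambda>z. ereal (spiral_Arg lam (c * h z))) \<noteq>
               Limsup (nontangential \<sigma>) (\<lambda>z. ereal (spiral_Arg lam (c * h z)))))
       \<and> (repelling_fixed_point \<phi> \<sigma> \<longleftrightarrow>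
            filterlim (\<lambda>z. cmod (h z)) at_top (at \<sigma> within unit_disc) \<and>
            (\<forall>c. c \<noteq> 0 \<longrightarrow>
               Liminf (at \<sigma> within unit_disc) (\<lambda>z. ereal (spiral_Arg lam (c * h z))) \<noteq>
               Limsup (at \<sigma> within unit_disc) (\<lambda>z. ereal (spiral_Arg lam (c * h z)))))
       \<and> (\<forall>\<nu>. repelling_spectral_value \<phi> \<sigma> \<nu> \<longrightarrow>
            (\<exists>\<theta>\<^sub>0\<in>{-pi..<pi}. \<forall>z \<beta>.
               (\<forall>n. z n \<in> unit_disc) \<and> z \<longlonglongrightarrow> \<sigma> \<and>
               (\<lambda>n. Arg (1 - cnj \<sigma> * z n)) \<longlonglongrightarrow> \<beta> \<and> \<beta> \<in> {-pi/2<..<pi/2} \<longrightarrow>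
               (\<lambda>n. cis (spiral_Arg lam (h (z n))))
                 \<longlonglongrightarrow> cis (\<theta>\<^sub>0 + \<beta> * (cmod lam)\<^sup>2 / (\<nu> * Re lam))))"
proof -
  note h\<tau> = Koenigs_function_at_Denjoy_Wolff_point[OF assms(3,4,7,6)]
  have lam: "Re lam > 0" by fact
  have lam0: "lam \<noteq> 0" using lam by auto
  have \<sigma>: "cmod \<sigma> = 1" using assms(8) by simp
  have \<phi>: "\<phi> t holomorphic_on unit_disc" "\<phi> t ` unit_disc \<subseteq> unit_disc" if "t \<ge> 0" for t
    using assms(1) that by (auto simp: holomorphic_semigroup_def)
  have h: "h holomorphic_on unit_disc" "inj_on h unit_disc"
    and h\<phi>: "\<And>t z. t \<ge> 0 \<Longrightarrow> z \<in> unit_disc \<Longrightarrow> h (\<phi> t z) = exp (- lam * of_real t) * h z"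
    using assms(7) by (auto simp: Koenigs_function_def)
  \<comment> \<open>Both points have value 0 under the injective h.\<close>
  have \<phi>\<tau>: "\<phi> t \<tau> = \<tau>" if t: "t \<ge> 0" for t
  proof (rule inj_onD[OF h(2)])
    show "h (\<phi> t \<tau>) = h \<tau>" using h\<phi>[OF t assms(4)] h\<tau> by simp
    show "\<phi> t \<tau> \<in> unit_disc" using \<phi>(2)[OF t] assms(4) by blast
  qed fact
  have spiral: "\<exists>z'\<in>unit_disc. cmod (Moebius_function 0 \<tau> z') \<le> cmod (Moebius_function 0 \<tau> z) \<and>
      h z' = exp (- lam * of_real t) * h z" if "t \<ge> 0" "z \<in> unit_disc" for t z
    using Schwarz_Pick_fixed_point[OF \<phi>[OF that(1)] assms(4) \<phi>\<tau>[OF that(1)] that(2)] \<phi>(2)[OF that(1)] that h\<phi>[OF that]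
    by blast
  define K where "K = (cmod lam)\<^sup>2 / Re lam"
  have K: "K > 0" using lam lam0 by (simp add: K_def)
  obtain A v where A: "A \<ge> 0"
    "((\<lambda>z. (\<sigma> - z) * deriv h z / (lam * h z)) \<longlongrightarrow> of_real A) (nontangential \<sigma>)"
    "((\<lambda>z. cis (spiral_Arg lam (h z) + A * K * Arg (1 - cnj \<sigma> * z))) \<longlongrightarrow> cis v) (at \<sigma> within unit_disc)"
    "A > 0 \<Longrightarrow> filterlim (\<lambda>z. cmod (h z)) at_top (at \<sigma> within unit_disc)"
    by (rule Koenigs_boundary_behaviour[OF h assms(4) h\<tau> lam \<sigma> spiral, folded K_def]) (assumption | rule that)+
  have nz: "\<forall>\<^sub>F z in at \<sigma> within unit_disc. h z \<noteq> 0"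
  proof -
    have "\<sigma> \<noteq> \<tau>" using \<sigma> assms(4) by auto
    then have "\<forall>\<^sub>F z in at \<sigma> within unit_disc. z \<noteq> \<tau>" using tendsto_imp_eventually_ne[OF tendsto_ident_at] by blast
    moreover have "\<forall>\<^sub>F z in at \<sigma> within unit_disc. z \<in> unit_disc" by (simp add: eventually_at_filter)
    ultimately show ?thesis
    proof eventually_elim
      case (elim z)
      then show ?case using inj_onD[OF h(2) _ elim(2) assms(4)] h\<tau> by auto
    qed
  qed
  have rsv: "repelling_spectral_value \<phi> \<sigma> \<nu> \<longleftrightarrow> A > 0 \<and> \<nu> = - 1 / A" for \<nu>
    using repelling_spectral_value_iff_atom[OF h \<sigma> lam0 filter_leD[OF nontangential_le_at_within_ball nz] A(2,1) \<phi> h\<phi>] .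
  then have rfp: "repelling_fixed_point \<phi> \<sigma> \<longleftrightarrow> A > 0" by (auto simp: repelling_fixed_point_def)
  \<comment> \<open>Working with any filter between non-tangential and unrestricted approach covers
    conditions (2) and (3) at once: it suffices to refute convergence along the smaller filter and
    to prove it along the larger one.\<close>
  have eqv: "A > 0 \<longleftrightarrow> filterlim (\<lambda>z. cmod (h z)) at_top (at \<sigma> within unit_disc) \<and>
      (\<forall>c. c \<noteq> 0 \<longrightarrow> Liminf F (\<lambda>z. ereal (spiral_Arg lam (c * h z))) \<noteq> Limsup F (\<lambda>z. ereal (spiral_Arg lam (c * h z))))"
    if F: "nontangential \<sigma> \<le> F" "F \<le> at \<sigma> within unit_disc" for F
  proof -
    have Fb: "F \<noteq> bot" using nontangential_neq_bot[OF \<sigma>] F(1) bot_unique by auto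
    \<comment> \<open>A common value of the lower and upper limits would be a limit of the spiral
      argument. Cancelling it against the known asymptotics leaves a non-tangential limit of cis (A
      * K * Arg (1 - cnj \<sigma> * z)), although this function takes the value cis (A * K *
      \<beta>) on the ray of angle \<beta>.\<close>
    have False if A0: "A > 0" and c: "c \<noteq> 0"
      and eq: "Liminf F (\<lambda>z. ereal (spiral_Arg lam (c * h z))) = Limsup F (\<lambda>z. ereal (spiral_Arg lam (c * h z)))" for c
    proof -
      define L where "L = Limsup F (\<lambda>z. ereal (spiral_Arg lam (c * h z)))"
      have L: "((\<lambda>z. ereal (spiral_Arg lam (c * h z))) \<longlongrightarrow> L) F"
        using Fb eq by (intro Liminf_eq_Limsup) (auto simp: L_def)
      have bnd: "\<forall>\<^sub>F z in F. spiral_Arg lam (c * h z) \<in> {-pi..<pi}"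
        using filter_leD[OF F(2) nz] by eventually_elim (use spiral_Arg_bounds[OF lam] c in auto)
      have "L \<le> ereal pi"
        by (rule tendsto_upperbound[OF L _ Fb]) (use bnd in \<open>auto elim: eventually_mono\<close>)
      moreover have "ereal (- pi) \<le> L"
        by (rule tendsto_lowerbound[OF L _ Fb]) (use bnd in \<open>auto elim: eventually_mono\<close>)
      ultimately obtain r where r: "L = ereal r" by (cases L) auto
      have "((\<lambda>z. spiral_Arg lam (c * h z)) \<longlongrightarrow> r) F" using L r by simp
      then have 1: "((\<lambda>z. cis (spiral_Arg lam (c * h z))) \<longlongrightarrow> cis r) (nontangential \<sigma>)"
        by (intro tendsto_intros) (rule tendsto_mono[OF F(1)])
      have "((\<lambda>z. cis (spiral_Arg lam c) * cis (spiral_Arg lam (h z) + A * K * Arg (1 - cnj \<sigma> * z)) / cis (spiral_Arg lam (c * h z)))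
          \<longlongrightarrow> cis (spiral_Arg lam c) * cis v / cis r) (nontangential \<sigma>)"
        by (intro tendsto_intros 1 tendsto_mono[OF nontangential_le_at_within_ball A(3)]) simp
      moreover have "\<forall>\<^sub>F z in nontangential \<sigma>. cis (spiral_Arg lam c) * cis (spiral_Arg lam (h z) + A * K * Arg (1 - cnj \<sigma> * z)) / cis (spiral_Arg lam (c * h z))
          = cis (A * K * Arg (1 - cnj \<sigma> * z))"
        using filter_leD[OF nontangential_le_at_within_ball nz]
      proof eventually_elim
        case (elim z)
        show ?case unfolding cis_spiral_Arg_mult[OF lam c elim] cis_mult[symmetric] by simp
      qed
      ultimately have lim: "((\<lambda>z. cis (A * K * Arg (1 - cnj \<sigma> * z))) \<longlongrightarrow> cis (spiral_Arg lam c) * cis v / cis r) (nontangential \<sigma>)"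
        by (rule Lim_transform_eventually)
      have \<sigma>\<sigma>: "cnj \<sigma> * \<sigma> = 1" using complex_norm_square[of \<sigma>] \<sigma> by (auto simp: mult.commute)
      have const: "cis (A * K * \<beta>) = cis (spiral_Arg lam c) * cis v / cis r" if \<beta>: "\<bar>\<beta>\<bar> < pi / 2" for \<beta>
      proof (rule tendsto_unique[OF trivial_limit_at_right_real])
        show "((\<lambda>x. cis (A * K * Arg (1 - cnj \<sigma> * (\<sigma> * (1 - rcis x \<beta>))))) \<longlongrightarrow> cis (spiral_Arg lam c) * cis v / cis r) (at_right 0)"
          by (rule filterlim_compose[OF lim filterlim_sector_nontangential[OF \<sigma> \<beta>]])
        have "\<forall>\<^sub>F x in at_right 0. cis (A * K * Arg (1 - cnj \<sigma> * (\<sigma> * (1 - rcis x \<beta>)))) = cis (A * K * \<beta>)"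
          using eventually_at_right_less
        proof eventually_elim
          case (elim x)
          have "1 - cnj \<sigma> * (\<sigma> * (1 - rcis x \<beta>)) = rcis x \<beta>" by (simp add: \<sigma>\<sigma> flip: mult.assoc)
          moreover have "Arg (rcis x \<beta>) = \<beta>"
          proof -
            have "Arg (cis \<beta>) = \<beta>" using \<beta> pi_gt_zero by (intro Arg_cis) (auto simp: abs_less_iff)
            then show ?thesis using elim by (simp add: rcis_def Arg_times_of_real)
          qed
          ultimately show ?case by simp
        qed
        then show "((\<lambda>x. cis (A * K * Arg (1 - cnj \<sigma> * (\<sigma> * (1 - rcis x \<beta>))))) \<longlongrightarrow> cis (A * K * \<beta>)) (at_right 0)"
          by (rule tendsto_eventually)
      qed
      \<comment> \<open>The bound 1 keeps \<beta> below pi / 2. The other bound puts A * K * \<beta>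
        into the interval from 0 to pi, where \<open>Arg\<close> recovers it from its
        \<open>cis\<close>.\<close>
      define \<beta> where "\<beta> = min 1 (pi / (A * K))"
      have AK: "A * K > 0" using A0 K by simp
      have \<beta>: "0 < \<beta>" "\<beta> \<le> 1" "\<beta> \<le> pi / (A * K)"
        unfolding \<beta>_def using AK by (auto simp: min_def)
      have "cis (A * K * \<beta>) = cis (A * K * 0)"
        using const[of \<beta>] const[of 0] \<beta> pi_gt3 by simp
      then have "Arg (cis (A * K * \<beta>)) = 0" by simp
      moreover have gt: "A * K * \<beta> > 0" using mult_pos_pos[OF AK \<beta>(1)] .
      have "A * K * \<beta> \<le> pi" using \<beta>(3) AK by (simp only: pos_le_divide_eq mult.commute)
      then have "Arg (cis (A * K * \<beta>)) = A * K * \<beta>" using gt pi_gt_zero by (intro Arg_cis) auto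
      ultimately show False using gt by linarith
    qed
    moreover have "\<exists>c. c \<noteq> 0 \<and> Liminf F (\<lambda>z. ereal (spiral_Arg lam (c * h z))) = Limsup F (\<lambda>z. ereal (spiral_Arg lam (c * h z)))"
      if "\<not> A > 0"
    \<comment> \<open>For A = 0 the spiral argument of h tends to v modulo 2 pi; this rotation moves
      the limit to 0, away from the cut.\<close>
    proof (intro exI[of _ "cis (- v)"] conjI)
      have A0: "A = 0" using A(1) that by simp
      have "((\<lambda>z. cis (- v) * cis (spiral_Arg lam (h z))) \<longlongrightarrow> cis (- v) * cis v) F"
        using tendsto_mult[OF tendsto_const tendsto_mono[OF F(2) A(3)], of "cis (- v)"] by (simp add: A0)
      then have "((\<lambda>z. cis (- v) * cis (spiral_Arg lam (h z))) \<longlongrightarrow> 1) F" by (simp add: cis_mult)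
      moreover have "\<forall>\<^sub>F z in F. cis (- v) * cis (spiral_Arg lam (h z)) = cis (spiral_Arg lam (cis (- v) * h z))"
        using filter_leD[OF F(2) nz]
        by eventually_elim (simp add: cis_spiral_Arg_mult[OF lam] cis_spiral_Arg_cis[OF lam])
      ultimately have "((\<lambda>z. cis (spiral_Arg lam (cis (- v) * h z))) \<longlongrightarrow> 1) F"
        by (rule Lim_transform_eventually)
      moreover have "\<forall>\<^sub>F z in F. cis (- v) * h z \<noteq> 0"
        using filter_leD[OF F(2) nz] by eventually_elim simp
      ultimately have "((\<lambda>z. spiral_Arg lam (cis (- v) * h z)) \<longlongrightarrow> 0) F"
        by (intro tendsto_spiral_Arg_0[OF lam])
      then have "((\<lambda>z. ereal (spiral_Arg lam (cis (- v) * h z))) \<longlongrightarrow> ereal 0) F" by simp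
      then show "Liminf F (\<lambda>z. ereal (spiral_Arg lam (cis (- v) * h z))) = Limsup F (\<lambda>z. ereal (spiral_Arg lam (cis (- v) * h z)))"
        using lim_imp_Liminf[OF Fb] lim_imp_Limsup[OF Fb] by metis
    qed simp
    ultimately show ?thesis using A(4) by blast
  qed
  have more: "\<exists>\<theta>\<^sub>0\<in>{-pi..<pi}. \<forall>z \<beta>.
       (\<forall>n. z n \<in> unit_disc) \<and> z \<longlonglongrightarrow> \<sigma> \<and> (\<lambda>n. Arg (1 - cnj \<sigma> * z n)) \<longlonglongrightarrow> \<beta> \<and> \<beta> \<in> {-pi/2<..<pi/2} \<longrightarrow>
       (\<lambda>n. cis (spiral_Arg lam (h (z n)))) \<longlonglongrightarrow> cis (\<theta>\<^sub>0 + \<beta> * (cmod lam)\<^sup>2 / (\<nu> * Re lam))"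
    if "repelling_spectral_value \<phi> \<sigma> \<nu>" for \<nu>
  \<comment> \<open>The angle sought is the representative of v in the interval from - pi to pi. The
    correction - A * K * \<beta> becomes the stated one by \<nu> = - 1 / A.\<close>
  proof (intro bexI[of _ "spiral_Arg lam (cis v)"] allI impI)
    show "spiral_Arg lam (cis v) \<in> {-pi..<pi}" by (rule spiral_Arg_bounds[OF lam]) simp
    have \<nu>: "A > 0" "\<nu> = - 1 / A" using that rsv by auto
    fix z :: "nat \<Rightarrow> complex" and \<beta> :: real
    assume z: "(\<forall>n. z n \<in> unit_disc) \<and> z \<longlonglongrightarrow> \<sigma> \<and> (\<lambda>n. Arg (1 - cnj \<sigma> * z n)) \<longlonglongrightarrow> \<beta> \<and> \<beta> \<in> {-pi/2<..<pi/2}"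
    have "z n \<noteq> \<sigma>" for n using z \<sigma> by (metis less_irrefl mem_ball_0)
    then have "filterlim z (at \<sigma> within unit_disc) sequentially" using z by (simp add: filterlim_at)
    from filterlim_compose[OF A(3) this]
    have "(\<lambda>n. cis (spiral_Arg lam (h (z n)) + A * K * Arg (1 - cnj \<sigma> * z n)) * cis (- (A * K * Arg (1 - cnj \<sigma> * z n)))) \<longlonglongrightarrow> cis v * cis (- (A * K * \<beta>))"
      by (rule tendsto_mult) (use z in \<open>auto intro!: tendsto_intros\<close>)
    moreover have "cis v * cis (- (A * K * \<beta>)) = cis (spiral_Arg lam (cis v) + \<beta> * (cmod lam)\<^sup>2 / (\<nu> * Re lam))"
      unfolding cis_mult[symmetric] cis_spiral_Arg_cis[OF lam] using \<nu> by (simp add: K_def mult_ac)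
    ultimately show "(\<lambda>n. cis (spiral_Arg lam (h (z n)))) \<longlonglongrightarrow> cis (spiral_Arg lam (cis v) + \<beta> * (cmod lam)\<^sup>2 / (\<nu> * Re lam))"
      by (simp add: cis_mult)
  qed
  show ?thesis
    using eqv[OF order_refl nontangential_le_at_within_ball] eqv[OF nontangential_le_at_within_ball order_refl] more
    unfolding rfp by blast
qed

end
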